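(* Let $V\in C^\infty(\mathbb R;\mathbb R)$ be even, $V(-x)=V(x)$ for all $x$, and suppose $V=V_{\rm per}+V_{\rm def}$ where $V_{\rm per}(x+1)=V_{\rm per}(x)$ for all $x\in\mathbb R$ and $V_{\rm def}(x)=0$ for $|x|>\rho$, for some $\rho>0$. Suppose $H=-\partial_x^2+V$ on $L^2(\mathbb R)$ has a bound state $\Phi\in L^2(\mathbb R)$, $\Phi\neq 0$, $H\Phi=E\Phi$, with $E>0$. Let $H_{\rm trunc}=-\partial_x^2+V_{\rm trunc}$ on $L^2(\mathbb R)$, where $V_{\rm trunc}(x)=V(x)$ for $|x|\le M$ and $V_{\rm trunc}(x)=0$ for $|x|>M$. Then there exist $k>0$ and $M_0>\rho$ such that for all $M\ge M_0$, $H_{\rm trunc}$ has a resonance $z^*$ such that $$\operatorname{Re}z^*=E+\frac{u_E'(M)v_E'(M)+E\,u_E(M)v_E(M)}{\left[(v_E'(M))^2+E(v_E(M))^2\right]\int_0^Mu_E^2(y)\,dy}+O(Me^{-4kM}),$$ $$\operatorname{Im}z^*=\frac{-\sqrt E}{\left[(v_E'(M))^2+E(v_E(M))^2\right]\int_0^Mu_E^2(y)\,dy}+O(Me^{-4kM}).$$ The associated resonant state $\Phi^*$ equals, for $x\ge0$, $$\Phi^*(x)=\begin{cases}u_{z^*}(x),&0\le x\le M,\\ u_{z^*}(M)e^{i\sqrt{z^*}(x-M)},&x>M,\end{cases}$$ and $\Phi^*$ is even (resp. odd) when $\Phi$ is even (resp. odd).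
   Context: Because $V$ is even and $E$ is a non-degenerate eigenvalue, $\Phi$ is either even or odd. For $z\in\mathbb C$, let $u_z$ and $v_z$ be the solutions on $[0,M]$ of $-u''+V(x)u-zu=0$ with initial data: if $\Phi$ is even, $u_z(0)=1,\ u_z'(0)=0$ and $v_z(0)=0,\ v_z'(0)=1$; if $\Phi$ is odd, $u_z(0)=0,\ u_z'(0)=1$ and $v_z(0)=-1,\ v_z'(0)=0$. The square root is defined on $\mathbb C\setminus(-\infty,0]$ with the branch such that $\pm\operatorname{Im}z>0\Rightarrow\pm\operatorname{Im}\sqrt z>0$. Resonances of $H_{\rm trunc}$ are the poles of the resolvent $(H_{\rm trunc}-z)^{-1}$ viewed as a function of $\lambda=\sqrt z$ and meromorphically continued (from $\operatorname{Im}\lambda>0$) to $\operatorname{Im}\lambda<0$. Here a resonance $z^*$ has $\operatorname{Re}z^*>0$, $\operatorname{Im}z^*<0$, and an associated resonant state is a nonzero solution $\Phi^*$ of $-\Phi''+V_{\rm trunc}\Phi=z^*\Phi$ which is outgoing, i.e. a multiple of $e^{i\sqrt{z^*}x}$ for $x>M$ and of $e^{-i\sqrt{z^*}x}$ for $x<-M$. $O(Me^{-4kM})$ means bounded in modulus by $CMe^{-4kM}$ with $C$ independent of $M\ge M_0$. *)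

theory Defs
  imports "HOL-Complex_Analysis.Complex_Analysis"
begin

definition smooth_fun :: "(real \<Rightarrow> real) \<Rightarrow> bool" where
  "smooth_fun V \<longleftrightarrow> (\<forall>n. (deriv ^^ n) V differentiable_on UNIV)"

definition even_fun :: "(real \<Rightarrow> 'a) \<Rightarrow> bool" where
  "even_fun f \<longleftrightarrow> (\<forall>x. f (- x) = f x)"

definition odd_fun :: "(real \<Rightarrow> 'a::uminus) \<Rightarrow> bool" where
  "odd_fun f \<longleftrightarrow> (\<forall>x. f (- x) = - f x)"

definition trunc :: "real \<Rightarrow> (real \<Rightarrow> real) \<Rightarrow> real \<Rightarrow> real" where
  "trunc M V x = (if \<bar>x\<bar> \<le> M then V x else 0)"


subsection \<open>The Schroedinger operator on the line\<close>

definition L2 :: "(real \<Rightarrow> complex) \<Rightarrow> bool" where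
  "L2 f \<longleftrightarrow> f \<in> borel_measurable lborel \<and> integrable lborel (\<lambda>x. (cmod (f x))\<^sup>2)"

definition L2_norm :: "(real \<Rightarrow> complex) \<Rightarrow> real" where
  "L2_norm f = sqrt (LINT x|lborel. (cmod (f x))\<^sup>2)"

definition L2_inner :: "(real \<Rightarrow> complex) \<Rightarrow> (real \<Rightarrow> complex) \<Rightarrow> complex" where
  "L2_inner g f = (LINT x|lborel. cnj (g x) * f x)"

definition L2_comp :: "(real \<Rightarrow> complex) \<Rightarrow> bool" where
  "L2_comp f \<longleftrightarrow> L2 f \<and> (\<exists>r. \<forall>x. \<bar>x\<bar> > r \<longrightarrow> f x = 0)"

text \<open>\<open>has_AC_derivs u u1 u2\<close>: \<open>u\<close> is continuously differentiable with derivative \<open>u1\<close>, which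
  is locally absolutely continuous with almost-everywhere derivative \<open>u2\<close>. Elements of
  \<open>H\<^sup>2(\<real>)\<close> are represented throughout by their unique continuously differentiable
  representative, so that they can be compared pointwise.\<close>

definition has_AC_derivs ::
  "(real \<Rightarrow> complex) \<Rightarrow> (real \<Rightarrow> complex) \<Rightarrow> (real \<Rightarrow> complex) \<Rightarrow> bool" where
  "has_AC_derivs u u1 u2 \<longleftrightarrow>
     (\<forall>x. (u has_vector_derivative u1 x) (at x)) \<and>
     u2 \<in> borel_measurable lborel \<and>
     (\<forall>a b. a \<le> b \<longrightarrow> set_integrable lborel {a..b} u2 \<and>
        u1 b - u1 a = (LINT t:{a..b}|lborel. u2 t))"

text \<open>\<open>schroedinger W u f\<close>: the pair \<open>(u, f)\<close> lies in the graph of the operator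
  \<open>-\<partial>\<^sub>x\<^sup>2 + W\<close> on \<open>L\<^sup>2(\<real>)\<close> with domain \<open>H\<^sup>2(\<real>)\<close> (for bounded \<open>W\<close>).
  As \<open>f\<close> stands for an element of \<open>L\<^sup>2(\<real>)\<close>, it matters only up to null sets.\<close>

definition schroedinger ::
  "(real \<Rightarrow> real) \<Rightarrow> (real \<Rightarrow> complex) \<Rightarrow> (real \<Rightarrow> complex) \<Rightarrow> bool" where
  "schroedinger W u f \<longleftrightarrow> L2 f \<and>
     (\<exists>u1 u2. has_AC_derivs u u1 u2 \<and> L2 u \<and> L2 u1 \<and> L2 u2 \<and>
        (AE x in lborel. - u2 x + of_real (W x) * u x = f x))"

definition bound_state :: "(real \<Rightarrow> real) \<Rightarrow> real \<Rightarrow> (real \<Rightarrow> complex) \<Rightarrow> bool" where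
  "bound_state W E \<Phi> \<longleftrightarrow>
     (\<exists>x. \<Phi> x \<noteq> 0) \<and> schroedinger W \<Phi> (\<lambda>x. of_real E * \<Phi> x)"


subsection \<open>Resolvent and resonances\<close>

definition resolvent_eq ::
  "(real \<Rightarrow> real) \<Rightarrow> complex \<Rightarrow> (real \<Rightarrow> complex) \<Rightarrow> (real \<Rightarrow> complex) \<Rightarrow> bool" where
  "resolvent_eq W z f u \<longleftrightarrow> schroedinger W u (\<lambda>x. f x + z * u x)"

definition resolvent_set :: "(real \<Rightarrow> real) \<Rightarrow> complex set" where
  "resolvent_set W = {z.
     (\<forall>f. L2 f \<longrightarrow> (\<exists>!u. resolvent_eq W z f u)) \<and>
     (\<exists>C. \<forall>f u. L2 f \<longrightarrow> resolvent_eq W z f u \<longrightarrow> L2_norm u \<le> C * L2_norm f)}"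

definition resolvent ::
  "(real \<Rightarrow> real) \<Rightarrow> complex \<Rightarrow> (real \<Rightarrow> complex) \<Rightarrow> (real \<Rightarrow> complex)" where
  "resolvent W z f = (THE u. resolvent_eq W z f u)"

text \<open>\<open>F f g\<close> is the meromorphic continuation in \<open>\<lambda>\<close>, from the upper half plane to the whole
  plane, of the matrix element \<open>\<langle>g, (-\<partial>\<^sub>x\<^sup>2 + W - \<lambda>\<^sup>2)\<inverse> f\<rangle>\<close>. The test functions must have
  compact support because below the real axis the continued resolvent is no longer an operator
  on \<open>L\<^sup>2(\<real>)\<close> but maps compactly supported to locally square-integrable functions. The values
  of \<open>F f g\<close> are prescribed by the resolvent off a discrete subset of the upper half plane, so
  away from poles and removable singularities they are determined everywhere.\<close>

definition resolvent_continuation ::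
  "(real \<Rightarrow> real) \<Rightarrow> ((real \<Rightarrow> complex) \<Rightarrow> (real \<Rightarrow> complex) \<Rightarrow> complex \<Rightarrow> complex) \<Rightarrow> bool" where
  "resolvent_continuation W F \<longleftrightarrow>
     (\<forall>f g. L2_comp f \<longrightarrow> L2_comp g \<longrightarrow>
        F f g meromorphic_on UNIV \<and>
        (\<forall>l. Im l > 0 \<longrightarrow> l\<^sup>2 \<in> resolvent_set W \<longrightarrow>
           F f g l = L2_inner g (resolvent W (l\<^sup>2) f)))"

text \<open>A pole of the operator-valued continuation is a pole of one of its matrix elements. On
  the complement of \<open>(-\<infinity>, 0]\<close> the function \<^const>\<open>csqrt\<close> is the branch of the square root whose
  imaginary part has the sign of \<open>Im z\<close>.\<close>

definition is_resonance :: "(real \<Rightarrow> real) \<Rightarrow> complex \<Rightarrow> bool" where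
  "is_resonance W z \<longleftrightarrow> Im (csqrt z) < 0 \<and>
     (\<exists>F. resolvent_continuation W F \<and>
        (\<exists>f g. L2_comp f \<and> L2_comp g \<and> is_pole (F f g) (csqrt z)))"

text \<open>For a potential \<open>W\<close> supported in \<open>[-M, M]\<close>. As \<open>W\<close> may jump at the endpoints, the
  equation is understood almost everywhere.\<close>

definition resonant_state ::
  "(real \<Rightarrow> real) \<Rightarrow> real \<Rightarrow> complex \<Rightarrow> (real \<Rightarrow> complex) \<Rightarrow> bool" where
  "resonant_state W M z \<Psi> \<longleftrightarrow>
     (\<exists>x. \<Psi> x \<noteq> 0) \<and>
     (\<exists>\<Psi>1 \<Psi>2. has_AC_derivs \<Psi> \<Psi>1 \<Psi>2 \<and>
        (AE x in lborel. - \<Psi>2 x + of_real (W x) * \<Psi> x = z * \<Psi> x)) \<and>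
     (\<exists>c. \<forall>x>M. \<Psi> x = c * exp (\<i> * csqrt z * of_real x)) \<and>
     (\<exists>c. \<forall>x<(- M). \<Psi> x = c * exp (- \<i> * csqrt z * of_real x))"


subsection \<open>The normalised solutions\<close>

text \<open>The classical solution of \<open>-w'' + V w = z w\<close> with \<open>w(0) = a\<close> and \<open>w'(0) = b\<close>. For
  continuous \<open>V\<close> it exists uniquely on the whole line; its restriction to \<open>[0, M]\<close> is the
  solution on that interval for each \<open>M > 0\<close>.\<close>

definition ivp_sol :: "(real \<Rightarrow> real) \<Rightarrow> complex \<Rightarrow> complex \<Rightarrow> complex \<Rightarrow> real \<Rightarrow> complex" where
  "ivp_sol V z a b = (THE w. w 0 = a \<and>
     (\<exists>w'. w' 0 = b \<and>
        (\<forall>x. (w has_vector_derivative w' x) (at x) \<and>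
             (w' has_vector_derivative (of_real (V x) - z) * w x) (at x))))"

text \<open>The else-branches are the case of odd \<open>\<Phi>\<close>: a bound state of an even potential is even
  or odd.\<close>

definition u_sol :: "(real \<Rightarrow> real) \<Rightarrow> (real \<Rightarrow> complex) \<Rightarrow> complex \<Rightarrow> real \<Rightarrow> complex" where
  "u_sol V \<Phi> z = (if even_fun \<Phi> then ivp_sol V z 1 0 else ivp_sol V z 0 1)"

definition v_sol :: "(real \<Rightarrow> real) \<Rightarrow> (real \<Rightarrow> complex) \<Rightarrow> complex \<Rightarrow> real \<Rightarrow> complex" where
  "v_sol V \<Phi> z = (if even_fun \<Phi> then ivp_sol V z 0 1 else ivp_sol V z (-1) 0)"

definition u_sol' :: "(real \<Rightarrow> real) \<Rightarrow> (real \<Rightarrow> complex) \<Rightarrow> complex \<Rightarrow> real \<Rightarrow> complex" where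
  "u_sol' V \<Phi> z x = vector_derivative (u_sol V \<Phi> z) (at x)"

definition v_sol' :: "(real \<Rightarrow> real) \<Rightarrow> (real \<Rightarrow> complex) \<Rightarrow> complex \<Rightarrow> real \<Rightarrow> complex" where
  "v_sol' V \<Phi> z x = vector_derivative (v_sol V \<Phi> z) (at x)"

text \<open>The common denominator \<open>[v\<^sub>E'(M)\<^sup>2 + E v\<^sub>E(M)\<^sup>2] \<integral>\<^sub>0\<^sup>M u\<^sub>E\<^sup>2\<close>. It is a complex number only
  formally: \<open>u\<^sub>E\<close> and \<open>v\<^sub>E\<close> are real-valued for real \<open>E\<close>.\<close>

definition denom :: "(real \<Rightarrow> real) \<Rightarrow> (real \<Rightarrow> complex) \<Rightarrow> real \<Rightarrow> real \<Rightarrow> complex" where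
  "denom V \<Phi> E M =
     ((v_sol' V \<Phi> (of_real E) M)\<^sup>2 + of_real E * (v_sol V \<Phi> (of_real E) M)\<^sup>2) *
     integral {0..M} (\<lambda>y. (u_sol V \<Phi> (of_real E) y)\<^sup>2)"

end

theory Submission imports Defs begin

text \<open>
  The bound state forces \<open>u\<^sub>E\<close> to be the decaying Floquet solution, so \<open>u\<^sub>E\<close> is of size
  \<open>e\<^bsup>-\<kappa>x\<^esup>\<close> and \<open>v\<^sub>E\<close> of size \<open>e\<^bsup>\<kappa>x\<^esup>\<close>. With \<open>\<delta> = z - E\<close>, \<open>A = \<integral>\<^sub>0\<^sup>M u\<^sub>E u\<^sub>z\<close>,
  \<open>B = \<integral>\<^sub>0\<^sup>M v\<^sub>E u\<^sub>z\<close>, variation of parameters turns the outgoing condition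
  \<open>u\<^sub>z'(M) = i \<surd>z u\<^sub>z(M)\<close> into the exact fixed point equation
  \<open>\<delta> = (u\<^sub>E' - i \<surd>z u\<^sub>E)(1 + \<delta> B) / (A (v\<^sub>E' - i \<surd>z v\<^sub>E))\<close> (all functions at \<open>M\<close>),
  which Brouwer's theorem solves in a disc of radius \<open>O(e\<^bsup>-2\<kappa>M\<^esup>)\<close>; putting \<open>z = E\<close>, \<open>\<delta> = 0\<close> on the
  right gives the leading term with error \<open>O(M\<^sup>2 e\<^bsup>-4\<kappa>M\<^esup>)\<close>, and \<open>k = \<kappa>/2\<close> absorbs the extra
  factor \<open>M\<close>.

  For the resolvent, solve the inhomogeneous equation with zero data at \<open>-R\<close> to the left of the source
  and add the multiple of the solution outgoing at \<open>-\<infinity>\<close> that makes the sum outgoing at \<open>R\<close>. This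
  quotient of entire functions of \<open>\<lambda>\<close> is the meromorphic continuation; its denominator vanishes at
  \<open>\<surd>z\<close> for the \<open>z\<close> above.
\<close>

section \<open>A priori bounds for the Schroedinger equation\<close>

text \<open>Two obstacles shape the argument. The truncated potential jumps at -M and M, so
  solutions are only C^1 there. They are handled through the integrated equation, and identities of
  the truncated problem that need second derivatives are confined to [-M, M]. Moreover, every
  estimate has to be uniform in M, while Gronwall over [0, M] would lose a factor exponential in M;
  near E it is replaced by a bootstrap in the weight e^(kappa x), driven by the bounds on u_E and
  v_E.

  The quantity M^3 e^(-2 kappa M) controls smallness throughout: up to constants the leading
  imaginary part is at least e^(-2 kappa M) / M, the error is at most M^2 e^(-4 kappa M), and Im z <
  0 requires their ratio to be small. Brouwer's theorem asks only for continuity in z, so no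
  Lipschitz bound for the fixed point map enters.

  A resonance is a pole of the continued resolvent, so an outgoing state alone does not suffice: the
  zero of the denominator must not be cancelled by the numerator, which dictates the choice of test
  functions.\<close>

lemma gronwall_forward:
  fixes g :: "real \<Rightarrow> real"
  assumes cont: "continuous_on {a..b} g" and K: "K \<ge> 0"
    and le: "\<And>x. x \<in> {a..b} \<Longrightarrow> g x \<le> C + K * integral {a..x} g"
    and x: "x \<in> {a..b}"
  shows "g x \<le> C * exp (K * (x - a))"
proof -
  define h where "h = (\<lambda>x. exp (- K * (x - a)) * (C + K * integral {a..x} g))"
  have G: "((\<lambda>x. integral {a..x} g) has_real_derivative g t) (at t within {a..b})" if "t \<in> {a..b}" for t
    using integral_has_vector_derivative[OF cont that]
    by (simp add: has_real_derivative_iff_has_vector_derivative)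
  have hd: "(h has_real_derivative
      exp (- K * (t - a)) * (K * g t - K * (C + K * integral {a..t} g))) (at t within {a..b})"
    if "t \<in> {a..b}" for t
    unfolding h_def
    by (rule derivative_eq_intros G that refl | simp add: algebra_simps)+
  have "h x \<le> h a"
  proof (rule DERIV_nonpos_imp_decreasing_open[of a x])
    show "a \<le> x" using x by simp
    show "continuous_on {a..x} h"
      by (rule continuous_on_subset[of "{a..b}"])
        (use x in \<open>auto intro!: DERIV_continuous_on hd\<close>)
    fix t assume t: "a < t" "t < x"
    then have "(h has_real_derivative
      exp (- K * (t - a)) * (K * g t - K * (C + K * integral {a..t} g))) (at t)"
      using hd[of t] x by (simp add: at_within_Icc_at)
    moreover have "K * g t \<le> K * (C + K * integral {a..t} g)"
      using le[of t] t x K by (intro mult_left_mono) auto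
    ultimately show "\<exists>y. (h has_real_derivative y) (at t) \<and> y \<le> 0"
      by (intro exI conjI) (auto intro!: mult_nonneg_nonpos)
  qed
  then have "exp (- K * (x - a)) * (C + K * integral {a..x} g) \<le> C"
    by (simp add: h_def)
  then have "exp (K * (x - a)) * (exp (- K * (x - a)) * (C + K * integral {a..x} g))
      \<le> exp (K * (x - a)) * C"
    by (intro mult_left_mono) auto
  then have "C + K * integral {a..x} g \<le> C * exp (K * (x - a))"
    by (simp add: mult.assoc[symmetric] exp_add[symmetric] mult.commute)
  with le[OF x] show ?thesis by linarith
qed

text \<open>Increments are bounded between arbitrary pairs of points, and in absolute value, so that
  the hypothesis survives reflection of the line. Replacing y - a by b - a in the source term
  reduces it to the form of \<open>gronwall_forward\<close>.\<close>

lemma gronwall_right: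
  fixes g :: "real \<Rightarrow> real"
  assumes cont: "continuous_on {a..b} g" and K: "K \<ge> 0" and S: "S \<ge> 0"
    and ga: "g a = 0"
    and le: "\<And>x y. a \<le> x \<Longrightarrow> x \<le> y \<Longrightarrow> y \<le> b \<Longrightarrow>
      \<bar>g y - g x\<bar> \<le> integral {x..y} (\<lambda>t. K * g t + S)"
    and x: "x \<in> {a..b}"
  shows "g x \<le> S * (b - a) * exp (K * (b - a))"
proof -
  have "g y \<le> S * (b - a) + K * integral {a..y} g" if y: "y \<in> {a..b}" for y
  proof -
    have gi: "g integrable_on {a..y}"
      by (rule integrable_continuous_real, rule continuous_on_subset[OF cont]) (use y in auto)
    have "g y \<le> integral {a..y} (\<lambda>t. K * g t + S)"
      using le[of a y] y ga by auto
    also have "\<dots> = K * integral {a..y} g + S * (y - a)"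
      using y gi by (subst integral_add) (auto intro: integrable_on_mult_right)
    also have "\<dots> \<le> K * integral {a..y} g + S * (b - a)"
      using y S by (auto intro!: mult_left_mono)
    finally show ?thesis by simp
  qed
  from gronwall_forward[OF cont K this x]
  have "g x \<le> S * (b - a) * exp (K * (x - a))" .
  also have "\<dots> \<le> S * (b - a) * exp (K * (b - a))"
    using x S K by (intro mult_left_mono) (auto intro!: mult_left_mono)
  finally show ?thesis .
qed

lemma gronwall_two_sided:
  fixes g :: "real \<Rightarrow> real"
  assumes cont: "continuous_on {a..b} g" and K: "K \<ge> 0" and S: "S \<ge> 0"
    and x0: "x0 \<in> {a..b}" and g0: "g x0 = 0"
    and le: "\<And>x y. a \<le> x \<Longrightarrow> x \<le> y \<Longrightarrow> y \<le> b \<Longrightarrow>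
      \<bar>g y - g x\<bar> \<le> integral {x..y} (\<lambda>t. K * g t + S)"
    and x: "x \<in> {a..b}"
  shows "g x \<le> S * (b - a) * exp (K * (b - a))"
proof -
  \<comment> \<open>\<open>r\<close> is the length of the part of the interval on the side of
    \<open>x0\<close> where \<open>x\<close> lies; enlarging it to b - a gives one bound for both
    sides.\<close>
  have *: "g x \<le> S * r * exp (K * r) \<Longrightarrow> 0 \<le> r \<Longrightarrow> r \<le> b - a \<Longrightarrow> ?thesis" for r
    using S K by (elim order_trans) (intro mult_mono, auto intro: mult_left_mono)
  show ?thesis
  proof (cases "x0 \<le> x")
    case True
    have "g x \<le> S * (b - x0) * exp (K * (b - x0))"
      by (rule gronwall_right[where g = g and a = x0 and x = x, OF _ K S g0])
        (use x0 x True le in \<open>auto intro: continuous_on_subset[OF cont]\<close>)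
    then show ?thesis using * x0 by auto
  next
    case False
    have "(\<lambda>t. g (- t)) (- x) \<le> S * (- a - (- x0)) * exp (K * (- a - (- x0)))"
    proof (rule gronwall_right[where g = "\<lambda>t. g (- t)" and K = K and S = S and x = "- x"])
      show "continuous_on {- x0..- a} (\<lambda>t. g (- t))"
        by (rule continuous_on_compose2[OF cont]) (use x0 in \<open>auto intro!: continuous_intros\<close>)
      fix y z assume "- x0 \<le> y" "y \<le> z" "z \<le> - a"
      then show "\<bar>g (- z) - g (- y)\<bar> \<le> integral {y..z} (\<lambda>t. K * g (- t) + S)"
        using le[of "- z" "- y"] x0 Henstock_Kurzweil_Integration.integral_reflect_real[of "-y" "-z" "\<lambda>t. K * g t + S"]
        by (auto simp: abs_minus_commute)
    qed (use g0 x False K S in auto)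
    then show ?thesis using *[of "x0 - a"] x0 by auto
  qed
qed

text \<open>The equation w'' = q w - f in integrated form. The integral is that of Henstock and
  Kurzweil and so insensitive to null sets, and the derivative is taken within the interval, so a
  potential may jump at the ends.\<close>

definition weak_sol ::
  "(real \<Rightarrow> complex) \<Rightarrow> (real \<Rightarrow> complex) \<Rightarrow> (real \<Rightarrow> complex) \<Rightarrow> (real \<Rightarrow> complex) \<Rightarrow>
   real \<Rightarrow> real \<Rightarrow> bool" where
  "weak_sol q f w w1 a b \<longleftrightarrow>
     (\<forall>x\<in>{a..b}. (w has_vector_derivative w1 x) (at x within {a..b})) \<and>
     (\<forall>x y. a \<le> x \<longrightarrow> x \<le> y \<longrightarrow> y \<le> b \<longrightarrow>
        ((\<lambda>t. q t * w t - f t) has_integral (w1 y - w1 x)) {x..y})"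

lemma weak_sol_deriv:
  "weak_sol q f w w1 a b \<Longrightarrow> x \<in> {a..b} \<Longrightarrow> (w has_vector_derivative w1 x) (at x within {a..b})"
  by (simp add: weak_sol_def)

lemma weak_sol_integral:
  "weak_sol q f w w1 a b \<Longrightarrow> a \<le> x \<Longrightarrow> x \<le> y \<Longrightarrow> y \<le> b \<Longrightarrow>
    ((\<lambda>t. q t * w t - f t) has_integral (w1 y - w1 x)) {x..y}"
  by (simp add: weak_sol_def)

lemma weak_sol_cont:
  assumes "weak_sol q f w w1 a b"
  shows "continuous_on {a..b} w" "continuous_on {a..b} w1"
proof -
  show "continuous_on {a..b} w"
    using weak_sol_deriv[OF assms] by (intro continuous_on_vector_derivative)
  show "continuous_on {a..b} w1"
  proof (cases "a \<le> b")
    case True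
    have "(\<lambda>t. q t * w t - f t) integrable_on {a..b}"
      using weak_sol_integral[OF assms, of a b] True by auto
    then have "continuous_on {a..b} (\<lambda>x. w1 a + integral {a..x} (\<lambda>t. q t * w t - f t))"
      by (intro continuous_intros indefinite_integral_continuous_1)
    then show ?thesis
    proof (rule continuous_on_eq)
      fix x assume "x \<in> {a..b}"
      then show "w1 a + integral {a..x} (\<lambda>t. q t * w t - f t) = w1 x"
        using integral_unique[OF weak_sol_integral[OF assms, of a x]] by auto
    qed
  qed auto
qed

lemma weak_sol_subset:
  assumes "weak_sol q f w w1 a b" "a \<le> c" "d \<le> b"
  shows "weak_sol q f w w1 c d"
  using assms unfolding weak_sol_def
  by (auto intro: has_vector_derivative_within_subset[of _ _ _ "{a..b}" "{c..d}"])

text \<open>The endpoints form a null set. At R = M the truncated potential still has the value of V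
  at the endpoint, so agreement with the zero potential on a tail holds only in the
  interior.\<close>

lemma weak_sol_cong:
  assumes "weak_sol q f w w1 a b"
    and "\<And>t. t \<in> {a<..<b} \<Longrightarrow> q t * w t - f t = q' t * w t - f' t"
  shows "weak_sol q' f' w w1 a b"
  unfolding weak_sol_def
proof (intro conjI ballI allI impI)
  fix x assume "x \<in> {a..b}"
  then show "(w has_vector_derivative w1 x) (at x within {a..b})"
    using assms(1) by (simp add: weak_sol_def)
next
  fix x y assume xy: "a \<le> x" "x \<le> y" "y \<le> b"
  show "((\<lambda>t. q' t * w t - f' t) has_integral (w1 y - w1 x)) {x..y}"
    by (rule has_integral_spike_finite[OF _ _ weak_sol_integral[OF assms(1) xy], of "{a,b}"])
      (use assms(2) xy in \<open>auto simp: less_le\<close>)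
qed

text \<open>The two potentials may differ from each other and from the resulting one, the mismatch
  being moved into the source. This is how solutions at different spectral parameters are
  compared.\<close>

lemma weak_sol_lincomb:
  assumes "weak_sol q f w w1 a b" "weak_sol q' f' y y1 a b"
    and "\<And>t. t \<in> {a..b} \<Longrightarrow>
      q'' t * (c * w t + d * y t) - f'' t = c * (q t * w t - f t) + d * (q' t * y t - f' t)"
  shows "weak_sol q'' f'' (\<lambda>t. c * w t + d * y t) (\<lambda>t. c * w1 t + d * y1 t) a b"
  unfolding weak_sol_def
proof (intro conjI ballI allI impI)
  fix x assume "x \<in> {a..b}"
  then show "((\<lambda>t. c * w t + d * y t) has_vector_derivative c * w1 x + d * y1 x) (at x within {a..b})"
    using weak_sol_deriv[OF assms(1)] weak_sol_deriv[OF assms(2)]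
    by (intro has_vector_derivative_add has_vector_derivative_mult_right) auto
next
  fix x z assume xy: "a \<le> x" "x \<le> z" "z \<le> b"
  have "((\<lambda>t. c * (q t * w t - f t) + d * (q' t * y t - f' t)) has_integral
      (c * (w1 z - w1 x) + d * (y1 z - y1 x))) {x..z}"
    by (intro has_integral_add has_integral_mult_right
        weak_sol_integral[OF assms(1) xy] weak_sol_integral[OF assms(2) xy])
  then have "((\<lambda>t. q'' t * (c * w t + d * y t) - f'' t) has_integral
      (c * (w1 z - w1 x) + d * (y1 z - y1 x))) {x..z}"
    by (rule has_integral_eq[rotated]) (use assms(3) xy in auto)
  then show "((\<lambda>t. q'' t * (c * w t + d * y t) - f'' t) has_integral
      (c * w1 z + d * y1 z - (c * w1 x + d * y1 x))) {x..z}"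
    by (simp add: algebra_simps)
qed

lemma weak_sol_diff:
  assumes "weak_sol q f w w1 a b" "weak_sol q f y y1 a b"
  shows "weak_sol q (\<lambda>_. 0) (\<lambda>t. w t - y t) (\<lambda>t. w1 t - y1 t) a b"
  using weak_sol_lincomb[OF assms, of q 1 "-1" "\<lambda>_. 0"] by (simp add: algebra_simps)

lemma weak_sol_scale:
  assumes "weak_sol q (\<lambda>_. 0) w w1 a b"
  shows "weak_sol q (\<lambda>_. 0) (\<lambda>t. c * w t) (\<lambda>t. c * w1 t) a b"
  using weak_sol_lincomb[OF assms assms, of q c 0 "\<lambda>_. 0"] by (simp add: algebra_simps)

text \<open>Gronwall for the first order system: w changes at rate at most |w1| and w1 at rate at
  most Q |w| + S, so |w| + |w1| changes at rate at most (1 + Q) (|w| + |w1|) + S.\<close>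

lemma weak_sol_bound:
  assumes sol: "weak_sol q f w w1 a b" and x0: "x0 \<in> {a..b}" "w x0 = 0" "w1 x0 = 0"
    and q: "\<And>t. t \<in> {a..b} \<Longrightarrow> cmod (q t) \<le> Q"
    and f: "\<And>t. t \<in> {a..b} \<Longrightarrow> cmod (f t) \<le> S"
    and x: "x \<in> {a..b}"
  shows "cmod (w x) + cmod (w1 x) \<le> S * (b - a) * exp ((1 + Q) * (b - a))"
proof -
  note c = weak_sol_cont[OF sol]
  have cg: "continuous_on {a..b} (\<lambda>x. cmod (w x) + cmod (w1 x))"
    by (intro continuous_intros c)
  have QS: "0 \<le> Q" "0 \<le> S" using q[OF x0(1)] f[OF x0(1)] norm_ge_zero order_trans by blast+
  have step: "\<bar>cmod (w t) + cmod (w1 t) - (cmod (w s) + cmod (w1 s))\<bar>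
      \<le> integral {s..t} (\<lambda>r. (1 + Q) * (cmod (w r) + cmod (w1 r)) + S)"
    if st: "a \<le> s" "s \<le> t" "t \<le> b" for s t
  proof -
  have sub: "{s..t} \<subseteq> {a..b}" using st by auto
  note c' = continuous_on_subset[OF c(1) sub] continuous_on_subset[OF c(2) sub]
  have wi: "(w1 has_integral (w t - w s)) {s..t}"
    by (rule fundamental_theorem_of_calculus[OF st(2)])
      (use weak_sol_deriv[OF weak_sol_subset[OF sol st(1,3)]] in auto)
  have 1: "cmod (w t - w s) \<le> integral {s..t} (\<lambda>r. cmod (w1 r))"
    using integral_norm_bound_integral[of w1 "{s..t}" "\<lambda>r. cmod (w1 r)"] wi
    by (auto simp: integral_unique intro!: integrable_continuous_real continuous_intros c')
  note hi = weak_sol_integral[OF sol st]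
  have 2: "cmod (w1 t - w1 s) \<le> integral {s..t} (\<lambda>r. Q * cmod (w r) + S)"
    unfolding integral_unique[OF hi, symmetric]
  proof (rule integral_norm_bound_integral)
    show "(\<lambda>r. q r * w r - f r) integrable_on {s..t}" using hi by auto
    show "(\<lambda>r. Q * cmod (w r) + S) integrable_on {s..t}"
      by (intro integrable_continuous_real continuous_intros c')
    fix r assume "r \<in> {s..t}"
    then have r: "r \<in> {a..b}" using sub by auto
    have "cmod (q r * w r - f r) \<le> cmod (q r) * cmod (w r) + cmod (f r)"
      by (metis norm_mult norm_triangle_ineq4)
    also have "\<dots> \<le> Q * cmod (w r) + S"
      by (intro add_mono mult_right_mono q f r) auto
    finally show "cmod (q r * w r - f r) \<le> Q * cmod (w r) + S" .
  qed
  have "\<bar>cmod (w t) + cmod (w1 t) - (cmod (w s) + cmod (w1 s))\<bar>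
      \<le> cmod (w t - w s) + cmod (w1 t - w1 s)"
    using norm_triangle_ineq3[of "w t" "w s"] norm_triangle_ineq3[of "w1 t" "w1 s"] by linarith
  also have "\<dots> \<le> integral {s..t} (\<lambda>r. cmod (w1 r)) + integral {s..t} (\<lambda>r. Q * cmod (w r) + S)"
    using 1 2 by linarith
  also have "\<dots> = integral {s..t} (\<lambda>r. cmod (w1 r) + (Q * cmod (w r) + S))"
    by (rule integral_add[symmetric]) (intro integrable_continuous_real continuous_intros c')+
  also have "\<dots> \<le> integral {s..t} (\<lambda>r. (1 + Q) * (cmod (w r) + cmod (w1 r)) + S)"
  proof (rule integral_le)
    fix r assume "r \<in> {s..t}"
    have "0 \<le> cmod (w r) + Q * cmod (w1 r)" using QS by simp
    then show "cmod (w1 r) + (Q * cmod (w r) + S) \<le> (1 + Q) * (cmod (w r) + cmod (w1 r)) + S"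
      by (simp add: algebra_simps)
  qed (intro integrable_continuous_real continuous_intros c')+
  finally show ?thesis .
  qed
  show ?thesis
    using gronwall_two_sided[OF cg _ QS(2) x0(1) _ step x] x0 QS by auto
qed

lemma weak_sol_unique:
  assumes "weak_sol q f w w1 a b" "weak_sol q f y y1 a b"
    and x0: "x0 \<in> {a..b}" "w x0 = y x0" "w1 x0 = y1 x0"
    and q: "\<And>t. t \<in> {a..b} \<Longrightarrow> cmod (q t) \<le> Q"
    and x: "x \<in> {a..b}"
  shows "w x = y x" "w1 x = y1 x"
proof -
  have "cmod (w x - y x) + cmod (w1 x - y1 x) \<le> 0"
    using weak_sol_bound[OF weak_sol_diff[OF assms(1,2)] x0(1) _ _ q _ x, of 0] x0(2,3) by simp
  then show "w x = y x" "w1 x = y1 x"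
    by (smt (verit) norm_ge_zero norm_eq_zero right_minus_eq)+
qed

section \<open>Existence of solutions\<close>

definition prim :: "real \<Rightarrow> (real \<Rightarrow> complex) \<Rightarrow> real \<Rightarrow> complex" where
  "prim x0 h x = (if x0 \<le> x then integral {x0..x} h else - integral {x..x0} h)"

lemma prim_self [simp]: "prim x0 h x0 = 0"
  by (simp add: prim_def)

lemma prim_has_integral:
  assumes "\<And>a b. h integrable_on {a..b}" "x \<le> y"
  shows "(h has_integral (prim x0 h y - prim x0 h x)) {x..y}"
proof -
  have c: "integral {a..c} h + integral {c..b} h = integral {a..b} h" if "a \<le> c" "c \<le> b" for a b c
    by (rule Henstock_Kurzweil_Integration.integral_combine[OF that assms(1)])
  have "prim x0 h y - prim x0 h x = integral {x..y} h"
    using c[of x0 x y] c[of x x0 y] c[of x y x0] assms(2) by (auto simp: prim_def algebra_simps)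
  then show ?thesis using assms(1)[of x y] by (simp add: has_integral_integral)
qed

lemma prim_deriv:
  assumes "continuous_on UNIV h"
  shows "(prim x0 h has_vector_derivative h x) (at x)"
proof -
  have i: "h integrable_on {a..b}" for a b
    by (rule integrable_continuous_real, rule continuous_on_subset[OF assms]) auto
  have "((\<lambda>t. integral {x-1..t} h) has_vector_derivative h x) (at x within {x-1..x+1})"
    by (rule integral_has_vector_derivative) (auto intro: continuous_on_subset[OF assms])
  then have "((\<lambda>t. prim x0 h (x-1) + integral {x-1..t} h) has_vector_derivative h x)
      (at x within {x-1..x+1})"
    by (auto intro!: derivative_eq_intros)
  then have "(prim x0 h has_vector_derivative h x) (at x within {x-1..x+1})"
  proof (rule has_vector_derivative_transform[rotated -1])
    fix t assume "t \<in> {x-1..x+1}"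
    then show "prim x0 h t = prim x0 h (x-1) + integral {x-1..t} h"
      using integral_unique[OF prim_has_integral[OF i, of "x-1" t x0]] by auto
  qed auto
  then show ?thesis by (simp add: at_within_Icc_at)
qed

lemma prim_cont:
  assumes i: "\<And>a b. h integrable_on {a..b}"
  shows "continuous_on UNIV (prim x0 h)"
proof -
  have "isCont (prim x0 h) x" for x
  proof -
    have "continuous_on {x-1..x+1} (\<lambda>t. prim x0 h (x-1) + integral {x-1..t} h)"
      by (intro continuous_intros indefinite_integral_continuous_1 i)
    then have "continuous_on {x-1..x+1} (prim x0 h)"
    proof (rule continuous_on_eq)
      fix t assume "t \<in> {x-1..x+1}"
      then show "prim x0 h (x-1) + integral {x-1..t} h = prim x0 h t"
        using integral_unique[OF prim_has_integral[OF i, of "x-1" t x0]] by auto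
    qed
    then show ?thesis by (rule continuous_on_interior) (auto simp: interior_atLeastAtMost_real)
  qed
  then show ?thesis by (simp add: continuous_on_eq_continuous_at)
qed

text \<open>In the sup norm with weight exp (L |t - x0|) one integration gains the factor 1 / L.
  This makes the Volterra equation a contraction on the whole line at once, with no gluing of short
  intervals.\<close>

lemma prim_bound:
  assumes i: "\<And>a b. h integrable_on {a..b}"
    and le: "\<And>t. cmod (h t) \<le> B * exp (L * \<bar>t - x0\<bar>)" and L: "L > 0"
  shows "cmod (prim x0 h x) \<le> B / L * exp (L * \<bar>x - x0\<bar>)"
proof -
  have B: "B \<ge> 0" using order_trans[OF norm_ge_zero le[of x0]] by simp
  show ?thesis
  proof (cases "x0 \<le> x")
    case True
    have nb: "cmod (integral {x0..x} h) \<le> integral {x0..x} (\<lambda>t. B * exp (L * (t - x0)))"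
    proof (intro integral_norm_bound_integral i)
      fix t assume "t \<in> {x0..x}"
      then show "cmod (h t) \<le> B * exp (L * (t - x0))" using le[of t] by auto
    qed (auto intro!: integrable_continuous_real continuous_intros)
    have "((\<lambda>t. B * exp (L * (t - x0))) has_integral
        (B / L * exp (L * (x - x0)) - B / L * exp (L * (x0 - x0)))) {x0..x}"
      by (rule fundamental_theorem_of_calculus[OF True])
        (use L in \<open>auto intro!: derivative_eq_intros simp: has_real_derivative_iff_has_vector_derivative[symmetric] field_simps\<close>)
    from integral_unique[OF this] have "integral {x0..x} (\<lambda>t. B * exp (L * (t - x0))) = B / L * exp (L * (x - x0)) - B / L"
      by simp
    moreover have "B / L \<ge> 0" using B L by simp
    ultimately show ?thesis using True nb
      by (simp add: prim_def)
  next
    case False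
    then have le': "x \<le> x0" by simp
    have nb: "cmod (integral {x..x0} h) \<le> integral {x..x0} (\<lambda>t. B * exp (L * (x0 - t)))"
    proof (intro integral_norm_bound_integral i)
      fix t assume "t \<in> {x..x0}"
      then show "cmod (h t) \<le> B * exp (L * (x0 - t))" using le[of t] by (auto simp: abs_of_nonpos)
    qed (auto intro!: integrable_continuous_real continuous_intros)
    have "((\<lambda>t. B * exp (L * (x0 - t))) has_integral
        ((- (B / L) * exp (L * (x0 - x0))) - (- (B / L) * exp (L * (x0 - x))))) {x..x0}"
      by (rule fundamental_theorem_of_calculus[OF le'])
        (auto intro!: derivative_eq_intros simp: has_real_derivative_iff_has_vector_derivative[symmetric] less_imp_neq[OF L, symmetric] field_simps)
    from integral_unique[OF this] have "integral {x..x0} (\<lambda>t. B * exp (L * (x0 - t))) = B / L * exp (L * (x0 - x)) - B / L"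
      by simp
    moreover have "B / L \<ge> 0" using B L by simp
    ultimately show ?thesis using False nb
      by (simp add: prim_def)
  qed
qed

lemma prim_diff_fun:
  assumes "\<And>a b. h integrable_on {a..b}" "\<And>a b. k integrable_on {a..b}"
  shows "prim x0 h x - prim x0 k x = prim x0 (\<lambda>t. h t - k t) x"
  using assms by (auto simp: prim_def Henstock_Kurzweil_Integration.integral_diff)

lemma set_integrable_bounded_mult:
  fixes q w :: "real \<Rightarrow> complex"
  assumes q: "q \<in> borel_measurable borel" "\<And>t. cmod (q t) \<le> Q"
    and w: "continuous_on UNIV w"
  shows "set_integrable lborel {a..b} (\<lambda>t. q t * w t)"
proof -
  have wi: "set_integrable lborel {a..b} (\<lambda>t. Q * w t)"
    by (intro borel_integrable_compact[unfolded set_integrable_def[symmetric]])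
      (auto intro!: continuous_intros continuous_on_subset[OF w])
  have wm: "w \<in> borel_measurable borel"
    using w by (rule borel_measurable_continuous_onI)
  show ?thesis
    unfolding set_integrable_def
  proof (rule Bochner_Integration.integrable_bound[OF wi[unfolded set_integrable_def]])
    show "(\<lambda>t. indicat_real {a..b} t *\<^sub>R (q t * w t)) \<in> borel_measurable lborel"
      using q(1) wm by simp
    have "0 \<le> Q" using q(2) norm_ge_zero order_trans by blast
    then show "AE t in lborel. norm (indicat_real {a..b} t *\<^sub>R (q t * w t))
        \<le> norm (indicat_real {a..b} t *\<^sub>R (Q * w t))"
      using q(2) by (auto simp: norm_mult indicator_def intro!: mult_right_mono AE_I2)
  qed
qed

lemma norm_integral_le_L1:
  fixes f :: "real \<Rightarrow> complex"
  assumes f: "integrable lborel f"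
  shows "f integrable_on {a..b}" "cmod (integral {a..b} f) \<le> (LINT t|lborel. cmod (f t))"
proof -
  have s: "set_integrable lborel {a..b} f"
    unfolding set_integrable_def by (intro integrable_mult_indicator f) auto
  show "f integrable_on {a..b}" by (rule set_borel_integral_eq_integral[OF s])
  have "cmod (integral {a..b} f) = cmod (LINT t:{a..b}|lborel. f t)"
    using set_borel_integral_eq_integral(2)[OF s] by simp
  also have "\<dots> \<le> (LINT t|lborel. cmod (indicat_real {a..b} t *\<^sub>R f t))"
    unfolding set_lebesgue_integral_def by (rule integral_norm_bound)
  also have "\<dots> \<le> (LINT t|lborel. cmod (f t))"
    using f s by (intro integral_mono integrable_norm) (auto simp: set_integrable_def indicator_def)
  finally show "cmod (integral {a..b} f) \<le> (LINT t|lborel. cmod (f t))" .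
qed

text \<open>Picard iteration in Bielecki's weighted norm. The unknown is the solution divided by the
  weight, which stays bounded and continuous; a source integrable over the line contributes at most
  its L1 norm to w1.\<close>

lemma schroedinger_ivp_exists:
  fixes q f :: "real \<Rightarrow> complex"
  assumes q: "q \<in> borel_measurable borel" "\<And>t. cmod (q t) \<le> Q"
    and f: "integrable lborel f"
  obtains w w1 where "w x0 = A" "w1 x0 = B" "has_AC_derivs w w1 (\<lambda>t. q t * w t - f t)"
proof -
  define F where "F = (LINT t|lborel. cmod (f t))"
  have F0: "F \<ge> 0" by (simp add: F_def)
  have Q0: "Q \<ge> 0" using q(2) norm_ge_zero order_trans by blast
  \<comment> \<open>Two integrations give the Lipschitz constant Q / L^2, and (Q + 1)^2 > Q.\<close>
  define L where "L = Q + 1"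
  have L: "L > 0" "L \<ge> 1" using Q0 by (auto simp: L_def)
  define wt where "wt = (\<lambda>x. exp (L * \<bar>x - x0\<bar>))"
  have wt: "continuous_on UNIV wt" "\<And>x. wt x > 0" "\<And>x. wt x \<ge> 1"
    using L by (auto simp: wt_def intro!: continuous_intros)
  define H where "H = (\<lambda>g t. q t * (complex_of_real (wt t) * g t) - f t)"
  have Hs: "set_integrable lborel {a..b} (H g)" if "continuous_on UNIV g" for g a b
  proof -
    have "set_integrable lborel {a..b} f"
      unfolding set_integrable_def by (intro integrable_mult_indicator f) auto
    moreover have "set_integrable lborel {a..b} (\<lambda>t. q t * (complex_of_real (wt t) * g t))"
      by (rule set_integrable_bounded_mult[OF q]) (intro continuous_intros wt that)
    ultimately show ?thesis unfolding H_def by (rule set_integral_diff(1)[rotated])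
  qed
  have Hi: "H g integrable_on {a..b}" if "continuous_on UNIV g" for g a b
    using set_borel_integral_eq_integral(1)[OF Hs[OF that]] .
  have qi: "(\<lambda>t. q t * (complex_of_real (wt t) * g t)) integrable_on {a..b}"
    if "continuous_on UNIV g" for g a b
    by (rule set_borel_integral_eq_integral(1), rule set_integrable_bounded_mult[OF q])
      (intro continuous_intros wt that)
  define W1 where "W1 = (\<lambda>g t. B + prim x0 (H g) t)"
  have W1c: "continuous_on UNIV (W1 g)" if "continuous_on UNIV g" for g
    unfolding W1_def by (intro continuous_intros prim_cont Hi that)
  have W1i: "W1 g integrable_on {a..b}" if "continuous_on UNIV g" for g a b
    by (rule integrable_continuous_real, rule continuous_on_subset[OF W1c[OF that]]) auto
  define T where "T = (\<lambda>g x. (A + prim x0 (W1 g) x) / complex_of_real (wt x))"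
  have Tc: "continuous_on UNIV (T g)" if "continuous_on UNIV g" for g
    unfolding T_def using wt(2)
    by (intro continuous_intros prim_cont W1i that wt) (auto simp: less_le)
  have T_lip: "cmod (T g x - T h x) \<le> Q / L\<^sup>2 * D"
    if g: "continuous_on UNIV g" and h: "continuous_on UNIV h"
      and d: "\<And>t. cmod (g t - h t) \<le> D" for g h x D
  proof -
    have "cmod (W1 g t - W1 h t) \<le> Q * D / L * exp (L * \<bar>t - x0\<bar>)" for t
    proof -
      have "W1 g t - W1 h t = prim x0 (\<lambda>s. H g s - H h s) t"
        unfolding W1_def using prim_diff_fun[OF Hi[OF g] Hi[OF h]] by simp
      also have "cmod \<dots> \<le> Q * D / L * exp (L * \<bar>t - x0\<bar>)"
      proof (rule prim_bound[OF _ _ L(1)])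
        show "(\<lambda>s. H g s - H h s) integrable_on {a..b}" for a b
          by (intro integrable_diff Hi g h)
        fix s
        have "H g s - H h s = q s * (wt s * (g s - h s))" by (simp add: H_def algebra_simps)
        also have "cmod \<dots> \<le> Q * (wt s * D)"
          unfolding norm_mult using q(2)[of s] d[of s] wt(2)[of s] Q0
          by (intro mult_mono) auto
        finally show "cmod (H g s - H h s) \<le> Q * D * exp (L * \<bar>s - x0\<bar>)"
          by (simp add: wt_def mult_ac)
      qed
      finally show ?thesis .
    qed
    then have "cmod (prim x0 (\<lambda>t. W1 g t - W1 h t) x) \<le> Q * D / L / L * exp (L * \<bar>x - x0\<bar>)"
      by (intro prim_bound integrable_diff W1i g h L)
    moreover have "T g x - T h x = prim x0 (\<lambda>t. W1 g t - W1 h t) x / wt x"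
      using prim_diff_fun[OF W1i[OF g] W1i[OF h]] by (simp add: T_def diff_divide_distrib[symmetric])
    ultimately have "cmod (T g x - T h x) \<le> Q * D / L / L * wt x / wt x"
      using wt(2)[of x] by (simp only: norm_divide norm_of_real abs_of_pos wt_def divide_right_mono less_imp_le)
    then show ?thesis using wt(2)[of x] by (simp add: power2_eq_square less_imp_neq[OF wt(2), symmetric])
  qed
  have T0: "cmod (T (\<lambda>_. 0) x) \<le> cmod A + (cmod B + F) / L" for x
  proof -
    have "cmod (W1 (\<lambda>_. 0) t) \<le> (cmod B + F) * exp (L * \<bar>t - x0\<bar>)" for t
    proof -
      have "cmod (prim x0 (H (\<lambda>_. 0)) t) \<le> F"
        using norm_integral_le_L1(2)[OF f] by (auto simp: H_def prim_def F_def)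
      then have "cmod (W1 (\<lambda>_. 0) t) \<le> cmod B + F"
        unfolding W1_def by (meson add_left_mono norm_triangle_ineq order_trans)
      also have "\<dots> \<le> (cmod B + F) * exp (L * \<bar>t - x0\<bar>)"
        using F0 L mult_left_mono[of 1 "exp (L * \<bar>t - x0\<bar>)" "cmod B + F"] by simp
      finally show ?thesis .
    qed
    then have "cmod (prim x0 (W1 (\<lambda>_. 0)) x) \<le> (cmod B + F) / L * wt x"
      unfolding wt_def by (intro prim_bound W1i L) auto
    then have "cmod (A + prim x0 (W1 (\<lambda>_. 0)) x) \<le> cmod A * wt x + (cmod B + F) / L * wt x"
      using mult_left_mono[OF wt(3)[of x], of "cmod A"] norm_triangle_ineq[of A "prim x0 (W1 (\<lambda>_. 0)) x"]
      by simp
    then show ?thesis using wt(2)[of x]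
      by (simp add: T_def norm_divide divide_le_eq algebra_simps)
  qed
  have Tb: "T g \<in> bcontfun" if g: "g \<in> bcontfun" for g
  proof -
    obtain N where N: "\<And>t. cmod (g t) \<le> N" and gc: "continuous_on UNIV g"
      using g by (auto simp: bcontfun_def bounded_iff)
    show ?thesis
    proof (rule bcontfun_normI[OF Tc[OF gc]])
      fix x
      have "cmod (T g x - T (\<lambda>_. 0) x) \<le> Q / L\<^sup>2 * N"
        by (rule T_lip[OF gc]) (auto simp: N)
      then show "cmod (T g x) \<le> Q / L\<^sup>2 * N + (cmod A + (cmod B + F) / L)"
        using T0[of x] norm_triangle_sub[of "T g x" "T (\<lambda>_. 0) x"] by linarith
    qed
  qed
  define TT where "TT = (\<lambda>g::real \<Rightarrow>\<^sub>C complex. Bcontfun (T (apply_bcontfun g)))"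
  have TT: "apply_bcontfun (TT g) = T (apply_bcontfun g)" for g
    unfolding TT_def by (rule Bcontfun_inverse, rule Tb) (rule apply_bcontfun)
  have "L\<^sup>2 = Q * Q + 2 * Q + 1" by (simp add: L_def power2_eq_square algebra_simps)
  moreover have "Q * Q \<ge> 0" by simp
  ultimately have "Q < L\<^sup>2" using Q0 by linarith
  then have QL: "Q / L\<^sup>2 < 1" "0 \<le> Q / L\<^sup>2"
    using Q0 by (auto simp: divide_less_eq)
  have "\<exists>!g. TT g = g"
  proof (rule banach_fix_type[OF QL(2,1)], intro allI)
    fix g h
    show "dist (TT g) (TT h) \<le> Q / L\<^sup>2 * dist g h"
    proof (rule dist_bound)
      fix x
      have "cmod (apply_bcontfun g t - apply_bcontfun h t) \<le> dist g h" for t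
        using dist_bounded[of g t h] by (simp add: dist_norm)
      then show "dist (TT g x) (TT h x) \<le> Q / L\<^sup>2 * dist g h"
        unfolding TT dist_norm by (intro T_lip) auto
    qed
  qed
  then obtain g where g: "TT g = g" by blast
  define G where "G = apply_bcontfun g"
  have G: "T G = G" using TT[of g] g by (simp add: G_def)
  have Gc: "continuous_on UNIV G" by (simp add: G_def)
  define w where "w = (\<lambda>x. A + prim x0 (W1 G) x)"
  have wG: "w x = wt x * G x" for x
    using fun_cong[OF G, of x] wt(2)[of x] by (auto simp: T_def w_def field_simps)
  have HG: "H G = (\<lambda>t. q t * w t - f t)"
    by (auto simp: H_def wG)
  have "has_AC_derivs w (W1 G) (\<lambda>t. q t * w t - f t)"
    unfolding has_AC_derivs_def HG[symmetric]
  proof (intro conjI allI impI)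
    fix x show "(w has_vector_derivative W1 G x) (at x)"
      unfolding w_def using prim_deriv[OF W1c[OF Gc]] by (auto intro!: derivative_eq_intros)
  next
    have "G \<in> borel_measurable borel" "wt \<in> borel_measurable borel"
      using Gc wt(1) by (auto intro: borel_measurable_continuous_onI)
    then show "H G \<in> borel_measurable lborel"
      using q(1) f unfolding H_def by auto
  next
    fix a b :: real assume ab: "a \<le> b"
    show "set_integrable lborel {a..b} (H G)" by (rule Hs[OF Gc])
    show "W1 G b - W1 G a = (LINT t:{a..b}|lborel. H G t)"
      using integral_unique[OF prim_has_integral[OF Hi[OF Gc] ab, of x0]]
      by (simp add: W1_def set_borel_integral_eq_integral(2)[OF Hs[OF Gc]])
  qed
  then show thesis by (intro that[of w "W1 G"]) (auto simp: w_def W1_def)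
qed

lemma has_AC_derivs_weak_sol:
  assumes "has_AC_derivs w w1 w2" "AE t in lborel. t \<in> {a..b} \<longrightarrow> w2 t = q t * w t - f t"
  shows "weak_sol q f w w1 a b"
  unfolding weak_sol_def
proof (intro conjI ballI allI impI)
  fix x show "(w has_vector_derivative w1 x) (at x within {a..b})"
    using assms(1) by (auto simp: has_AC_derivs_def intro: has_vector_derivative_at_within)
next
  fix x y assume xy: "a \<le> x" "x \<le> y" "y \<le> b"
  have s: "set_integrable lborel {x..y} w2" "w1 y - w1 x = (LINT t:{x..y}|lborel. w2 t)"
    using assms(1) xy by (auto simp: has_AC_derivs_def)
  have "(w2 has_integral (w1 y - w1 x)) {x..y}"
    using set_borel_integral_eq_integral[OF s(1)] s(2) by (simp add: has_integral_integral)
  moreover have "AE t in lborel. t \<in> {x..y} \<longrightarrow> w2 t = q t * w t - f t"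
    using assms(2) by eventually_elim (use xy in auto)
  ultimately show "((\<lambda>t. q t * w t - f t) has_integral (w1 y - w1 x)) {x..y}"
    by (rule has_integral_AE[THEN iffD1, rotated])
qed

section \<open>Dependence on the spectral parameter\<close>

text \<open>A uniform quadratic remainder is passed on by evaluation and by integration against a
  fixed function, so this one criterion serves point values, derivatives and matrix
  elements.\<close>

lemma quadratic_error_imp_deriv:
  fixes h :: "complex \<Rightarrow> complex"
  assumes "\<And>z. cmod (z - z0) \<le> 1 \<Longrightarrow> cmod (h z - h z0 - (z - z0) * D) \<le> K * (cmod (z - z0))\<^sup>2"
  shows "(h has_field_derivative D) (at z0)"
  unfolding has_field_derivative_iff
proof (rule Lim_transform2[OF tendsto_const], rule Lim_null_comparison)
  show "((\<lambda>z. K * cmod (z - z0)) \<longlongrightarrow> 0) (at z0)"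
    by (rule tendsto_eq_intros refl | simp)+
  have "\<forall>\<^sub>F z in at z0. dist z z0 < 1 \<and> z \<noteq> z0"
    by (rule eventually_conj) (auto simp: eventually_at intro: exI[of _ 1])
  then show "\<forall>\<^sub>F z in at z0. cmod (D - (h z - h z0) / (z - z0)) \<le> K * cmod (z - z0)"
  proof eventually_elim
    case (elim z)
    have "D - (h z - h z0) / (z - z0) = - (h z - h z0 - (z - z0) * D) / (z - z0)"
      using elim by (simp add: field_simps)
    also have "cmod \<dots> = cmod (h z - h z0 - (z - z0) * D) / cmod (z - z0)"
      by (simp only: norm_divide norm_minus_cancel)
    also have "\<dots> \<le> K * (cmod (z - z0))\<^sup>2 / cmod (z - z0)"
      using assms[of z] elim by (intro divide_right_mono) (auto simp: dist_norm)
    also have "\<dots> = K * cmod (z - z0)" by (simp add: power2_eq_square)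
    finally show ?case .
  qed
qed

lemma sup_bound_on_Icc:
  fixes g :: "real \<Rightarrow> complex"
  assumes "continuous_on {a..b} g"
  obtains S where "S \<ge> 0" "\<And>x. x \<in> {a..b} \<Longrightarrow> cmod (g x) \<le> S"
proof -
  have "bounded (g ` {a..b})"
    by (intro compact_imp_bounded compact_continuous_image assms) auto
  then obtain S where "\<forall>x\<in>{a..b}. cmod (g x) \<le> S"
    unfolding bounded_iff by blast
  then have "0 \<le> max S 0" "\<And>x. x \<in> {a..b} \<Longrightarrow> cmod (g x) \<le> max S 0" by force+
  then show thesis by (rule that)
qed

lemma integrable_mult_continuous:
  fixes g h :: "real \<Rightarrow> complex"
  assumes gi: "integrable lborel g" and gab: "\<And>t. t \<notin> {a..b} \<Longrightarrow> g t = 0"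
    and h: "continuous_on {a..b} h"
  shows "integrable lborel (\<lambda>t. g t * h t)"
proof -
  obtain S where S: "S \<ge> 0" "\<And>x. x \<in> {a..b} \<Longrightarrow> cmod (h x) \<le> S"
    using sup_bound_on_Icc[OF h] by blast
  have m: "(\<lambda>t. indicat_real {a..b} t *\<^sub>R h t) \<in> borel_measurable borel"
    using borel_integrable_compact[OF _ h] by (auto simp: integrable_iff_bounded)
  have gm: "g \<in> borel_measurable borel"
    using borel_measurable_integrable[OF gi] by simp
  have "(\<lambda>t. g t * h t) = (\<lambda>t. g t * (indicat_real {a..b} t *\<^sub>R h t))"
    using gab by (auto simp: indicator_def)
  moreover have "(\<lambda>t. g t * (indicat_real {a..b} t *\<^sub>R h t)) \<in> borel_measurable lborel"
    using borel_measurable_times[OF gm m] by simp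
  ultimately have "(\<lambda>t. g t * h t) \<in> borel_measurable lborel"
    by (simp only:)
  moreover have "AE t in lborel. cmod (g t * h t) \<le> cmod (S * g t)"
  proof (rule AE_I2)
    fix t
    show "cmod (g t * h t) \<le> cmod (S * g t)"
      using S(1) mult_right_mono[OF S(2)[of t], of "cmod (g t)"] gab[of t]
      by (cases "t \<in> {a..b}") (simp_all add: norm_mult mult.commute)
  qed
  ultimately show ?thesis
    by (intro Bochner_Integration.integrable_bound[OF integrable_mult_right[OF gi, of "complex_of_real S"]])
qed

text \<open>The approximate derivative \<open>y\<close> solves the equation with source \<open>w z0\<close>.\<close>

lemma schroedinger_param_deriv:
  fixes q f :: "real \<Rightarrow> complex" and w w1 :: "complex \<Rightarrow> real \<Rightarrow> complex"
  assumes q: "q \<in> borel_measurable borel" "\<And>t. cmod (q t) \<le> Q"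
    and sol: "\<And>z. has_AC_derivs (w z) (w1 z) (\<lambda>t. (q t - z) * w z t - f t)"
    and init: "\<And>z. w z x0 = A" "\<And>z. w1 z x0 = B" and x0: "x0 \<in> {a..b}"
  obtains y y1 K where "continuous_on {a..b} y"
    "\<And>z x. cmod (z - z0) \<le> 1 \<Longrightarrow> x \<in> {a..b} \<Longrightarrow>
      cmod (w z x - w z0 x - (z - z0) * y x) \<le> K * (cmod (z - z0))\<^sup>2"
    "\<And>z x. cmod (z - z0) \<le> 1 \<Longrightarrow> x \<in> {a..b} \<Longrightarrow>
      cmod (w1 z x - w1 z0 x - (z - z0) * y1 x) \<le> K * (cmod (z - z0))\<^sup>2"
proof -
  have weak: "weak_sol (\<lambda>t. q t - z) f (w z) (w1 z) a b" for z
    by (rule has_AC_derivs_weak_sol[OF sol]) auto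
  note wc = weak_sol_cont(1)[OF weak]
  \<comment> \<open>The cut-off makes the source integrable over the line without changing it on
    [a, b].\<close>
  define g where "g = (\<lambda>t. indicat_real {a..b} t *\<^sub>R w z0 t)"
  have gi: "integrable lborel g"
    unfolding g_def using wc by (intro borel_integrable_compact) auto
  define q0 where "q0 = (\<lambda>t. q t - z0)"
  \<comment> \<open>The + 1 covers every parameter within distance 1 of \<open>z0\<close>.\<close>
  define Q0 where "Q0 = Q + cmod z0 + 1"
  have q0: "q0 \<in> borel_measurable borel" "\<And>t. cmod (q0 t) \<le> Q0"
    using q norm_triangle_ineq4[of "q _" z0] unfolding q0_def Q0_def
    by (auto intro: order_trans add_mono)
      (smt (verit) q(2) norm_triangle_ineq4)
  obtain y y1 where y: "y x0 = 0" "y1 x0 = 0" "has_AC_derivs y y1 (\<lambda>t. q0 t * y t - g t)"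
    by (rule schroedinger_ivp_exists[OF q0 gi])
  have yw: "weak_sol q0 g y y1 a b"
    by (rule has_AC_derivs_weak_sol[OF y(3)]) auto
  obtain S where S: "S \<ge> 0" "\<And>x. x \<in> {a..b} \<Longrightarrow> cmod (w z0 x) \<le> S"
    using sup_bound_on_Icc[OF wc[of z0]] by blast
  \<comment> \<open>The Gronwall factor of \<open>weak_sol_bound\<close>, incurred once for the
    difference and once more for the remainder.\<close>
  define G where "G = (b - a) * exp ((1 + Q0) * (b - a))"
  have G0: "G \<ge> 0" using x0 by (auto simp: G_def)
  have qz: "cmod (q t - z) \<le> Q0" if "cmod (z - z0) \<le> 1" for z t
  proof -
    have "q t - z = q t - z0 - (z - z0)" by simp
    then have "cmod (q t - z) \<le> cmod (q t) + cmod z0 + cmod (z - z0)"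
      by (smt (verit) norm_triangle_ineq4)
    then show ?thesis using q(2)[of t] that by (simp add: Q0_def)
  qed
  have d: "cmod (w z x - w z0 x) \<le> cmod (z - z0) * S * G"
    if z: "cmod (z - z0) \<le> 1" and x: "x \<in> {a..b}" for z x
  proof -
    have dw: "weak_sol (\<lambda>t. q t - z) (\<lambda>t. (z - z0) * w z0 t)
        (\<lambda>t. 1 * w z t + (- 1) * w z0 t) (\<lambda>t. 1 * w1 z t + (- 1) * w1 z0 t) a b"
      by (rule weak_sol_lincomb[OF weak weak]) (simp add: algebra_simps)
    have src: "cmod ((z - z0) * w z0 t) \<le> cmod (z - z0) * S" if "t \<in> {a..b}" for t
      using S(2)[OF that] by (simp add: norm_mult mult_left_mono)
    have "cmod (1 * w z x + (- 1) * w z0 x) + cmod (1 * w1 z x + (- 1) * w1 z0 x)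
        \<le> cmod (z - z0) * S * (b - a) * exp ((1 + Q0) * (b - a))"
      by (rule weak_sol_bound[OF dw x0 _ _ qz[OF z] src x]) (simp_all add: init)
    then have "cmod (w z x - w z0 x) + cmod (w1 z x - w1 z0 x) \<le> cmod (z - z0) * S * G"
      by (simp add: G_def mult.assoc)
    then show ?thesis by (smt (verit) norm_ge_zero)
  qed
  have e: "cmod (w z x - w z0 x - (z - z0) * y x) + cmod (w1 z x - w1 z0 x - (z - z0) * y1 x)
      \<le> (S * G * G) * (cmod (z - z0))\<^sup>2"
    if z: "cmod (z - z0) \<le> 1" and x: "x \<in> {a..b}" for z x
  proof -
    have dw: "weak_sol (\<lambda>t. q t - z) (\<lambda>t. (z - z0) * w z0 t)
        (\<lambda>t. 1 * w z t + (- 1) * w z0 t) (\<lambda>t. 1 * w1 z t + (- 1) * w1 z0 t) a b"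
      by (rule weak_sol_lincomb[OF weak weak]) (simp add: algebra_simps)
    \<comment> \<open>The remainder solves the equation with the difference w z - w z0 as source,
      times z - z0; by \<open>d\<close> this source is quadratically small.\<close>
    have "weak_sol q0 (\<lambda>t. (z - z0) * (w z t - w z0 t))
        (\<lambda>t. 1 * (1 * w z t + (- 1) * w z0 t) + (- (z - z0)) * y t)
        (\<lambda>t. 1 * (1 * w1 z t + (- 1) * w1 z0 t) + (- (z - z0)) * y1 t) a b"
      by (rule weak_sol_lincomb[OF dw yw]) (simp add: q0_def g_def algebra_simps)
    from weak_sol_bound[OF this x0 _ _ q0(2) _ x, where S = "cmod (z - z0) * (cmod (z - z0) * S * G)"]
    show ?thesis
      using d[OF z] init y(1,2)
      by (simp add: norm_mult mult_left_mono G_def power2_eq_square) (simp add: algebra_simps)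
  qed
  show thesis
  proof (rule that[of y "S * G * G" y1])
    show "continuous_on {a..b} y" by (rule weak_sol_cont(1)[OF yw])
  qed (use e in \<open>smt (verit) norm_ge_zero\<close>)+
qed

text \<open>The initial data are the same for all z. Data depending on \<lambda> are reached in
  \<open>psi\<close> by combining two such families with coefficients polynomial in
  \<lambda>.\<close>

lemma schroedinger_holomorphic:
  fixes q f :: "real \<Rightarrow> complex" and w w1 :: "complex \<Rightarrow> real \<Rightarrow> complex"
  assumes q: "q \<in> borel_measurable borel" "\<And>t. cmod (q t) \<le> Q"
    and sol: "\<And>z. has_AC_derivs (w z) (w1 z) (\<lambda>t. (q t - z) * w z t - f t)"
    and init: "\<And>z. w z x0 = A" "\<And>z. w1 z x0 = B"
  shows "(\<lambda>z. w z x) holomorphic_on UNIV" "(\<lambda>z. w1 z x) holomorphic_on UNIV"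
    and "integrable lborel g \<Longrightarrow> (\<And>t. \<bar>t\<bar> > r \<Longrightarrow> g t = 0) \<Longrightarrow>
      (\<lambda>z. LINT t|lborel. g t * w z t) holomorphic_on UNIV"
proof -
  \<comment> \<open>One interval that contains \<open>x0\<close>, \<open>x\<close> and the support
    of \<open>g\<close>.\<close>
  define a where "a = - \<bar>x0\<bar> - \<bar>x\<bar> - \<bar>r\<bar>"
  define b where "b = \<bar>x0\<bar> + \<bar>x\<bar> + \<bar>r\<bar>"
  have x0: "x0 \<in> {a..b}" and x: "x \<in> {a..b}" and r: "{-r..r} \<subseteq> {a..b}"
    by (auto simp: a_def b_def)
  have weak: "weak_sol (\<lambda>t. q t - z) f (w z) (w1 z) a b" for z
    by (rule has_AC_derivs_weak_sol[OF sol]) auto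
  note wc = weak_sol_cont(1)[OF weak]
  have "(\<lambda>z. w z x) field_differentiable at z0 \<and> (\<lambda>z. w1 z x) field_differentiable at z0 \<and>
    (integrable lborel g \<longrightarrow> (\<forall>t. \<bar>t\<bar> > r \<longrightarrow> g t = 0) \<longrightarrow>
      (\<lambda>z. LINT t|lborel. g t * w z t) field_differentiable at z0)" for z0
  proof (rule schroedinger_param_deriv[OF q sol init x0, of z0], intro conjI impI)
    fix y y1 K
    assume yc: "continuous_on {a..b} y"
      and e: "\<And>z x. cmod (z - z0) \<le> 1 \<Longrightarrow> x \<in> {a..b} \<Longrightarrow>
        cmod (w z x - w z0 x - (z - z0) * y x) \<le> K * (cmod (z - z0))\<^sup>2"
      and e1: "\<And>z x. cmod (z - z0) \<le> 1 \<Longrightarrow> x \<in> {a..b} \<Longrightarrow>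
        cmod (w1 z x - w1 z0 x - (z - z0) * y1 x) \<le> K * (cmod (z - z0))\<^sup>2"
    show "(\<lambda>z. w z x) field_differentiable at z0"
      unfolding field_differentiable_def
      by (rule exI, rule quadratic_error_imp_deriv) (rule e[OF _ x])
    show "(\<lambda>z. w1 z x) field_differentiable at z0"
      unfolding field_differentiable_def
      by (rule exI, rule quadratic_error_imp_deriv) (rule e1[OF _ x])
    assume gi: "integrable lborel g" and g0: "\<forall>t. \<bar>t\<bar> > r \<longrightarrow> g t = 0"
    have gab: "g t = 0" if "t \<notin> {a..b}" for t
      using g0 that r by (metis abs_le_iff atLeastAtMost_iff minus_le_iff not_le subsetD)
    note gint = integrable_mult_continuous[OF gi gab]
    have "((\<lambda>z. LINT t|lborel. g t * w z t) has_field_derivative (LINT t|lborel. g t * y t)) (at z0)"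
    proof (rule quadratic_error_imp_deriv)
      fix z assume z: "cmod (z - z0) \<le> 1"
      let ?K = "K * (cmod (z - z0))\<^sup>2"
      have "(LINT t|lborel. g t * w z t) - (LINT t|lborel. g t * w z0 t)
          - (z - z0) * (LINT t|lborel. g t * y t)
        = (LINT t|lborel. g t * w z t - g t * w z0 t - (z - z0) * (g t * y t))"
        using gint wc yc by simp
      also have "\<dots> = (LINT t|lborel. g t * (w z t - w z0 t - (z - z0) * y t))"
        by (simp add: algebra_simps)
      also have "cmod \<dots> \<le> (LINT t|lborel. cmod (g t * (w z t - w z0 t - (z - z0) * y t)))"
        by (rule integral_norm_bound)
      also have "\<dots> \<le> (LINT t|lborel. ?K * cmod (g t))"
      proof (rule integral_mono)
        show "integrable lborel (\<lambda>t. cmod (g t * (w z t - w z0 t - (z - z0) * y t)))"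
        proof (rule integrable_norm, rule gint)
          show "continuous_on {a..b} (\<lambda>t. w z t - w z0 t - (z - z0) * y t)"
            by (intro continuous_intros wc yc)
        qed
        show "integrable lborel (\<lambda>t. ?K * cmod (g t))"
          using gi by simp
        fix t
        show "cmod (g t * (w z t - w z0 t - (z - z0) * y t)) \<le> ?K * cmod (g t)"
          using mult_right_mono[OF e[OF z, of t], of "cmod (g t)"] gab[of t]
          by (cases "t \<in> {a..b}") (simp_all add: norm_mult mult.commute)
      qed
      also have "\<dots> = (K * (LINT t|lborel. cmod (g t))) * (cmod (z - z0))\<^sup>2"
        by simp
      finally show "cmod ((LINT t|lborel. g t * w z t) - (LINT t|lborel. g t * w z0 t)
          - (z - z0) * (LINT t|lborel. g t * y t)) \<le> (K * (LINT t|lborel. cmod (g t))) * (cmod (z - z0))\<^sup>2" .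
    qed
    then show "(\<lambda>z. LINT t|lborel. g t * w z t) field_differentiable at z0"
      by (auto simp: field_differentiable_def)
  qed
  then show "(\<lambda>z. w z x) holomorphic_on UNIV" "(\<lambda>z. w1 z x) holomorphic_on UNIV"
    and "integrable lborel g \<Longrightarrow> (\<And>t. \<bar>t\<bar> > r \<Longrightarrow> g t = 0) \<Longrightarrow>
      (\<lambda>z. LINT t|lborel. g t * w z t) holomorphic_on UNIV"
    by (auto simp: holomorphic_on_def)
qed

section \<open>Classical solutions\<close>

definition classical_sol :: "(real \<Rightarrow> real) \<Rightarrow> complex \<Rightarrow> (real \<Rightarrow> complex) \<Rightarrow> (real \<Rightarrow> complex) \<Rightarrow> bool" where
  "classical_sol V z w w1 \<longleftrightarrow>
     (\<forall>x. (w has_vector_derivative w1 x) (at x) \<and>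
          (w1 has_vector_derivative (of_real (V x) - z) * w x) (at x))"

lemma classical_solD:
  assumes "classical_sol V z w w1"
  shows "(w has_vector_derivative w1 x) (at x within S)"
    "(w1 has_vector_derivative (of_real (V x) - z) * w x) (at x within S)"
  using assms by (auto simp: classical_sol_def intro: has_vector_derivative_at_within)

lemma classical_sol_cont:
  assumes "classical_sol V z w w1"
  shows "continuous_on S w" "continuous_on S w1"
  by (rule continuous_on_vector_derivative, rule classical_solD[OF assms])+

lemma classical_imp_weak:
  assumes "classical_sol V z w w1"
  shows "weak_sol (\<lambda>t. of_real (V t) - z) (\<lambda>_. 0) w w1 a b"
  unfolding weak_sol_def
  by (auto intro!: classical_solD[OF assms] fundamental_theorem_of_calculus)

lemma has_AC_derivs_C2:
  assumes "has_AC_derivs w w1 w2" and c: "continuous_on UNIV w2"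
  shows "(w1 has_vector_derivative w2 x) (at x)"
proof -
  have "((\<lambda>t. integral {x-1..t} w2) has_vector_derivative w2 x) (at x within {x-1..x+1})"
    by (rule integral_has_vector_derivative) (auto intro: continuous_on_subset[OF c])
  then have "((\<lambda>t. w1 (x-1) + integral {x-1..t} w2) has_vector_derivative w2 x) (at x within {x-1..x+1})"
    by (auto intro!: derivative_eq_intros)
  then have "(w1 has_vector_derivative w2 x) (at x within {x-1..x+1})"
  proof (rule has_vector_derivative_transform[rotated -1])
    fix t assume t: "t \<in> {x-1..x+1}"
    then have "w1 t - w1 (x-1) = (LINT s:{x-1..t}|lborel. w2 s)" "set_integrable lborel {x-1..t} w2"
      using assms(1) by (auto simp: has_AC_derivs_def)
    then show "w1 t = w1 (x-1) + integral {x-1..t} w2"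
      by (simp add: set_borel_integral_eq_integral(2) algebra_simps)
  qed auto
  then show ?thesis by (simp add: at_within_Icc_at)
qed

lemma wronskian_deriv:
  assumes "classical_sol V z w w1" "classical_sol V z' y y1"
  shows "((\<lambda>t. w t * y1 t - w1 t * y t) has_vector_derivative (z - z') * (w x * y x)) (at x within S)"
  by (rule derivative_eq_intros classical_solD assms refl)+ (simp add: algebra_simps)

text \<open>Lagrange's identity: the potential cancels and only the difference of the spectral
  parameters remains. Equal parameters give constancy of the Wronskian; the parameters E and z give
  variation of parameters.\<close>

lemma wronskian_integral:
  assumes "classical_sol V z w w1" "classical_sol V z' y y1" "a \<le> b"
  shows "(w b * y1 b - w1 b * y b) - (w a * y1 a - w1 a * y a)
    = (z - z') * integral {a..b} (\<lambda>x. w x * y x)"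
proof -
  have "((\<lambda>x. (z - z') * (w x * y x)) has_integral
      (w b * y1 b - w1 b * y b) - (w a * y1 a - w1 a * y a)) {a..b}"
    by (rule fundamental_theorem_of_calculus[OF assms(3)]) (rule wronskian_deriv[OF assms(1,2)])
  from integral_unique[OF this] show ?thesis by simp
qed

lemma wronskian_const:
  assumes "classical_sol V z w w1" "classical_sol V z y y1"
  shows "w x * y1 x - w1 x * y x = w x' * y1 x' - w1 x' * y x'"
  using wronskian_integral[OF assms, of x x'] wronskian_integral[OF assms, of x' x]
  by (cases "x \<le> x'") auto

lemma classical_sol_lincomb:
  assumes "classical_sol V z w w1" "classical_sol V z y y1"
  shows "classical_sol V z (\<lambda>t. c * w t + d * y t) (\<lambda>t. c * w1 t + d * y1 t)"
  unfolding classical_sol_def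
  by (auto intro!: derivative_eq_intros classical_solD[OF assms(1)] classical_solD[OF assms(2)]
      simp: algebra_simps)

lemma classical_sol_scale:
  assumes "classical_sol V z w w1"
  shows "classical_sol V z (\<lambda>t. c * w t) (\<lambda>t. c * w1 t)"
  using classical_sol_lincomb[OF assms assms, of c 0] by simp

lemma classical_sol_reflect:
  assumes "classical_sol V z w w1" "even_fun V"
  shows "classical_sol V z (\<lambda>t. w (- t)) (\<lambda>t. - w1 (- t))"
proof -
  have V: "V (- x) = V x" for x using assms(2) by (simp add: even_fun_def)
  have n: "(uminus has_vector_derivative - 1) (at (x::real))" for x
    by (auto intro!: derivative_eq_intros)
  show ?thesis
    unfolding classical_sol_def
    using vector_diff_chain_at[OF n classical_solD(1)[OF assms(1)]]
      has_vector_derivative_minus[OF vector_diff_chain_at[OF n classical_solD(2)[OF assms(1)]]]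
    by (auto simp: o_def V)
qed

lemma classical_sol_cnj:
  assumes "classical_sol V (of_real e) w w1"
  shows "classical_sol V (of_real e) (\<lambda>t. cnj (w t)) (\<lambda>t. cnj (w1 t))"
  unfolding classical_sol_def
  using bounded_linear.has_vector_derivative[OF bounded_linear_cnj classical_solD(1)[OF assms]]
    bounded_linear.has_vector_derivative[OF bounded_linear_cnj classical_solD(2)[OF assms]]
  by simp

locale bounded_potential =
  fixes V :: "real \<Rightarrow> real" and Q :: real
  assumes V_cont: "continuous_on UNIV V" and V_bound: "\<And>x. \<bar>V x\<bar> \<le> Q"
begin

lemma q_bound: "cmod (of_real (V t) - z) \<le> Q + cmod z"
  using norm_triangle_ineq4[of "of_real (V t)" z] V_bound[of t] by simp

lemma q_meas: "(\<lambda>t. complex_of_real (V t) - z) \<in> borel_measurable borel"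
  by (intro borel_measurable_continuous_onI continuous_intros V_cont)

lemma classical_sol_unique:
  assumes "classical_sol V z w w1" "classical_sol V z y y1" "w x0 = y x0" "w1 x0 = y1 x0"
  shows "w = y" "w1 = y1"
proof -
  have "w x = y x \<and> w1 x = y1 x" for x
    using weak_sol_unique[OF assms(1,2)[THEN classical_imp_weak] _ assms(3,4) q_bound, of "min x0 x" "max x0 x" x]
    by auto
  then show "w = y" "w1 = y1" by auto
qed

lemma classical_sol_exists:
  obtains w w1 where "w x0 = A" "w1 x0 = B" "classical_sol V z w w1"
proof (rule schroedinger_ivp_exists[OF q_meas q_bound, of "\<lambda>_. 0"])
  fix w w1 assume w: "w x0 = A" "w1 x0 = B"
    and AC: "has_AC_derivs w w1 (\<lambda>t. (of_real (V t) - z) * w t - 0)"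
  have wd: "(w has_vector_derivative w1 x) (at x)" for x using AC by (simp add: has_AC_derivs_def)
  then have "continuous_on UNIV w"
    by (intro continuous_on_vector_derivative) (auto intro: has_vector_derivative_at_within)
  then have "continuous_on UNIV (\<lambda>t. (complex_of_real (V t) - z) * w t - 0)"
    by (intro continuous_intros V_cont)
  from has_AC_derivs_C2[OF AC this]
  have "(w1 has_vector_derivative (of_real (V x) - z) * w x) (at x)" for x
    by simp
  with wd w show thesis by (intro that[of w w1]) (auto simp: classical_sol_def)
qed auto

section \<open>Normalised solutions and their Wronskian identities\<close>

definition ivp_sol' where
  "ivp_sol' z a b x = vector_derivative (ivp_sol V z a b) (at x)"

lemma ivp_sol:
  "classical_sol V z (ivp_sol V z a b) (ivp_sol' z a b)"
  "ivp_sol V z a b 0 = a" "ivp_sol' z a b 0 = b"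
proof -
  obtain w w1 where w: "w 0 = a" "w1 0 = b" "classical_sol V z w w1"
    by (rule classical_sol_exists)
  have eq: "ivp_sol V z a b = w"
    unfolding ivp_sol_def
  proof (rule the_equality)
    show "w 0 = a \<and> (\<exists>w'. w' 0 = b \<and> (\<forall>x. (w has_vector_derivative w' x) (at x) \<and>
        (w' has_vector_derivative (of_real (V x) - z) * w x) (at x)))"
      using w by (auto simp: classical_sol_def)
    fix y assume "y 0 = a \<and> (\<exists>w'. w' 0 = b \<and> (\<forall>x. (y has_vector_derivative w' x) (at x) \<and>
        (w' has_vector_derivative (of_real (V x) - z) * y x) (at x)))"
    then obtain y1 where "y 0 = a" "y1 0 = b" "classical_sol V z y y1"
      by (auto simp: classical_sol_def)
    then show "y = w" using classical_sol_unique(1)[OF _ w(3), of y y1 0] w by auto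
  qed
  have eq1: "ivp_sol' z a b = w1"
    unfolding ivp_sol'_def eq
    using classical_solD(1)[OF w(3)] by (auto intro: vector_derivative_at)
  show "classical_sol V z (ivp_sol V z a b) (ivp_sol' z a b)"
    "ivp_sol V z a b 0 = a" "ivp_sol' z a b 0 = b"
    unfolding eq eq1 using w by auto
qed

lemma uv_sol:
  "classical_sol V z (u_sol V \<Phi> z) (u_sol' V \<Phi> z)"
  "classical_sol V z (v_sol V \<Phi> z) (v_sol' V \<Phi> z)"
  "u_sol V \<Phi> z 0 = (if even_fun \<Phi> then 1 else 0)"
  "u_sol' V \<Phi> z 0 = (if even_fun \<Phi> then 0 else 1)"
  "v_sol V \<Phi> z 0 = (if even_fun \<Phi> then 0 else -1)"
  "v_sol' V \<Phi> z 0 = (if even_fun \<Phi> then 1 else 0)"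
proof -
  have "u_sol' V \<Phi> z = (if even_fun \<Phi> then ivp_sol' z 1 0 else ivp_sol' z 0 1)"
    "v_sol' V \<Phi> z = (if even_fun \<Phi> then ivp_sol' z 0 1 else ivp_sol' z (-1) 0)"
    by (auto simp: u_sol'_def v_sol'_def ivp_sol'_def u_sol_def v_sol_def)
  then show
    "classical_sol V z (u_sol V \<Phi> z) (u_sol' V \<Phi> z)"
    "classical_sol V z (v_sol V \<Phi> z) (v_sol' V \<Phi> z)"
    "u_sol V \<Phi> z 0 = (if even_fun \<Phi> then 1 else 0)"
    "u_sol' V \<Phi> z 0 = (if even_fun \<Phi> then 0 else 1)"
    "v_sol V \<Phi> z 0 = (if even_fun \<Phi> then 0 else -1)"
    "v_sol' V \<Phi> z 0 = (if even_fun \<Phi> then 1 else 0)"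
    by (auto simp: u_sol_def v_sol_def ivp_sol)
qed

text \<open>The value v(0) = -1 in the odd case is what makes the Wronskian +1 for both
  parities.\<close>

lemma uv_wronskian: "u_sol V \<Phi> z x * v_sol' V \<Phi> z x - u_sol' V \<Phi> z x * v_sol V \<Phi> z x = 1"
  using wronskian_const[OF uv_sol(1)[of z \<Phi>] uv_sol(2)[of z \<Phi>], of x 0] by (auto simp: uv_sol)

lemma uv_real:
  "cnj (u_sol V \<Phi> (of_real e) x) = u_sol V \<Phi> (of_real e) x"
  "cnj (u_sol' V \<Phi> (of_real e) x) = u_sol' V \<Phi> (of_real e) x"
  "cnj (v_sol V \<Phi> (of_real e) x) = v_sol V \<Phi> (of_real e) x"
  "cnj (v_sol' V \<Phi> (of_real e) x) = v_sol' V \<Phi> (of_real e) x"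
proof -
  note u = classical_sol_unique[OF classical_sol_cnj[OF uv_sol(1)[of "of_real e" \<Phi>]] uv_sol(1)[of "of_real e" \<Phi>], of 0]
  note v = classical_sol_unique[OF classical_sol_cnj[OF uv_sol(2)[of "of_real e" \<Phi>]] uv_sol(2)[of "of_real e" \<Phi>], of 0]
  show "cnj (u_sol V \<Phi> (of_real e) x) = u_sol V \<Phi> (of_real e) x"
    "cnj (u_sol' V \<Phi> (of_real e) x) = u_sol' V \<Phi> (of_real e) x"
    using u[THEN fun_cong, of x] by (auto simp: uv_sol)
  show "cnj (v_sol V \<Phi> (of_real e) x) = v_sol V \<Phi> (of_real e) x"
    "cnj (v_sol' V \<Phi> (of_real e) x) = v_sol' V \<Phi> (of_real e) x"
    using v[THEN fun_cong, of x] by (auto simp: uv_sol)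
qed

lemma u_parity:
  assumes "even_fun V"
  shows "u_sol V \<Phi> z (- x) = (if even_fun \<Phi> then 1 else -1) * u_sol V \<Phi> z x"
    "u_sol' V \<Phi> z (- x) = (if even_fun \<Phi> then -1 else 1) * u_sol' V \<Phi> z x"
proof -
  define s :: complex where "s = (if even_fun \<Phi> then 1 else -1)"
  note u = classical_sol_unique[OF classical_sol_reflect[OF uv_sol(1)[of z \<Phi>] assms]
      classical_sol_scale[OF uv_sol(1)[of z \<Phi>], of s], of 0]
  show "u_sol V \<Phi> z (- x) = (if even_fun \<Phi> then 1 else -1) * u_sol V \<Phi> z x"
    "u_sol' V \<Phi> z (- x) = (if even_fun \<Phi> then -1 else 1) * u_sol' V \<Phi> z x"
    using u[THEN fun_cong, of x] by (auto simp: uv_sol s_def minus_equation_iff split: if_splits)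
qed

text \<open>Variation of parameters, in the form obtained by solving the two Wronskian identities for
  \<open>u\<^sub>z\<close> and \<open>u\<^sub>z'\<close>.\<close>

lemma u_sol_perturb:
  fixes \<Phi> :: "real \<Rightarrow> complex" and e z :: complex and x :: real
  assumes "x \<ge> 0"
  defines "A \<equiv> integral {0..x} (\<lambda>y. u_sol V \<Phi> e y * u_sol V \<Phi> z y)"
    and "B \<equiv> integral {0..x} (\<lambda>y. v_sol V \<Phi> e y * u_sol V \<Phi> z y)"
  shows "u_sol V \<Phi> z x = u_sol V \<Phi> e x * (1 + (z - e) * B) - (z - e) * v_sol V \<Phi> e x * A"
    "u_sol' V \<Phi> z x = u_sol' V \<Phi> e x * (1 + (z - e) * B) - (z - e) * v_sol' V \<Phi> e x * A"
proof -
  have A: "u_sol V \<Phi> e x * u_sol' V \<Phi> z x - u_sol' V \<Phi> e x * u_sol V \<Phi> z x = (e - z) * A"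
    using wronskian_integral[OF uv_sol(1)[of e \<Phi>] uv_sol(1)[of z \<Phi>] assms(1)]
    by (simp add: A_def uv_sol)
  have B: "v_sol' V \<Phi> e x * u_sol V \<Phi> z x - v_sol V \<Phi> e x * u_sol' V \<Phi> z x = 1 - (e - z) * B"
    using wronskian_integral[OF uv_sol(2)[of e \<Phi>] uv_sol(1)[of z \<Phi>] assms(1)]
    by (simp add: B_def uv_sol algebra_simps split: if_splits)
  note W = uv_wronskian[of \<Phi> e x]
  have "u_sol V \<Phi> z x = (u_sol V \<Phi> e x * v_sol' V \<Phi> e x - u_sol' V \<Phi> e x * v_sol V \<Phi> e x) * u_sol V \<Phi> z x"
    unfolding W by simp
  also have "\<dots> = u_sol V \<Phi> e x * (v_sol' V \<Phi> e x * u_sol V \<Phi> z x - v_sol V \<Phi> e x * u_sol' V \<Phi> z x)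
    + v_sol V \<Phi> e x * (u_sol V \<Phi> e x * u_sol' V \<Phi> z x - u_sol' V \<Phi> e x * u_sol V \<Phi> z x)"
    by (simp add: algebra_simps)
  finally show "u_sol V \<Phi> z x = u_sol V \<Phi> e x * (1 + (z - e) * B) - (z - e) * v_sol V \<Phi> e x * A"
    unfolding A B by (simp add: algebra_simps)
  have "u_sol' V \<Phi> z x = (u_sol V \<Phi> e x * v_sol' V \<Phi> e x - u_sol' V \<Phi> e x * v_sol V \<Phi> e x) * u_sol' V \<Phi> z x"
    unfolding W by simp
  also have "\<dots> = u_sol' V \<Phi> e x * (v_sol' V \<Phi> e x * u_sol V \<Phi> z x - v_sol V \<Phi> e x * u_sol' V \<Phi> z x)
    + v_sol' V \<Phi> e x * (u_sol V \<Phi> e x * u_sol' V \<Phi> z x - u_sol' V \<Phi> e x * u_sol V \<Phi> z x)"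
    by (simp add: algebra_simps)
  finally show "u_sol' V \<Phi> z x = u_sol' V \<Phi> e x * (1 + (z - e) * B) - (z - e) * v_sol' V \<Phi> e x * A"
    unfolding A B by (simp add: algebra_simps)
qed

end

section \<open>Bound states and Floquet decay\<close>

lemma integrable_const_Ici_imp_zero:
  fixes c :: real
  assumes "integrable lborel (\<lambda>x::real. indicator {r..} x * c)"
  shows "c = 0"
proof (rule ccontr)
  assume c: "c \<noteq> 0"
  have "integrable lborel (\<lambda>x::real. inverse c * (indicator {r..} x * c))"
    using assms by simp
  also have "(\<lambda>x::real. inverse c * (indicator {r..} x * c)) = indicator {r..}"
    using c by (auto simp: indicator_def)
  finally have "emeasure lborel {r..} < \<infinity>"
    by (simp add: integrable_indicator_iff)
  then obtain K where K: "emeasure lborel {r..} = ennreal K" "K \<ge> 0"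
    by (metis ennreal_cases infinity_ennreal_def less_irrefl)
  have "emeasure lborel {r..r + (K + 1)} \<le> emeasure lborel {r..}"
    by (rule emeasure_mono) auto
  then show False using K by simp
qed

lemma L2_mult_integrable:
  assumes "L2 f" "L2 g"
  shows "integrable lborel (\<lambda>x. f x * g x)"
proof (rule Bochner_Integration.integrable_bound)
  show "integrable lborel (\<lambda>x. (cmod (f x))\<^sup>2 + (cmod (g x))\<^sup>2)"
    using assms by (auto simp: L2_def)
  show "(\<lambda>x. f x * g x) \<in> borel_measurable lborel"
    using assms by (auto simp: L2_def intro: borel_measurable_times)
  have "cmod (f x * g x) \<le> (cmod (f x))\<^sup>2 + (cmod (g x))\<^sup>2" for x
    unfolding norm_mult
  proof -
    have "2 * (cmod (f x) * cmod (g x)) \<le> (cmod (f x))\<^sup>2 + (cmod (g x))\<^sup>2"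
      using sum_squares_bound[of "cmod (f x)" "cmod (g x)"] by simp
    moreover have "0 \<le> cmod (f x) * cmod (g x)" by simp
    ultimately show "cmod (f x) * cmod (g x) \<le> (cmod (f x))\<^sup>2 + (cmod (g x))\<^sup>2" by linarith
  qed
  then show "AE x in lborel. cmod (f x * g x) \<le> norm ((cmod (f x))\<^sup>2 + (cmod (g x))\<^sup>2)"
    by auto
qed

lemma L2_affine:
  assumes "L2 f" "c \<noteq> 0"
  shows "L2 (\<lambda>x. f (t + c * x))"
  using assms lborel_integrable_real_affine[of "\<lambda>x. (cmod (f x))\<^sup>2" c t]
  by (auto simp: L2_def)

lemma L2_scale: "L2 f \<Longrightarrow> L2 (\<lambda>x. c * f x)"
  by (auto simp: L2_def norm_mult power_mult_distrib)

text \<open>Applied to Wronskians of square-integrable solutions, which are integrable yet constant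
  far out, and to the energy |u|^2 + |u1|^2 of a solution that does not decay.\<close>

lemma integrable_imp_zero_on_Ici:
  fixes h :: "real \<Rightarrow> complex"
  assumes h: "integrable lborel h" and c: "\<And>x. x \<ge> r \<Longrightarrow> c \<le> cmod (h x)" and "c \<ge> 0"
  shows "c = 0"
proof (rule integrable_const_Ici_imp_zero[of r])
  show "integrable lborel (\<lambda>x. indicator {r..} x * c)"
    by (rule Bochner_Integration.integrable_bound[OF integrable_norm[OF h]])
      (use c \<open>c \<ge> 0\<close> in \<open>auto simp: indicator_def\<close>)
qed

section \<open>Functions multiplied by a constant under the unit shift\<close>

lemma shift_decomp:
  fixes x r :: real
  assumes "x \<ge> r"
  obtains n y where "x = y + real n" "r \<le> y" "y \<le> r + 1"
proof -
  define n where "n = nat \<lfloor>x - r\<rfloor>"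
  have "real n = of_int \<lfloor>x - r\<rfloor>" using assms by (simp add: n_def)
  then show thesis
    using that[of "x - real n" n] by linarith
qed

lemma shift_power:
  fixes w :: "real \<Rightarrow> complex"
  assumes "\<And>x. x \<ge> r \<Longrightarrow> w (x + 1) = m * w x" and x: "x \<ge> r"
  shows "w (x + real n) = m ^ n * w x"
proof (induction n)
  case (Suc n)
  have "w (x + real (Suc n)) = w ((x + real n) + 1)" by (simp add: add_ac)
  also have "\<dots> = m * w (x + real n)" by (rule assms(1)) (use x in simp)
  finally show ?case using Suc by (simp add: mult_ac)
qed auto

text \<open>Write x = y + n with y in [0, r + 1]. Then |m|^n = exp (l (x - y)), and exp (- l y)
  costs at most exp (|l| (r + 1)), whichever sign l = ln |m| has; decaying and growing solutions are
  covered alike.\<close>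

lemma floquet_bound:
  fixes w :: "real \<Rightarrow> complex"
  assumes cont: "continuous_on UNIV w" and m: "m \<noteq> 0" and r: "r \<ge> 0"
    and shift: "\<And>x. x \<ge> r \<Longrightarrow> w (x + 1) = m * w x"
  obtains C where "C \<ge> 1" "\<And>x. x \<ge> 0 \<Longrightarrow> cmod (w x) \<le> C * exp (ln (cmod m) * x)"
proof -
  obtain S where S: "S \<ge> 0" "\<And>x. x \<in> {0..r+1} \<Longrightarrow> cmod (w x) \<le> S"
    using sup_bound_on_Icc[OF continuous_on_subset[OF cont], of 0 "r+1"] by blast
  define l where "l = ln (cmod m)"
  define C where "C = (S + 1) * exp (\<bar>l\<bar> * (r + 1))"
  have C1: "C \<ge> 1"
    using mult_mono[of 1 "S + 1" 1 "exp (\<bar>l\<bar> * (r + 1))"] S r by (simp add: C_def)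
  have "cmod (w x) \<le> C * exp (l * x)" if x: "x \<ge> 0" for x
  proof -
    obtain n y where ny: "x = y + real n" "0 \<le> y" "y \<le> r + 1" "w x = m ^ n * w y"
    proof (cases "x \<le> r")
      case True
      then show thesis using x r by (intro that[of x 0]) auto
    next
      case False
      then have "x \<ge> r" by simp
      then obtain n y where ny: "x = y + real n" "r \<le> y" "y \<le> r + 1"
        by (rule shift_decomp)
      show thesis
        using ny(2,3) r that[of y n] shift_power[of r w m y n, OF shift ny(2)] by (simp add: ny(1))
    qed
    have "- (l * y) \<le> \<bar>l\<bar> * (r + 1)"
    proof -
      have "- l * y \<le> \<bar>l\<bar> * y" using ny(2) by (intro mult_right_mono) auto
      also have "\<dots> \<le> \<bar>l\<bar> * (r + 1)" using ny(3) by (intro mult_left_mono) auto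
      finally show ?thesis by simp
    qed
    then have *: "l * real n \<le> \<bar>l\<bar> * (r + 1) + l * x"
      by (simp add: ny(1) algebra_simps)
    have "cmod m ^ n = exp (l * real n)"
      using m by (simp add: l_def exp_of_nat2_mult)
    then have "cmod (w x) = exp (l * real n) * cmod (w y)"
      by (simp add: ny(4) norm_mult norm_power)
    also have "\<dots> \<le> exp (\<bar>l\<bar> * (r + 1) + l * x) * (S + 1)"
      using * S(2)[of y] ny(2,3) by (intro mult_mono) auto
    finally show ?thesis by (simp add: C_def exp_add mult_ac)
  qed
  then show thesis using C1 that by (simp add: l_def)
qed

text \<open>This is \<open>floquet_bound\<close> for multiplier 1, where the exponential is
  constant; evenness supplies the left half line. Continuity is known for V but not for its periodic
  part, hence the formulation through the tail of V.\<close>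

lemma periodic_tail_bounded:
  fixes V :: "real \<Rightarrow> real"
  assumes c: "continuous_on UNIV V" and ev: "even_fun V"
    and p: "\<And>x. x \<ge> r \<Longrightarrow> V (x + 1) = V x" and r: "r \<ge> 0"
  obtains Q where "\<And>x. \<bar>V x\<bar> \<le> Q"
proof -
  obtain C where C: "C \<ge> 1" "\<And>x. x \<ge> 0 \<Longrightarrow> cmod (complex_of_real (V x)) \<le> C * exp (ln (cmod 1) * x)"
    by (rule floquet_bound[of "\<lambda>x. complex_of_real (V x)" 1 r])
      (use c p r in \<open>auto intro!: continuous_intros\<close>)
  have "\<bar>V x\<bar> \<le> C" for x
    using C(2)[of x] C(2)[of "-x"] ev by (cases "x \<ge> 0") (auto simp: even_fun_def)
  then show thesis by (rule that)
qed

context bounded_potential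
begin

text \<open>V is continuous, so uniqueness for the integrated equation identifies the H^2
  eigenfunction with the classical solution that has the same data at 0.\<close>

lemma bound_state_classical:
  assumes "bound_state V E \<Phi>"
  obtains \<Phi>1 where "classical_sol V (of_real E) \<Phi> \<Phi>1" "L2 \<Phi>" "L2 \<Phi>1" "\<exists>x. \<Phi> x \<noteq> 0"
proof -
  obtain u1 u2 where AC: "has_AC_derivs \<Phi> u1 u2" and L: "L2 \<Phi>" "L2 u1"
    and eq: "AE x in lborel. - u2 x + of_real (V x) * \<Phi> x = of_real E * \<Phi> x"
    and nz: "\<exists>x. \<Phi> x \<noteq> 0"
    using assms by (auto simp: bound_state_def schroedinger_def)
  have weak: "weak_sol (\<lambda>t. of_real (V t) - of_real E) (\<lambda>_. 0) \<Phi> u1 a b" for a b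
    by (rule has_AC_derivs_weak_sol[OF AC]) (use eq in eventually_elim, auto simp: algebra_simps)
  obtain y y1 where y: "y 0 = \<Phi> 0" "y1 0 = u1 0" "classical_sol V (of_real E) y y1"
    by (rule classical_sol_exists)
  have "\<Phi> x = y x \<and> u1 x = y1 x" for x
    using weak_sol_unique[OF weak classical_imp_weak[OF y(3)] _ y(1,2)[symmetric] q_bound,
        of "min 0 x" "max 0 x" x] by auto
  then have "\<Phi> = y" "u1 = y1" by auto
  then have "classical_sol V (of_real E) \<Phi> u1" using y(3) by simp
  from that[OF this L nz] show thesis .
qed

text \<open>The Wronskian of \<Phi> with its reflection is constant and integrable, hence zero. At 0
  it equals -2 \<Phi>(0) \<Phi>'(0), so one of the two data vanishes and uniqueness gives the
  parity. Then \<Phi> is a nonzero multiple of u_E, which inherits square-integrability.\<close>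

lemma bound_state_parity:
  assumes bs: "bound_state V E \<Phi>" and ev: "even_fun V"
  shows "even_fun \<Phi> \<or> odd_fun \<Phi>" "\<not> (even_fun \<Phi> \<and> odd_fun \<Phi>)"
    "L2 (u_sol V \<Phi> (of_real E))" "L2 (u_sol' V \<Phi> (of_real E))"
proof -
  obtain \<Phi>1 where s: "classical_sol V (of_real E) \<Phi> \<Phi>1" and L: "L2 \<Phi>" "L2 \<Phi>1" and nz: "\<exists>x. \<Phi> x \<noteq> 0"
    using bound_state_classical[OF bs] .
  note r = classical_sol_reflect[OF s ev]
  define D where "D = (\<lambda>x. \<Phi> x * (- \<Phi>1 (- x)) - \<Phi>1 x * \<Phi> (- x))"
  have D0: "D x = D 0" for x
    unfolding D_def by (rule wronskian_const[OF s r])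
  have "integrable lborel D"
    unfolding D_def
    using L2_mult_integrable[OF L(1) L2_affine[OF L(2), of "-1" 0]]
      L2_mult_integrable[OF L(2) L2_affine[OF L(1), of "-1" 0]]
    by (simp add: minus_mult_right[symmetric] del: mult_minus_right)
  then have "cmod (D 0) = 0"
  proof (rule integrable_imp_zero_on_Ici[of _ 0])
    show "cmod (D 0) \<le> cmod (D x)" for x unfolding D0[of x] ..
  qed auto
  then have "\<Phi> 0 = 0 \<or> \<Phi>1 0 = 0" by (simp add: D_def)
  moreover have "even_fun \<Phi>" if "\<Phi>1 0 = 0"
    using classical_sol_unique(1)[OF r s, of 0] that by (auto simp: even_fun_def dest: fun_cong)
  moreover have "odd_fun \<Phi>" if "\<Phi> 0 = 0"
    using classical_sol_unique(1)[OF r classical_sol_scale[OF s, of "-1"], of 0] that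
    by (auto simp: odd_fun_def dest: fun_cong)
  ultimately show eo: "even_fun \<Phi> \<or> odd_fun \<Phi>" by blast
  show "\<not> (even_fun \<Phi> \<and> odd_fun \<Phi>)"
  proof
    assume eo: "even_fun \<Phi> \<and> odd_fun \<Phi>"
    obtain x where "\<Phi> x \<noteq> 0" using nz by blast
    moreover have "\<Phi> x = - \<Phi> x" using eo unfolding even_fun_def odd_fun_def by metis
    ultimately show False by simp
  qed
  have e0: "\<Phi>1 0 = 0" if "even_fun \<Phi>"
  proof -
    have "(\<lambda>t. \<Phi> (- t)) = \<Phi>" using that by (auto simp: even_fun_def)
    then have "- \<Phi>1 0 = \<Phi>1 0"
      using vector_derivative_unique_at[of _ "- \<Phi>1 (- 0)" 0 "\<Phi>1 0"]
        classical_solD(1)[OF r, of 0 UNIV] classical_solD(1)[OF s, of 0 UNIV]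
      by simp
    then have "\<Phi>1 0 + \<Phi>1 0 = 0" by (simp add: eq_neg_iff_add_eq_0[symmetric])
    then show ?thesis by (simp add: mult_2[symmetric])
  qed
  have o0: "\<Phi> 0 = 0" if "\<not> even_fun \<Phi>"
    using that eo by (auto simp: odd_fun_def dest!: spec[of _ "0::real"])
  define c where "c = (if even_fun \<Phi> then \<Phi> 0 else \<Phi>1 0)"
  have eq: "\<Phi> = (\<lambda>t. c * u_sol V \<Phi> (of_real E) t)" "\<Phi>1 = (\<lambda>t. c * u_sol' V \<Phi> (of_real E) t)"
    using classical_sol_unique[OF s classical_sol_scale[OF uv_sol(1)[of "of_real E" \<Phi>], of c], of 0] e0 o0
    by (auto simp: uv_sol c_def)
  have "c \<noteq> 0" using nz eq(1) by (metis mult_zero_left)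
  then have "u_sol V \<Phi> (of_real E) = (\<lambda>t. inverse c * \<Phi> t)"
    "u_sol' V \<Phi> (of_real E) = (\<lambda>t. inverse c * \<Phi>1 t)"
    using fun_cong[OF eq(1)] fun_cong[OF eq(2)]
    by (auto simp: field_simps fun_eq_iff)
  then show "L2 (u_sol V \<Phi> (of_real E))" "L2 (u_sol' V \<Phi> (of_real E))"
    using L2_scale[OF L(1)] L2_scale[OF L(2)] by metis+
qed

text \<open>V is periodic only beyond r, so the shifted solution satisfies the equation only there.
  Its coordinates in the basis u, v are read off at r by Cramer's rule, the determinant being the
  Wronskian 1.\<close>

lemma shift_basis:
  assumes s: "classical_sol V z w w1" and p: "\<And>x. x \<ge> r \<Longrightarrow> V (x + 1) = V x"
    and u: "classical_sol V z u u1" and v: "classical_sol V z v v1"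
    and W: "u r * v1 r - u1 r * v r = 1"
  obtains a b where "\<And>x. x \<ge> r \<Longrightarrow> w (x + 1) = a * u x + b * v x"
    "\<And>x. x \<ge> r \<Longrightarrow> w1 (x + 1) = a * u1 x + b * v1 x"
proof -
  define a where "a = w (r + 1) * v1 r - w1 (r + 1) * v r"
  define b where "b = u r * w1 (r + 1) - u1 r * w (r + 1)"
  have n: "((\<lambda>t. t + 1) has_vector_derivative 1) (at (x::real))" for x
    by (auto intro!: derivative_eq_intros)
  have d: "((\<lambda>t. w (t + 1)) has_vector_derivative w1 (x + 1)) (at x within S)"
    "((\<lambda>t. w1 (t + 1)) has_vector_derivative (of_real (V (x + 1)) - z) * w (x + 1)) (at x within S)" for x S
    using vector_diff_chain_at[OF n classical_solD(1)[OF s]]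
      vector_diff_chain_at[OF n classical_solD(2)[OF s]]
    by (auto simp: o_def intro: has_vector_derivative_at_within)
  have "w (x + 1) = a * u x + b * v x \<and> w1 (x + 1) = a * u1 x + b * v1 x" if x: "x \<ge> r" for x
  proof -
    have "weak_sol (\<lambda>t. of_real (V t) - z) (\<lambda>_. 0) (\<lambda>t. w (t + 1)) (\<lambda>t. w1 (t + 1)) r x"
      unfolding weak_sol_def
    proof (intro conjI ballI allI impI d)
      fix s t assume st: "r \<le> s" "s \<le> t" "t \<le> x"
      show "((\<lambda>t. (of_real (V t) - z) * w (t + 1) - 0) has_integral w1 (t + 1) - w1 (s + 1)) {s..t}"
      proof (rule fundamental_theorem_of_calculus[OF st(2)])
        fix y assume "y \<in> {s..t}"
        then show "((\<lambda>t. w1 (t + 1)) has_vector_derivative (of_real (V y) - z) * w (y + 1) - 0) (at y within {s..t})"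
          using d(2)[of y "{s..t}"] p[of y] st by simp
      qed
    qed
    from weak_sol_unique[OF this classical_imp_weak[OF classical_sol_lincomb[OF u v, of a b]] _ _ _ q_bound, of r x]
    have "a * u r + b * v r = w (r + 1) \<Longrightarrow> a * u1 r + b * v1 r = w1 (r + 1) \<Longrightarrow> ?thesis"
      using x by auto
    moreover have "a * u r + b * v r = w (r + 1) * (u r * v1 r - u1 r * v r)"
      "a * u1 r + b * v1 r = w1 (r + 1) * (u r * v1 r - u1 r * v r)"
      by (simp_all add: a_def b_def algebra_simps)
    ultimately show ?thesis by (simp add: W)
  qed
  then show thesis using that by blast
qed

text \<open>In the basis u, v the unit shift acts by a triangular matrix: square-integrability
  removes the v-component of the shifted u, and conservation of the Wronskian makes the diagonal
  entries m and 1 / m. The rate k is - ln |m|.\<close>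

lemma floquet_decay:
  assumes p: "\<And>x. x \<ge> r \<Longrightarrow> V (x + 1) = V x" and r: "r \<ge> 0"
    and u: "classical_sol V z u u1" and v: "classical_sol V z v v1"
    and W: "\<And>x. u x * v1 x - u1 x * v x = 1" and L: "L2 u" "L2 u1"
  obtains k C where "k > 0" "C \<ge> 1"
    "\<And>x. x \<ge> 0 \<Longrightarrow> cmod (u x) \<le> C * exp (- k * x)" "\<And>x. x \<ge> 0 \<Longrightarrow> cmod (u1 x) \<le> C * exp (- k * x)"
    "\<And>x. x \<ge> 0 \<Longrightarrow> cmod (v x) \<le> C * exp (k * x)" "\<And>x. x \<ge> 0 \<Longrightarrow> cmod (v1 x) \<le> C * exp (k * x)"
proof -
  obtain m b where mb: "\<And>x. x \<ge> r \<Longrightarrow> u (x + 1) = m * u x + b * v x"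
    "\<And>x. x \<ge> r \<Longrightarrow> u1 (x + 1) = m * u1 x + b * v1 x"
    using shift_basis[OF u p u v W] by blast
  have "integrable lborel (\<lambda>x. u x * u1 (x + 1) - u1 x * u (x + 1))"
    using L2_mult_integrable[OF L(1) L2_affine[OF L(2), of 1 1]]
      L2_mult_integrable[OF L(2) L2_affine[OF L(1), of 1 1]]
    by (simp add: add.commute)
  moreover have "u x * u1 (x + 1) - u1 x * u (x + 1) = b" if "x \<ge> r" for x
  proof -
    have "u x * u1 (x + 1) - u1 x * u (x + 1) = b * (u x * v1 x - u1 x * v x)"
      by (simp only: mb[OF that]) (simp add: algebra_simps)
    then show ?thesis by (simp add: W)
  qed
  ultimately have "cmod b = 0"
    by (intro integrable_imp_zero_on_Ici[where r = r]) auto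
  then have us: "\<And>x. x \<ge> r \<Longrightarrow> u (x + 1) = m * u x" "\<And>x. x \<ge> r \<Longrightarrow> u1 (x + 1) = m * u1 x"
    using mb by auto
  obtain c a where ca: "\<And>x. x \<ge> r \<Longrightarrow> v (x + 1) = c * u x + a * v x"
    "\<And>x. x \<ge> r \<Longrightarrow> v1 (x + 1) = c * u1 x + a * v1 x"
    using shift_basis[OF v p u v W] by blast
  have "m * a * (u r * v1 r - u1 r * v r) = u (r + 1) * v1 (r + 1) - u1 (r + 1) * v (r + 1)"
    by (simp only: us[OF order_refl] ca[OF order_refl]) (simp add: algebra_simps)
  then have ma: "m * a = 1" by (simp add: W)
  then have m0: "m \<noteq> 0" "a \<noteq> 0" by auto
  \<comment> \<open>If |m| >= 1, the energy \<open>h\<close> would stay above its positive minimum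
    over one period and could not be integrable.\<close>
  have m1: "cmod m < 1"
  proof (rule ccontr)
    assume m: "\<not> cmod m < 1"
    define h where "h = (\<lambda>x. cmod (u x) ^ 2 + cmod (u1 x) ^ 2)"
    have hc: "continuous_on {r..r+1} h"
      unfolding h_def by (intro continuous_intros classical_sol_cont[OF u])
    obtain x0 where x0: "x0 \<in> {r..r+1}" "\<And>x. x \<in> {r..r+1} \<Longrightarrow> h x0 \<le> h x"
      using continuous_attains_inf[OF _ _ hc] by auto
    have "u x0 \<noteq> 0 \<or> u1 x0 \<noteq> 0" using W[of x0] by auto
    then have h0: "h x0 > 0" by (auto simp: h_def add_pos_nonneg add_nonneg_pos)
    have ge: "h x0 \<le> h x" if xr: "x \<ge> r" for x
    proof -
      obtain n y where ny: "x = y + real n" "r \<le> y" "y \<le> r + 1"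
        using shift_decomp[OF xr] by blast
      have "h x = (cmod m ^ n)\<^sup>2 * h y"
        using shift_power[of r u m y n] shift_power[of r u1 m y n] us ny
        by (simp add: h_def norm_mult norm_power power_mult_distrib algebra_simps)
      moreover have "1 \<le> (cmod m ^ n)\<^sup>2" using m by (simp add: one_le_power)
      moreover have "h y \<ge> 0" by (simp add: h_def)
      ultimately have "h y \<le> h x" using mult_right_mono[of 1 "(cmod m ^ n)\<^sup>2" "h y"] by simp
      then show ?thesis using x0(2)[of y] ny by auto
    qed
    have "h x0 = 0"
    proof (rule integrable_imp_zero_on_Ici[where r = r])
      show "integrable lborel (\<lambda>x. complex_of_real (h x))"
        unfolding h_def using L
        by (intro integrable_of_real Bochner_Integration.integrable_add) (auto simp: L2_def)
      show "h x0 \<le> cmod (complex_of_real (h x))" if "r \<le> x" for x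
        using ge[OF that] h0 by simp
    qed (use h0 in simp)
    with h0 show False by simp
  qed
  define k where "k = - ln (cmod m)"
  have k: "k > 0" using m1 m0 by (simp add: k_def)
  have lna: "ln (cmod a) = k"
  proof -
    have "cmod m * cmod a = 1" using ma by (metis norm_mult norm_one)
    then have "ln (cmod m) + ln (cmod a) = 0" using m0 by (metis ln_mult_pos ln_one zero_less_norm_iff)
    then show ?thesis by (simp add: k_def)
  qed
  have am: "a - m \<noteq> 0"
  proof
    assume "a - m = 0"
    then have "cmod m * cmod m = 1" using ma by (metis eq_iff_diff_eq_0 norm_mult norm_one)
    moreover have "cmod m * cmod m < 1" using m1 mult_strict_mono[of "cmod m" 1 "cmod m" 1] by simp
    ultimately show False by simp
  qed
  \<comment> \<open>v itself may fail to be an eigenvector of the shift. With this g the combination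
    v + g u has multiplier a, and v inherits its growth bound.\<close>
  define g where "g = c / (a - m)"
  have g: "c + g * m = a * g" using am by (simp add: g_def field_simps)
  define y where "y = (\<lambda>x. 1 * v x + g * u x)"
  define y1 where "y1 = (\<lambda>x. 1 * v1 x + g * u1 x)"
  have y: "classical_sol V z y y1"
    unfolding y_def y1_def by (rule classical_sol_lincomb[OF v u])
  have ys: "y (x + 1) = a * y x" "y1 (x + 1) = a * y1 x" if "x \<ge> r" for x
  proof -
    have "y (x + 1) = (c + g * m) * u x + a * v x" "y1 (x + 1) = (c + g * m) * u1 x + a * v1 x"
      unfolding y_def y1_def us[OF that] ca[OF that] by (simp_all add: algebra_simps)
    then show "y (x + 1) = a * y x" "y1 (x + 1) = a * y1 x"
      by (simp_all add: g y_def y1_def algebra_simps)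
  qed
  obtain C1 where C1: "C1 \<ge> 1" "\<And>x. x \<ge> 0 \<Longrightarrow> cmod (u x) \<le> C1 * exp (ln (cmod m) * x)"
    using floquet_bound[OF classical_sol_cont(1)[OF u] m0(1) r us(1)] by blast
  obtain C2 where C2: "C2 \<ge> 1" "\<And>x. x \<ge> 0 \<Longrightarrow> cmod (u1 x) \<le> C2 * exp (ln (cmod m) * x)"
    using floquet_bound[OF classical_sol_cont(2)[OF u] m0(1) r us(2)] by blast
  obtain C3 where C3: "C3 \<ge> 1" "\<And>x. x \<ge> 0 \<Longrightarrow> cmod (y x) \<le> C3 * exp (ln (cmod a) * x)"
    using floquet_bound[OF classical_sol_cont(1)[OF y] m0(2) r ys(1)] by blast
  obtain C4 where C4: "C4 \<ge> 1" "\<And>x. x \<ge> 0 \<Longrightarrow> cmod (y1 x) \<le> C4 * exp (ln (cmod a) * x)"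
    using floquet_bound[OF classical_sol_cont(2)[OF y] m0(2) r ys(2)] by blast
  define C where "C = C1 + C2 + C3 + C4 + cmod g * C1 + cmod g * C2"
  have gC: "cmod g * C1 \<ge> 0" "cmod g * C2 \<ge> 0" using C1 C2 by auto
  have C: "C \<ge> 1" "C1 \<le> C" "C2 \<le> C" "C3 + cmod g * C1 \<le> C" "C4 + cmod g * C2 \<le> C"
    using C1(1) C2(1) C3(1) C4(1) gC unfolding C_def by linarith+
  show thesis
  proof (rule that[OF k C(1)])
    fix x :: real assume x: "x \<ge> 0"
    have e: "exp (- k * x) \<le> exp (k * x)" using k x by simp
    have mk: "ln (cmod m) * x = - k * x" by (simp add: k_def)
    show u_le: "cmod (u x) \<le> C * exp (- k * x)"
      by (rule order_trans[OF C1(2)[OF x, unfolded mk] mult_right_mono[OF C(2)]]) simp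
    show u1_le: "cmod (u1 x) \<le> C * exp (- k * x)"
      by (rule order_trans[OF C2(2)[OF x, unfolded mk] mult_right_mono[OF C(3)]]) simp
    have "cmod (v x) \<le> cmod (y x) + cmod g * cmod (u x)"
      using norm_triangle_ineq4[of "y x" "g * u x"] by (simp add: y_def norm_mult)
    also have "\<dots> \<le> C3 * exp (k * x) + cmod g * (C1 * exp (- k * x))"
      using C3(2)[OF x] C1(2)[OF x] unfolding mk lna by (intro add_mono mult_left_mono) auto
    also have "\<dots> \<le> C3 * exp (k * x) + cmod g * (C1 * exp (k * x))"
      using e C1(1) by (intro add_left_mono mult_left_mono) auto
    also have "\<dots> = (C3 + cmod g * C1) * exp (k * x)" by (simp add: algebra_simps)
    also have "\<dots> \<le> C * exp (k * x)" using C(4) by (rule mult_right_mono) auto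
    finally show "cmod (v x) \<le> C * exp (k * x)" .
    have "cmod (v1 x) \<le> cmod (y1 x) + cmod g * cmod (u1 x)"
      using norm_triangle_ineq4[of "y1 x" "g * u1 x"] by (simp add: y1_def norm_mult)
    also have "\<dots> \<le> C4 * exp (k * x) + cmod g * (C2 * exp (- k * x))"
      using C4(2)[OF x] C2(2)[OF x] unfolding mk lna by (intro add_mono mult_left_mono) auto
    also have "\<dots> \<le> C4 * exp (k * x) + cmod g * (C2 * exp (k * x))"
      using e C2(1) by (intro add_left_mono mult_left_mono) auto
    also have "\<dots> = (C4 + cmod g * C2) * exp (k * x)" by (simp add: algebra_simps)
    also have "\<dots> \<le> C * exp (k * x)" using C(5) by (rule mult_right_mono) auto
    finally show "cmod (v1 x) \<le> C * exp (k * x)" .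
  qed
qed

end

section \<open>The resonance near a bound state\<close>

text \<open>csqrt z has nonnegative real part, so in (csqrt z - s) (csqrt z + s) = z - s^2 the
  second factor is at least s in modulus.\<close>

lemma csqrt_near:
  fixes z :: complex and s :: real
  assumes "s > 0"
  shows "cmod (csqrt z - of_real s) \<le> cmod (z - of_real (s\<^sup>2)) / s"
proof -
  have "(csqrt z - of_real s) * (csqrt z + of_real s) = z - of_real (s\<^sup>2)"
    by (simp add: algebra_simps power2_eq_square[symmetric])
  then have "cmod (csqrt z - of_real s) * cmod (csqrt z + of_real s) = cmod (z - of_real (s\<^sup>2))"
    by (metis norm_mult)
  moreover have "0 \<le> Re (csqrt z)" using csqrt_principal[of z] by linarith
  then have "s \<le> cmod (csqrt z + of_real s)"
    using complex_Re_le_cmod[of "csqrt z + of_real s"]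
    unfolding plus_complex.sel Re_complex_of_real by linarith
  then have "cmod (csqrt z - of_real s) * s \<le> cmod (csqrt z - of_real s) * cmod (csqrt z + of_real s)"
    by (intro mult_left_mono) auto
  ultimately show ?thesis using assms by (simp add: field_simps)
qed

lemma norm_integral_le_const:
  fixes f :: "real \<Rightarrow> complex"
  assumes "continuous_on {0..x} f" "x \<ge> 0" "\<And>y. y \<in> {0..x} \<Longrightarrow> cmod (f y) \<le> B"
  shows "cmod (integral {0..x} f) \<le> B * x"
  using integral_bound[of 0 x f B] assms by simp

text \<open>Free of differential equations: e stands for e^(-kappa M), and R, KB and K involve
  neither e nor M. On the disc the numerator is at most 2 C e (2 + s) and the denominator at least
  N0 c / (4 e), whose quotient is R e^2. K collects the three summands of the error
  \<open>X\<close>.\<close>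

lemma resonance_fixed_point:
  fixes A B :: "complex \<Rightarrow> complex" and u u1 v v1 N :: complex and e M C c s N0 :: real
  defines "E \<equiv> complex_of_real (s\<^sup>2)"
  defines "R \<equiv> 8 * C * (2 + s) / (N0 * c)"
  defines "KB \<equiv> C\<^sup>2 + 4 * C ^ 4 * R"
  defines "d0 \<equiv> v1 - \<i> * of_real s * v" and "n0 \<equiv> u1 - \<i> * of_real s * u"
  defines "K \<equiv> (R * (4 * C ^ 5 * R * (1 + s) + 2 * C ^ 3 * R / s) + R * C / s + C * (2 + s) * R * KB) / (N0 * c)"
  assumes pos: "C \<ge> 1" "s > 0" "N0 > 0" "c > 0" "M \<ge> 1" "e > 0"
    and u: "cmod u \<le> C * e" "cmod u1 \<le> C * e" and v: "cmod v \<le> C / e" "cmod v1 \<le> C / e"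
    and d0: "c / e \<le> cmod d0" and N: "N0 \<le> cmod N" "cmod N \<le> C\<^sup>2 * M"
    and cont: "continuous_on UNIV A" "continuous_on UNIV B"
    and A: "\<And>z. cmod (z - E) \<le> R * e\<^sup>2 \<Longrightarrow> cmod (A z - N) \<le> 4 * C ^ 4 * M\<^sup>2 * cmod (z - E)"
    and B: "\<And>z. cmod (z - E) \<le> R * e\<^sup>2 \<Longrightarrow> cmod (B z) \<le> C\<^sup>2 * M + 4 * C ^ 4 * M\<^sup>2 * cmod (z - E) / e\<^sup>2"
    and small: "R * (M ^ 3 * e\<^sup>2) \<le> s" "R * (M ^ 3 * e\<^sup>2) < s\<^sup>2" "4 * C ^ 4 * R * (M ^ 3 * e\<^sup>2) \<le> N0 / 2"
      "R * KB * (M ^ 3 * e\<^sup>2) \<le> 1" "2 * R * C * (M ^ 3 * e\<^sup>2) \<le> c * s"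
  obtains z where "cmod (z - E) \<le> R * e\<^sup>2"
    "(z - E) * A z * (v1 - \<i> * csqrt z * v) = (u1 - \<i> * csqrt z * u) * (1 + (z - E) * B z)"
    "cmod (z - E - n0 / (d0 * N)) \<le> K * (M\<^sup>2 * e ^ 4)"
proof -
  have R: "R > 0" using pos by (auto simp: R_def)
  have KB: "KB > 0" using pos R by (auto simp: KB_def add_pos_pos)
  \<comment> \<open>All smallness conditions are put in terms of M^3 e^2, which dominates both
    combinations that the estimates produce.\<close>
  have M: "e\<^sup>2 \<le> M ^ 3 * e\<^sup>2" "M\<^sup>2 * e\<^sup>2 \<le> M ^ 3 * e\<^sup>2"
  proof -
    have "1 * e\<^sup>2 \<le> M ^ 3 * e\<^sup>2" using pos by (intro mult_right_mono) auto
    then show "e\<^sup>2 \<le> M ^ 3 * e\<^sup>2" by simp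
    have "M\<^sup>2 * e\<^sup>2 \<le> M ^ 3 * e\<^sup>2" using pos power_increasing[of 2 3 M] by (intro mult_right_mono) auto
    then show "M\<^sup>2 * e\<^sup>2 \<le> M ^ 3 * e\<^sup>2" .
  qed
  have sm: "k * e\<^sup>2 \<le> k * (M ^ 3 * e\<^sup>2)" "k * (M\<^sup>2 * e\<^sup>2) \<le> k * (M ^ 3 * e\<^sup>2)" if "k \<ge> 0" for k
    using M that by (auto intro: mult_left_mono)
  define d where "d = (\<lambda>z. v1 - \<i> * csqrt z * v)"
  define n where "n = (\<lambda>z. u1 - \<i> * csqrt z * u)"
  define S where "S = cball E (R * e\<^sup>2)"
  have facts: "cmod (A z) \<ge> N0 / 2" "cmod (d z) \<ge> c / (2 * e)" "cmod (n z) \<le> C * e * (2 + s)"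
    "cmod ((z - E) * B z) \<le> R * KB * (M\<^sup>2 * e\<^sup>2)" "cmod (d z - d0) \<le> R * C / s * e"
    "cmod (n z - n0) \<le> R * C / s * e ^ 3" "cmod (A z - N) \<le> 4 * C ^ 4 * R * (M\<^sup>2 * e\<^sup>2)"
    "cmod (z - E) \<le> R * e\<^sup>2" "Re z > 0"
    if zS: "z \<in> S" for z
  proof -
    show z: "cmod (z - E) \<le> R * e\<^sup>2"
      using zS by (simp add: S_def dist_norm norm_minus_commute)
    have sq: "cmod (csqrt z - of_real s) \<le> R * e\<^sup>2 / s"
      using order_trans[OF csqrt_near[OF pos(2), of z, folded E_def] divide_right_mono[OF z]] pos(2) by simp
    have "4 * C ^ 4 * M\<^sup>2 * cmod (z - E) \<le> 4 * C ^ 4 * M\<^sup>2 * (R * e\<^sup>2)"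
      using z pos by (intro mult_left_mono) auto
    with A[OF z] show AN: "cmod (A z - N) \<le> 4 * C ^ 4 * R * (M\<^sup>2 * e\<^sup>2)"
      by (simp add: mult_ac)
    also have "\<dots> \<le> N0 / 2" using sm(2)[of "4 * C ^ 4 * R"] small(3) pos R by (smt (verit) mult_nonneg_nonneg zero_le_power)
    finally have "cmod (A z - N) \<le> N0 / 2" .
    then show "cmod (A z) \<ge> N0 / 2"
      using N(1) norm_triangle_ineq2[of N "N - A z"] by (simp add: norm_minus_commute)
    have "d z - d0 = - (\<i> * (csqrt z - of_real s) * v)" by (simp add: d_def d0_def algebra_simps)
    then have "cmod (d z - d0) = cmod (csqrt z - of_real s) * cmod v" by (simp add: norm_mult)
    also have "\<dots> \<le> R * e\<^sup>2 / s * (C / e)"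
      using sq v(1) R pos by (intro mult_mono) auto
    also have "\<dots> = R * C / s * e" using pos by (simp add: power2_eq_square field_simps)
    finally show dd: "cmod (d z - d0) \<le> R * C / s * e" .
    have "2 * R * C * e\<^sup>2 \<le> c * s" using sm(1)[of "2 * R * C"] small(5) R pos by (smt (verit) mult_nonneg_nonneg)
    then have "R * C / s * e \<le> c / (2 * e)" using pos by (simp add: field_simps power2_eq_square)
    then show "cmod (d z) \<ge> c / (2 * e)"
      using dd d0 norm_triangle_ineq2[of d0 "d0 - d z"] by (simp add: norm_minus_commute)
    have "R * e\<^sup>2 \<le> s" using sm(1)[of R] small(1) R by linarith
    then have "cmod (csqrt z - of_real s) \<le> 1" using order_trans[OF sq] pos by simp
    moreover have "cmod (complex_of_real s) = s" using pos by simp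
    ultimately have cs: "cmod (csqrt z) \<le> s + 1"
      using norm_triangle_sub[of "csqrt z" "of_real s"] by linarith
    have "cmod (n z) \<le> cmod u1 + cmod (csqrt z) * cmod u"
      using norm_triangle_ineq4[of u1 "\<i> * csqrt z * u"] by (simp add: n_def norm_mult)
    also have "\<dots> \<le> C * e + (s + 1) * (C * e)"
      using u cs pos by (intro add_mono mult_mono) auto
    finally show "cmod (n z) \<le> C * e * (2 + s)" by (simp add: algebra_simps)
    have "n z - n0 = - (\<i> * (csqrt z - of_real s) * u)" by (simp add: n_def n0_def algebra_simps)
    then have "cmod (n z - n0) = cmod (csqrt z - of_real s) * cmod u" by (simp add: norm_mult)
    also have "\<dots> \<le> R * e\<^sup>2 / s * (C * e)"
      using sq u(1) R pos by (intro mult_mono) auto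
    also have "\<dots> = R * C / s * e ^ 3" by (simp add: power2_eq_square power3_eq_cube)
    finally show "cmod (n z - n0) \<le> R * C / s * e ^ 3" .
    have "4 * C ^ 4 * M\<^sup>2 * cmod (z - E) / e\<^sup>2 \<le> 4 * C ^ 4 * M\<^sup>2 * (R * e\<^sup>2) / e\<^sup>2"
      using z pos by (intro divide_right_mono mult_left_mono) auto
    then have "cmod (B z) \<le> C\<^sup>2 * M + 4 * C ^ 4 * M\<^sup>2 * R"
      using B[OF z] pos by (simp add: mult_ac)
    also have "C\<^sup>2 * M \<le> C\<^sup>2 * M\<^sup>2"
      using pos by (intro mult_left_mono) (auto simp: power2_eq_square)
    finally have "cmod (B z) \<le> KB * M\<^sup>2" by (simp add: KB_def algebra_simps)
    then have "cmod ((z - E) * B z) \<le> R * e\<^sup>2 * (KB * M\<^sup>2)"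
      unfolding norm_mult using z R by (intro mult_mono) auto
    then show "cmod ((z - E) * B z) \<le> R * KB * (M\<^sup>2 * e\<^sup>2)" by (simp add: mult_ac)
    have "cmod (z - E) < s\<^sup>2" using z sm(1)[of R] small(2) R by linarith
    then show "Re z > 0" using abs_Re_le_cmod[of "z - E"] by (simp add: E_def)
  qed
  have nz: "A z \<noteq> 0" "d z \<noteq> 0" if "z \<in> S" for z
    using facts(1,2)[OF that] pos by (auto simp: divide_le_0_iff)
  define T where "T = (\<lambda>z. E + n z * (1 + (z - E) * B z) / (A z * d z))"
  \<comment> \<open>The disc lies in Re z > 0, away from the cut of \<open>csqrt\<close>.\<close>
  have cs: "continuous_on S csqrt"
    using facts(9) by (intro continuous_at_imp_continuous_on ballI continuous_at_csqrt)
      (force simp: complex_nonpos_Reals_iff)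
  have "continuous_on S T"
    unfolding T_def n_def d_def
    by (intro continuous_intros cs continuous_on_subset[OF cont(1)] continuous_on_subset[OF cont(2)])
      (use nz d_def in auto)
  moreover have "T z \<in> S" if z: "z \<in> S" for z
  proof -
    have "R * KB * (M\<^sup>2 * e\<^sup>2) \<le> 1" using sm(2)[of "R * KB"] small(4) R KB by (smt (verit) mult_nonneg_nonneg)
    then have "cmod (1 + (z - E) * B z) \<le> 2"
      using facts(4)[OF z] norm_triangle_ineq[of 1 "(z - E) * B z"] by simp
    then have "cmod (n z * (1 + (z - E) * B z)) \<le> C * e * (2 + s) * 2"
      unfolding norm_mult using facts(3)[OF z] pos by (intro mult_mono) auto
    moreover have "N0 / 2 * (c / (2 * e)) \<le> cmod (A z * d z)"
      unfolding norm_mult using facts(1,2)[OF z] pos by (intro mult_mono) auto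
    ultimately have "cmod (n z * (1 + (z - E) * B z) / (A z * d z)) \<le> C * e * (2 + s) * 2 / (N0 / 2 * (c / (2 * e)))"
      unfolding norm_divide using pos by (intro frac_le) auto
    also have "\<dots> = R * e\<^sup>2" using pos by (simp add: R_def field_simps power2_eq_square)
    finally show ?thesis by (simp add: T_def S_def dist_norm)
  qed
  moreover have "E \<in> S" "compact S" "convex S" using R by (auto simp: S_def)
  ultimately obtain z where z: "z \<in> S" "T z = z"
    using brouwer[of S T] by blast
  have eq: "(z - E) * A z * d z = n z * (1 + (z - E) * B z)"
  proof -
    have "z - E = n z * (1 + (z - E) * B z) / (A z * d z)"
      using z(2) unfolding T_def by (metis add_diff_cancel_left')
    then show ?thesis using nz[OF z(1)] by (simp add: field_simps)
  qed
  have "0 < cmod d0" using less_le_trans[OF divide_pos_pos[OF pos(4,6)] d0] .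
  moreover have "0 < cmod N" using N(1) pos(3) by linarith
  ultimately have N0: "N \<noteq> 0" "d0 \<noteq> 0" by auto
  \<comment> \<open>The exact error times N d0: the change of the denominator, the change of the
    numerator and the feedback through B. The first and the last carry the factor z - E, the middle
    one the factor csqrt z - s, so all gain the order e^2 over the leading term up to powers of
    M.\<close>
  define X where "X = (z - E) * (N * d0 - A z * d z) + (n z - n0) + n z * ((z - E) * B z)"
  have "(z - E - n0 / (d0 * N)) * (N * d0) = X"
    using eq N0 by (simp add: X_def field_simps)
  then have X: "cmod (z - E - n0 / (d0 * N)) * cmod (N * d0) = cmod X" by (metis norm_mult)
  have N0M: "N0 \<le> C\<^sup>2 * M" using N by simp
  have AM: "cmod (A z) \<le> 2 * C\<^sup>2 * M\<^sup>2"
  proof -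
    have "4 * C ^ 4 * R * (M\<^sup>2 * e\<^sup>2) \<le> N0"
      using order_trans[OF sm(2)[of "4 * C ^ 4 * R"] small(3)] pos R by simp
    then have "cmod (A z) \<le> 2 * (C\<^sup>2 * M)"
      using facts(7)[OF z(1)] N(2) norm_triangle_sub[of "A z" N] N0M by linarith
    then have "cmod (A z) \<le> 2 * C\<^sup>2 * M" by simp
    also have "\<dots> \<le> 2 * C\<^sup>2 * M\<^sup>2"
      using pos by (intro mult_left_mono) (auto simp: power2_eq_square)
    finally show ?thesis .
  qed
  have d0C: "cmod d0 \<le> C * (1 + s) / e"
  proof -
    have "cmod d0 \<le> cmod v1 + s * cmod v"
      using norm_triangle_ineq4[of v1 "\<i> * of_real s * v"] pos by (simp add: d0_def norm_mult)
    also have "\<dots> \<le> C / e + s * (C / e)" using v pos by (intro add_mono mult_left_mono) auto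
    finally show ?thesis by (simp add: algebra_simps add_divide_distrib)
  qed
  have 1: "cmod (N * d0 - A z * d z) \<le> (4 * C ^ 5 * R * (1 + s) + 2 * C ^ 3 * R / s) * (M\<^sup>2 * e)"
  proof -
    have "N * d0 - A z * d z = - ((A z - N) * d0) - A z * (d z - d0)" by (simp add: algebra_simps)
    then have "cmod (N * d0 - A z * d z) \<le> cmod (A z - N) * cmod d0 + cmod (A z) * cmod (d z - d0)"
      using norm_triangle_ineq4[of "- ((A z - N) * d0)" "A z * (d z - d0)"] by (simp add: norm_mult)
    also have "\<dots> \<le> 4 * C ^ 4 * R * (M\<^sup>2 * e\<^sup>2) * (C * (1 + s) / e) + 2 * C\<^sup>2 * M\<^sup>2 * (R * C / s * e)"
      using facts(5,7)[OF z(1)] d0C AM pos R by (intro add_mono mult_mono) auto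
    also have "\<dots> = (4 * C ^ 5 * R * (1 + s) + 2 * C ^ 3 * R / s) * (M\<^sup>2 * e)"
      using pos by (simp add: field_simps power2_eq_square eval_nat_numeral)
    finally show ?thesis .
  qed
  have "cmod X \<le> cmod (z - E) * cmod (N * d0 - A z * d z) + cmod (n z - n0) + cmod (n z) * cmod ((z - E) * B z)"
    using norm_triangle_ineq[of "(z - E) * (N * d0 - A z * d z) + (n z - n0)" "n z * ((z - E) * B z)"]
      norm_triangle_ineq[of "(z - E) * (N * d0 - A z * d z)" "n z - n0"]
    unfolding X_def norm_mult[of "z - E" "N * d0 - A z * d z"] norm_mult[of "n z"] by linarith
  also have "\<dots> \<le> R * e\<^sup>2 * ((4 * C ^ 5 * R * (1 + s) + 2 * C ^ 3 * R / s) * (M\<^sup>2 * e))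
      + R * C / s * (M\<^sup>2 * e ^ 3) + C * e * (2 + s) * (R * KB * (M\<^sup>2 * e\<^sup>2))"
  proof (intro add_mono mult_mono 1 facts z)
    have "1 * e ^ 3 \<le> M\<^sup>2 * e ^ 3" using pos by (intro mult_right_mono) auto
    then have "R * C / s * e ^ 3 \<le> R * C / s * (M\<^sup>2 * e ^ 3)"
      using R pos by (intro mult_left_mono) auto
    then show "cmod (n z - n0) \<le> R * C / s * (M\<^sup>2 * e ^ 3)" using facts(6)[OF z(1)] by linarith
  qed (use pos R in auto)
  also have "\<dots> = K * (M\<^sup>2 * e ^ 4) * (N0 * (c / e))"
    using pos by (simp add: K_def field_simps eval_nat_numeral)
  also have "\<dots> \<le> K * (M\<^sup>2 * e ^ 4) * cmod (N * d0)"
    unfolding norm_mult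
  proof (intro mult_left_mono mult_mono N d0)
    show "0 \<le> K * (M\<^sup>2 * e ^ 4)"
      unfolding K_def using pos R KB by (intro mult_nonneg_nonneg divide_nonneg_nonneg add_nonneg_nonneg) auto
  qed (use pos in auto)
  finally have "cmod (z - E - n0 / (d0 * N)) * cmod (N * d0) \<le> K * (M\<^sup>2 * e ^ 4) * cmod (N * d0)"
    unfolding X .
  then have "cmod (z - E - n0 / (d0 * N)) \<le> K * (M\<^sup>2 * e ^ 4)"
    using N0 by (simp add: mult_le_cancel_right)
  then show thesis using that[of z] facts(8)[OF z(1)] eq by (simp add: d_def n_def)
qed

section \<open>Bounds near E that are uniform in M\<close>

context bounded_potential
begin

lemma classical_sol_AC:
  assumes "classical_sol V z w w1"
  shows "has_AC_derivs w w1 (\<lambda>t. (of_real (V t) - z) * w t - 0)"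
  unfolding has_AC_derivs_def
proof (intro conjI allI impI)
  have c: "continuous_on S (\<lambda>t. (of_real (V t) - z) * w t - 0)" for S
    by (intro continuous_intros continuous_on_subset[OF V_cont] classical_sol_cont[OF assms]) auto
  fix x show "(w has_vector_derivative w1 x) (at x)" by (rule classical_solD[OF assms])
  show "(\<lambda>t. (of_real (V t) - z) * w t - 0) \<in> borel_measurable lborel"
    using borel_measurable_continuous_onI[OF c] by simp
  fix a b :: real assume ab: "a \<le> b"
  show s: "set_integrable lborel {a..b} (\<lambda>t. (of_real (V t) - z) * w t - 0)"
    unfolding set_integrable_def by (rule borel_integrable_compact[OF _ c]) auto
  have "((\<lambda>t. (of_real (V t) - z) * w t - 0) has_integral (w1 b - w1 a)) {a..b}"
    using weak_sol_integral[OF classical_imp_weak[OF assms] order_refl ab order_refl] .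
  then show "w1 b - w1 a = (LINT t:{a..b}|lborel. (of_real (V t) - z) * w t - 0)"
    using set_borel_integral_eq_integral(2)[OF s] by (simp add: integral_unique)
qed

text \<open>Supplies continuity of the coefficients of the fixed point map. Cutting g off outside
  [0, M] turns the integral into a matrix element covered by the holomorphy result.\<close>

lemma integral_u_continuous:
  assumes g: "continuous_on {0..M} g"
  shows "continuous_on UNIV (\<lambda>z. integral {0..M} (\<lambda>y. g y * u_sol V \<Phi> z y))"
proof -
  define h where "h = (\<lambda>t. indicat_real {0..M} t *\<^sub>R g t)"
  have h: "integrable lborel h"
    unfolding h_def by (rule borel_integrable_compact[OF _ g]) auto
  have AC: "has_AC_derivs (u_sol V \<Phi> z) (u_sol' V \<Phi> z) (\<lambda>t. (of_real (V t) - z) * u_sol V \<Phi> z t - 0)" for z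
    by (rule classical_sol_AC[OF uv_sol(1)])
  have "(\<lambda>z. LINT t|lborel. h t * u_sol V \<Phi> z t) holomorphic_on UNIV"
    by (rule schroedinger_holomorphic(3)[where q = "\<lambda>t. complex_of_real (V t)" and Q = Q and f = "\<lambda>_. 0"
          and ?x0.0 = 0 and r = "\<bar>M\<bar>", OF _ _ AC])
      (use q_meas[of 0] V_bound h in \<open>auto simp: uv_sol h_def indicator_def\<close>)
  moreover have "(LINT t|lborel. h t * u_sol V \<Phi> z t) = integral {0..M} (\<lambda>y. g y * u_sol V \<Phi> z y)" for z
  proof -
    have "set_integrable lborel {0..M} (\<lambda>y. g y * u_sol V \<Phi> z y)"
      unfolding set_integrable_def
      by (rule borel_integrable_compact) (auto intro!: continuous_intros g classical_sol_cont[OF uv_sol(1)])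
    from set_borel_integral_eq_integral(2)[OF this] show ?thesis
      by (simp add: set_lebesgue_integral_def h_def)
  qed
  ultimately show ?thesis by (simp add: holomorphic_on_imp_continuous_on)
qed

context
  fixes \<Phi> :: "real \<Rightarrow> complex" and E :: complex and k C M :: real and z :: complex
  assumes k: "k > 0" and C: "C \<ge> 1"
    and u_bd: "\<And>x. x \<ge> 0 \<Longrightarrow> cmod (u_sol V \<Phi> E x) \<le> C * exp (- k * x)"
    and v_bd: "\<And>x. x \<ge> 0 \<Longrightarrow> cmod (v_sol V \<Phi> E x) \<le> C * exp (k * x)"
    and M: "M \<ge> 1" and near: "4 * C\<^sup>2 * M * cmod (z - E) \<le> 1"
begin

text \<open>A bootstrap: let m be the maximum of e^(-k x) |u_z| over [0, M]. The perturbation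
  formula bounds u_z - u_E by 2 C^2 M |z - E| m e^(k x), and \<open>near\<close> makes the
  coefficient of m at most 1/2, so m <= C + m / 2. The growing weight reflects the component along
  v_E.\<close>

lemma u_sol_near:
  assumes x: "x \<in> {0..M}"
  shows "cmod (u_sol V \<Phi> z x - u_sol V \<Phi> E x) \<le> 4 * C ^ 3 * M * cmod (z - E) * exp (k * x)"
proof -
  let ?u = "u_sol V \<Phi> E" and ?v = "v_sol V \<Phi> E" and ?w = "u_sol V \<Phi> z"
  note cu = classical_sol_cont(1)[OF uv_sol(1)] and cv = classical_sol_cont(1)[OF uv_sol(2)]
  have "continuous_on {0..M} (\<lambda>x. exp (- k * x) * cmod (?w x))"
    by (intro continuous_intros cu)
  then obtain x0 where x0: "x0 \<in> {0..M}"
    "\<And>x. x \<in> {0..M} \<Longrightarrow> exp (- k * x) * cmod (?w x) \<le> exp (- k * x0) * cmod (?w x0)"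
    using continuous_attains_sup[of "{0..M}" "\<lambda>x. exp (- k * x) * cmod (?w x)"] M by auto
  define m where "m = exp (- k * x0) * cmod (?w x0)"
  have m0: "m \<ge> 0" by (simp add: m_def)
  have w: "cmod (?w y) \<le> m * exp (k * y)" if "y \<in> {0..M}" for y
  proof -
    have "exp (k * y) * (exp (- k * y) * cmod (?w y)) \<le> exp (k * y) * m"
      using x0(2)[OF that] by (intro mult_left_mono) (auto simp: m_def)
    then show ?thesis by (simp add: mult.assoc[symmetric] exp_add[symmetric] mult.commute)
  qed
  have diff: "cmod (?w x - ?u x) \<le> 2 * C\<^sup>2 * M * cmod (z - E) * m * exp (k * x)" if x: "x \<in> {0..M}" for x
  proof -
    define A where "A = integral {0..x} (\<lambda>y. ?u y * ?w y)"
    define B where "B = integral {0..x} (\<lambda>y. ?v y * ?w y)"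
    have "cmod A \<le> C * m * x"
      unfolding A_def
    proof (rule norm_integral_le_const)
      fix y assume y: "y \<in> {0..x}"
      have "cmod (?u y * ?w y) \<le> (C * exp (- k * y)) * (m * exp (k * y))"
        unfolding norm_mult using y x C by (intro mult_mono u_bd w) auto
      then show "cmod (?u y * ?w y) \<le> C * m" by (simp add: exp_minus field_simps)
    qed (use x in \<open>auto intro!: continuous_intros cu\<close>)
    also have "\<dots> \<le> C * m * M" using x C m0 by (intro mult_left_mono) auto
    finally have A: "cmod A \<le> C * m * M" .
    have e2: "exp (k * y) * exp (k * y) \<le> exp (k * x) * exp (k * x)" if "y \<in> {0..x}" for y
      using that k by (intro mult_mono) auto
    have "cmod B \<le> C * m * (exp (k * x) * exp (k * x)) * x"
      unfolding B_def
    proof (rule norm_integral_le_const)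
      fix y assume y: "y \<in> {0..x}"
      have "cmod (?v y * ?w y) \<le> (C * exp (k * y)) * (m * exp (k * y))"
        unfolding norm_mult using y x C by (intro mult_mono v_bd w) auto
      also have "\<dots> = C * m * (exp (k * y) * exp (k * y))" by simp
      also have "\<dots> \<le> C * m * (exp (k * x) * exp (k * x))"
        using e2[OF y] C m0 by (intro mult_left_mono) auto
      finally show "cmod (?v y * ?w y) \<le> C * m * (exp (k * x) * exp (k * x))" .
    qed (use x in \<open>auto intro!: continuous_intros cu cv\<close>)
    also have "\<dots> \<le> C * m * (exp (k * x) * exp (k * x)) * M"
      using x C m0 by (intro mult_left_mono) auto
    finally have B: "cmod B \<le> C * m * (exp (k * x) * exp (k * x)) * M" .
    have "?w x - ?u x = (z - E) * (?u x * B - ?v x * A)"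
      using u_sol_perturb(1)[where e = E and z = z and \<Phi> = \<Phi> and x = x] x by (simp add: A_def B_def algebra_simps)
    then have "cmod (?w x - ?u x) \<le> cmod (z - E) * (cmod (?u x) * cmod B + cmod (?v x) * cmod A)"
      using norm_triangle_ineq4[of "?u x * B" "?v x * A"] by (simp add: norm_mult mult_left_mono)
    also have "\<dots> \<le> cmod (z - E) * ((C * exp (- k * x)) * (C * m * (exp (k * x) * exp (k * x)) * M)
        + (C * exp (k * x)) * (C * m * M))"
      using A B C x M m0 by (intro mult_left_mono add_mono mult_mono u_bd v_bd) auto
    also have "\<dots> = 2 * C\<^sup>2 * M * cmod (z - E) * m * exp (k * x)"
      by (simp add: exp_minus field_simps power2_eq_square)
    finally show ?thesis .
  qed
  have "cmod (?w x0) \<le> C * exp (- k * x0) + 2 * C\<^sup>2 * M * cmod (z - E) * m * exp (k * x0)"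
    using diff[OF x0(1)] u_bd[of x0] x0(1) norm_triangle_sub[of "?w x0" "?u x0"] by auto
  then have "m \<le> exp (- k * x0) * (C * exp (- k * x0) + 2 * C\<^sup>2 * M * cmod (z - E) * m * exp (k * x0))"
    unfolding m_def by (intro mult_left_mono) auto
  also have "\<dots> = C * (exp (- k * x0) * exp (- k * x0)) + 2 * C\<^sup>2 * M * cmod (z - E) * m"
    by (simp add: exp_minus field_simps)
  also have "\<dots> \<le> C * (1 * 1) + 1 / 2 * m"
  proof (intro add_mono mult_left_mono mult_right_mono mult_mono)
    show "2 * C\<^sup>2 * M * cmod (z - E) \<le> 1 / 2" using near by simp
  qed (use k x0 C m0 in auto)
  finally have "m \<le> 2 * C" by simp
  then have "2 * C\<^sup>2 * M * cmod (z - E) * m * exp (k * x) \<le> 2 * C\<^sup>2 * M * cmod (z - E) * (2 * C) * exp (k * x)"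
    using M by (intro mult_right_mono mult_left_mono) auto
  then show ?thesis using diff[OF x] by (simp add: power2_eq_square power3_eq_cube mult_ac)
qed

text \<open>In the first integral the decay of u_E cancels the growth e^(k y) of the error. In the
  second both factors grow, which costs e^(2 k M); this is affordable for |z - E| of order e^(-2 k
  M).\<close>

lemma u_integrals_near:
  shows "cmod (integral {0..M} (\<lambda>y. u_sol V \<Phi> E y * u_sol V \<Phi> z y) - integral {0..M} (\<lambda>y. (u_sol V \<Phi> E y)\<^sup>2))
      \<le> 4 * C ^ 4 * M\<^sup>2 * cmod (z - E)"
    and "cmod (integral {0..M} (\<lambda>y. v_sol V \<Phi> E y * u_sol V \<Phi> z y))
      \<le> C\<^sup>2 * M + 4 * C ^ 4 * M\<^sup>2 * cmod (z - E) / (exp (- k * M))\<^sup>2"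
proof -
  let ?u = "u_sol V \<Phi> E" and ?v = "v_sol V \<Phi> E" and ?w = "u_sol V \<Phi> z"
  note cu = classical_sol_cont(1)[OF uv_sol(1)] and cv = classical_sol_cont(1)[OF uv_sol(2)]
  let ?D = "4 * C ^ 3 * M * cmod (z - E)"
  have D: "?D \<ge> 0" using C M by simp
  have "integral {0..M} (\<lambda>y. ?u y * ?w y) - integral {0..M} (\<lambda>y. (?u y)\<^sup>2)
      = integral {0..M} (\<lambda>y. ?u y * (?w y - ?u y))"
    by (subst Henstock_Kurzweil_Integration.integral_diff[symmetric])
      (auto intro!: integrable_continuous_real continuous_intros cu simp: algebra_simps power2_eq_square)
  also have "cmod \<dots> \<le> C * ?D * M"
  proof (rule norm_integral_le_const)
    fix y assume y: "y \<in> {0..M}"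
    have "cmod (?u y * (?w y - ?u y)) \<le> (C * exp (- k * y)) * (?D * exp (k * y))"
      unfolding norm_mult using y C by (intro mult_mono u_bd u_sol_near) auto
    then show "cmod (?u y * (?w y - ?u y)) \<le> C * ?D" by (simp add: exp_minus field_simps)
  qed (use M in \<open>auto intro!: continuous_intros cu\<close>)
  finally show "cmod (integral {0..M} (\<lambda>y. ?u y * ?w y) - integral {0..M} (\<lambda>y. (?u y)\<^sup>2))
      \<le> 4 * C ^ 4 * M\<^sup>2 * cmod (z - E)"
    by (simp add: eval_nat_numeral mult_ac)
  have "cmod (integral {0..M} (\<lambda>y. ?v y * ?w y)) \<le> (C\<^sup>2 + C * ?D * (exp (k * M) * exp (k * M))) * M"
  proof (rule norm_integral_le_const)
    fix y assume y: "y \<in> {0..M}"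
    have "cmod (?v y * ?w y) \<le> cmod (?v y) * cmod (?u y) + cmod (?v y) * cmod (?w y - ?u y)"
      unfolding norm_mult distrib_left[symmetric]
      using norm_triangle_sub[of "?w y" "?u y"] by (intro mult_left_mono) auto
    also have "\<dots> \<le> (C * exp (k * y)) * (C * exp (- k * y)) + (C * exp (k * y)) * (?D * exp (k * y))"
      using y C by (intro add_mono mult_mono u_bd v_bd u_sol_near) auto
    also have "\<dots> = C\<^sup>2 + C * ?D * (exp (k * y) * exp (k * y))"
      by (simp add: exp_minus field_simps power2_eq_square)
    also have "\<dots> \<le> C\<^sup>2 + C * ?D * (exp (k * M) * exp (k * M))"
      using D C y k by (intro add_left_mono mult_left_mono mult_mono) auto
    finally show "cmod (?v y * ?w y) \<le> C\<^sup>2 + C * ?D * (exp (k * M) * exp (k * M))" .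
  qed (use M in \<open>auto intro!: continuous_intros cu cv\<close>)
  also have "\<dots> = C\<^sup>2 * M + 4 * C ^ 4 * M\<^sup>2 * cmod (z - E) / (exp (- k * M))\<^sup>2"
    by (simp add: exp_minus field_simps eval_nat_numeral)
  finally show "cmod (integral {0..M} (\<lambda>y. ?v y * ?w y))
      \<le> C\<^sup>2 * M + 4 * C ^ 4 * M\<^sup>2 * cmod (z - E) / (exp (- k * M))\<^sup>2" .
qed

end

end

lemma cnj_eq_imp_Im_0: "cnj z = z \<Longrightarrow> Im z = 0"
  by (metis Reals_cnj_iff complex_is_Real_iff)

context bounded_potential
begin

text \<open>u_E is real, so its square integrates to a nonnegative real number that grows with M. It
  is positive at M = 1, since u_E vanishing on [0, 1] would contradict the Wronskian 1; this value
  is the lower bound uniform in M.\<close>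

lemma u_norm_pos:
  fixes \<Phi> :: "real \<Rightarrow> complex" and e :: real
  defines "N \<equiv> \<lambda>M. integral {0..M} (\<lambda>y. (u_sol V \<Phi> (of_real e) y)\<^sup>2)"
  shows "\<exists>r. (\<forall>M. N M = complex_of_real (r M)) \<and> r 1 > 0 \<and> (\<forall>M\<ge>1. r 1 \<le> r M)"
proof -
  let ?u = "u_sol V \<Phi> (of_real e)"
  note s = uv_sol(1)[of "of_real e" \<Phi>]
  define g where "g = (\<lambda>y. Re (?u y))"
  have gu: "?u y = of_real (g y)" for y
    using cnj_eq_imp_Im_0[OF uv_real(1)[of \<Phi> e y]] by (simp add: g_def complex_eq_iff)
  have gc: "continuous_on S g" for S
    unfolding g_def by (intro continuous_intros classical_sol_cont(1)[OF s])
  have gi: "(\<lambda>y. (g y)\<^sup>2) integrable_on {a..b}" for a b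
    by (intro integrable_continuous_real continuous_intros gc)
  define r where "r = (\<lambda>M. integral {0..M} (\<lambda>y. (g y)\<^sup>2))"
  have "N M = of_real (r M)" for M
  proof -
    have "((\<lambda>y. complex_of_real ((g y)\<^sup>2)) has_integral of_real (r M)) {0..M}"
      unfolding r_def using integrable_integral[OF gi] by (rule has_integral_of_real)
    from integral_unique[OF this] show ?thesis by (simp add: N_def gu)
  qed
  moreover have "r 1 \<ge> 0" unfolding r_def by (rule integral_nonneg[OF gi]) auto
  moreover have "r 1 \<noteq> 0"
  proof
    assume "r 1 = 0"
    then have "((\<lambda>y. (g y)\<^sup>2) has_integral 0) (cbox 0 1)"
      using integrable_integral[OF gi, of 0 1] by (simp add: r_def)
    then have "(g y)\<^sup>2 = 0" if "y \<in> cbox 0 1" for y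
      using has_integral_0_cbox_imp_0[of 0 1 "\<lambda>y. (g y)\<^sup>2" y] that
      by (auto intro!: continuous_intros gc)
    then have u0: "?u y = 0" if "y \<in> {0..1}" for y using that by (simp add: gu)
    have "(?u has_vector_derivative 0) (at (1/2) within {0..1})"
      by (rule has_vector_derivative_transform[of _ _ _ "\<lambda>_. 0"]) (auto simp: u0)
    then have "u_sol' V \<Phi> (of_real e) (1/2) = 0"
      using classical_solD(1)[OF s, of "1/2" "{0..1}"]
      by (intro vector_derivative_unique_within_closed_interval[of 0 1 "1/2" ?u]) auto
    then show False using uv_wronskian[of \<Phi> "of_real e" "1/2"] u0[of "1/2"] by simp
  qed
  moreover have "r 1 \<le> r M" if "M \<ge> 1" for M
    unfolding r_def by (rule integral_subset_le[OF _ gi gi]) (use that in auto)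
  ultimately show ?thesis by (intro exI[of _ r]) auto
qed

lemma resonance_exists:
  fixes \<Phi> :: "real \<Rightarrow> complex" and E k C :: real
  assumes E: "E > 0" and k: "k > 0" and C: "C \<ge> 1"
    and u_bd: "\<And>x. x \<ge> 0 \<Longrightarrow> cmod (u_sol V \<Phi> (of_real E) x) \<le> C * exp (- k * x)"
    and u1_bd: "\<And>x. x \<ge> 0 \<Longrightarrow> cmod (u_sol' V \<Phi> (of_real E) x) \<le> C * exp (- k * x)"
    and v_bd: "\<And>x. x \<ge> 0 \<Longrightarrow> cmod (v_sol V \<Phi> (of_real E) x) \<le> C * exp (k * x)"
    and v1_bd: "\<And>x. x \<ge> 0 \<Longrightarrow> cmod (v_sol' V \<Phi> (of_real E) x) \<le> C * exp (k * x)"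
  obtains \<epsilon> K where "\<epsilon> > 0"
    "\<And>M. M \<ge> 1 \<Longrightarrow> M ^ 3 * exp (- 2 * k * M) \<le> \<epsilon> \<Longrightarrow> \<exists>z. Re z > 0 \<and> Im z < 0 \<and>
       u_sol' V \<Phi> z M = \<i> * csqrt z * u_sol V \<Phi> z M \<and>
       cmod (of_real (Re z) -
         (of_real E +
          (u_sol' V \<Phi> (of_real E) M * v_sol' V \<Phi> (of_real E) M
            + of_real E * u_sol V \<Phi> (of_real E) M * v_sol V \<Phi> (of_real E) M)
          / denom V \<Phi> E M)) \<le> K * (M * exp (- 2 * k * M)) \<and>
       cmod (of_real (Im z) - (- of_real (sqrt E)) / denom V \<Phi> E M)
         \<le> K * (M * exp (- 2 * k * M))"
proof -
  define s where "s = sqrt E"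
  have s: "s > 0" "s\<^sup>2 = E" using E by (auto simp: s_def)
  let ?E = "complex_of_real E"
  obtain r where r: "\<And>M. integral {0..M} (\<lambda>y. (u_sol V \<Phi> ?E y)\<^sup>2) = complex_of_real (r M)"
    "r 1 > 0" "\<And>M. M \<ge> 1 \<Longrightarrow> r 1 \<le> r M"
    using u_norm_pos[of \<Phi> E] by blast
  define N0 where "N0 = r 1"
  \<comment> \<open>Lets d0 be compared with v1 and v at once, its imaginary part being - s
    v.\<close>
  define t where "t = min 1 s"
  have t: "t > 0" "t \<le> 1" "t \<le> s" using s by (auto simp: t_def)
  define c where "c = t / (2 * C)"
  define R where "R = 8 * C * (2 + s) / (N0 * c)"
  define KB where "KB = C\<^sup>2 + 4 * C ^ 4 * R"
  define K where "K = (R * (4 * C ^ 5 * R * (1 + s) + 2 * C ^ 3 * R / s) + R * C / s + C * (2 + s) * R * KB) / (N0 * c)"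
  have c: "c > 0" using t C by (simp add: c_def)
  have N0: "N0 > 0" using r by (simp add: N0_def)
  have R: "R > 0" using C s N0 c by (simp add: R_def)
  have KB: "KB > 0" using C R by (simp add: KB_def add_pos_pos)
  have K: "K \<ge> 0"
    unfolding K_def using C s N0 c R KB
    by (intro divide_nonneg_nonneg add_nonneg_nonneg mult_nonneg_nonneg) auto
  \<comment> \<open>Comes from the upper bound G M / e^2 for the denominator of the leading term, by
    which Im z < 0 is shown.\<close>
  define G where "G = C ^ 4 * (1 + s)\<^sup>2"
  have G: "G > 0" using C s by (simp add: G_def)
  \<comment> \<open>One summand per smallness condition, in order: csqrt z within 1 of s, the disc
    inside Re z > 0, |A z| at least N0 / 2, the feedback (z - E) B z at most 1, the denominator at
    least half of its lower bound at E, the hypothesis of the bootstrap, and Im z < 0. All are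
    positive, so h <= 1 / P makes each of them times h at most 1.\<close>
  define P where "P = R / s + 2 * R / s\<^sup>2 + 8 * C ^ 4 * R / N0 + R * KB + 2 * R * C / (c * s)
    + 4 * C\<^sup>2 * R + 2 * (K + 1) * G / s"
  have P_pos: "R / s > 0" "2 * R / s\<^sup>2 > 0" "8 * C ^ 4 * R / N0 > 0" "R * KB > 0" "2 * R * C / (c * s) > 0"
    "4 * C\<^sup>2 * R > 0" "2 * (K + 1) * G / s > 0"
    using R s C N0 c K KB G by auto
  then have P: "P > 0" unfolding P_def by linarith
  show thesis
  proof (rule that[of "1 / P" "K * (1 / P)"])
    show "1 / P > 0" using P by simp
    fix M :: real assume M: "M \<ge> 1" and small: "M ^ 3 * exp (- 2 * k * M) \<le> 1 / P"
    define e where "e = exp (- k * M)"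
    have e: "e > 0" "e\<^sup>2 = exp (- 2 * k * M)"
      by (auto simp: e_def power2_eq_square exp_add[symmetric])
    define h where "h = M ^ 3 * e\<^sup>2"
    have h: "h > 0" "h \<le> 1 / P" using small M e by (auto simp: h_def)
    have Ph: "x * h \<le> 1" if "x \<le> P" for x
    proof -
      have "x * h \<le> P * h" using that h by (intro mult_right_mono) auto
      also have "\<dots> \<le> 1" using h P by (simp add: field_simps)
      finally show ?thesis .
    qed
    have sm: "R / s * h \<le> 1" "2 * R / s\<^sup>2 * h \<le> 1" "8 * C ^ 4 * R / N0 * h \<le> 1" "R * KB * h \<le> 1"
      "2 * R * C / (c * s) * h \<le> 1" "4 * C\<^sup>2 * R * h \<le> 1" "2 * (K + 1) * G / s * h \<le> 1"
      using P_pos by (intro Ph; simp add: P_def)+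
    define u u1 v v1 N where "u = u_sol V \<Phi> ?E M" and "u1 = u_sol' V \<Phi> ?E M"
      and "v = v_sol V \<Phi> ?E M" and "v1 = v_sol' V \<Phi> ?E M"
      and "N = integral {0..M} (\<lambda>y. (u_sol V \<Phi> ?E y)\<^sup>2)"
    have ei: "exp (k * M) = 1 / e" by (simp add: e_def exp_minus field_simps)
    have bu: "cmod u \<le> C * e" "cmod u1 \<le> C * e"
      using u_bd[of M] u1_bd[of M] M by (auto simp: u_def u1_def e_def)
    have bv: "cmod v \<le> C / e" "cmod v1 \<le> C / e"
      using v_bd[of M] v1_bd[of M] M by (auto simp: v_def v1_def ei)
    have W: "u * v1 - u1 * v = 1" unfolding u_def u1_def v_def v1_def by (rule uv_wronskian)
    have real: "cnj u = u" "cnj u1 = u1" "cnj v = v" "cnj v1 = v1"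
      unfolding u_def u1_def v_def v1_def by (rule uv_real)+
    then have Im0: "Im u = 0" "Im u1 = 0" "Im v = 0" "Im v1 = 0"
      by (auto intro: cnj_eq_imp_Im_0)
    define d0 where "d0 = v1 - \<i> * of_real s * v"
    define n0 where "n0 = u1 - \<i> * of_real s * u"
    \<comment> \<open>The Wronskian is 1 and u, u1 are at most C e, so v and v1 cannot both be
      small. They are real, so in d0 = v1 - i s v they cannot cancel.\<close>
    have d0_le: "c / e \<le> cmod d0"
    proof -
      have "1 \<le> cmod u * cmod v1 + cmod u1 * cmod v"
        using W norm_triangle_ineq4[of "u * v1" "u1 * v"] by (simp add: norm_mult)
      also have "\<dots> \<le> C * e * cmod v1 + C * e * cmod v"
        using bu by (intro add_mono mult_right_mono) auto
      finally have *: "1 / (C * e) \<le> cmod v1 + cmod v" using C e by (simp add: field_simps)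
      have "cmod v1 = \<bar>Re d0\<bar>" "s * cmod v = \<bar>Im d0\<bar>"
        using Im0 s by (auto simp: d0_def cmod_eq_Re abs_mult)
      then have "cmod v1 \<le> cmod d0" "s * cmod v \<le> cmod d0"
        using abs_Re_le_cmod[of d0] abs_Im_le_cmod[of d0] by auto
      moreover have "t * (1 / (C * e)) \<le> t * (cmod v1 + cmod v)"
        using * t by (intro mult_left_mono) auto
      moreover have "t * cmod v1 \<le> cmod v1" "t * cmod v \<le> s * cmod v"
        using t mult_right_mono[of t 1 "cmod v1"] by (auto intro: mult_right_mono)
      ultimately have "t * (1 / (C * e)) \<le> 2 * cmod d0" by (simp add: distrib_left)
      then show ?thesis using C e by (simp add: c_def field_simps)
    qed
    have Nr: "N = of_real (r M)" by (simp add: N_def r)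
    have rM: "r M \<ge> N0" "r M > 0" using r(3)[OF M] r(2) by (auto simp: N0_def)
    have N: "N0 \<le> cmod N" "cmod N \<le> C\<^sup>2 * M"
    proof -
      show "N0 \<le> cmod N" using rM by (simp add: Nr)
      show "cmod N \<le> C\<^sup>2 * M"
        unfolding N_def
      proof (rule norm_integral_le_const)
        fix y assume y: "y \<in> {0..M}"
        have "C * exp (- k * y) \<le> C * 1" using y k C by (intro mult_left_mono) auto
        then have "cmod (u_sol V \<Phi> ?E y) \<le> C" using u_bd[of y] y by auto
        then show "cmod ((u_sol V \<Phi> ?E y)\<^sup>2) \<le> C\<^sup>2" by (simp add: norm_power power_mono)
      qed (use M in \<open>auto intro!: continuous_intros classical_sol_cont(1)[OF uv_sol(1)]\<close>)
    qed
    define A where "A = (\<lambda>z. integral {0..M} (\<lambda>y. u_sol V \<Phi> ?E y * u_sol V \<Phi> z y))"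
    define B where "B = (\<lambda>z. integral {0..M} (\<lambda>y. v_sol V \<Phi> ?E y * u_sol V \<Phi> z y))"
    have contAB: "continuous_on UNIV A" "continuous_on UNIV B"
      unfolding A_def B_def
      by (intro integral_u_continuous classical_sol_cont(1)[OF uv_sol(1)] classical_sol_cont(1)[OF uv_sol(2)])+
    have Es: "?E = complex_of_real (s\<^sup>2)" using s by simp
    have near: "4 * C\<^sup>2 * M * cmod (z - ?E) \<le> 1" if z: "cmod (z - ?E) \<le> R * e\<^sup>2" for z
    proof -
      have "M \<le> M ^ 3" using power_increasing[of 1 3 M] M by simp
      then have "M * e\<^sup>2 \<le> h" unfolding h_def by (intro mult_right_mono) auto
      then have "4 * C\<^sup>2 * R * (M * e\<^sup>2) \<le> 4 * C\<^sup>2 * R * h" using C R by (intro mult_left_mono) auto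
      moreover have "4 * C\<^sup>2 * M * cmod (z - ?E) \<le> 4 * C\<^sup>2 * M * (R * e\<^sup>2)"
        using z C M by (intro mult_left_mono) auto
      ultimately show ?thesis using sm(6) by (simp add: mult_ac)
    qed
    obtain z where z: "cmod (z - ?E) \<le> R * e\<^sup>2"
      and eq: "(z - ?E) * A z * (v1 - \<i> * csqrt z * v) = (u1 - \<i> * csqrt z * u) * (1 + (z - ?E) * B z)"
      and err: "cmod (z - ?E - n0 / (d0 * N)) \<le> K * (M\<^sup>2 * e ^ 4)"
    proof (rule resonance_fixed_point[of C s N0 c M e u u1 v v1 N A B, folded Es R_def KB_def d0_def n0_def])
      show "C \<ge> 1" "s > 0" "N0 > 0" "c > 0" "M \<ge> 1" "e > 0" by fact+
      show "R * (M ^ 3 * e\<^sup>2) \<le> s" using sm(1) s by (simp add: h_def field_simps)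
      show "R * (M ^ 3 * e\<^sup>2) < s\<^sup>2"
      proof -
        have "2 * (R * h) \<le> s\<^sup>2" using sm(2) s(1) by (simp add: field_simps)
        then show ?thesis using mult_pos_pos[OF R h(1)] unfolding h_def by linarith
      qed
      show "4 * C ^ 4 * R * (M ^ 3 * e\<^sup>2) \<le> N0 / 2" using sm(3) N0 by (simp add: h_def field_simps)
      show "R * KB * (M ^ 3 * e\<^sup>2) \<le> 1" using sm(4) by (simp add: h_def)
      show "2 * R * C * (M ^ 3 * e\<^sup>2) \<le> c * s" using sm(5) s c by (simp add: h_def field_simps)
      fix z assume z: "cmod (z - ?E) \<le> R * e\<^sup>2"
      note un = u_integrals_near[OF k C u_bd v_bd M near[OF z]]
      show "cmod (A z - N) \<le> 4 * C ^ 4 * M\<^sup>2 * cmod (z - ?E)"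
        unfolding A_def N_def by (rule un(1))
      show "cmod (B z) \<le> C\<^sup>2 * M + 4 * C ^ 4 * M\<^sup>2 * cmod (z - ?E) / e\<^sup>2"
        unfolding B_def e_def by (rule un(2))
    next
      fix z assume "cmod (z - ?E) \<le> R * e\<^sup>2"
        "(z - ?E) * A z * (v1 - \<i> * csqrt z * v) = (u1 - \<i> * csqrt z * u) * (1 + (z - ?E) * B z)"
        "cmod (z - ?E - n0 / (d0 * N)) \<le> (R * (4 * C ^ 5 * R * (1 + s) + 2 * C ^ 3 * R / s) + R * C / s + C * (2 + s) * R * KB) / (N0 * c) * (M\<^sup>2 * e ^ 4)"
      then show thesis unfolding K_def[symmetric] by (rule that)
    qed (rule bu bv d0_le N contAB)+
    have res: "u_sol' V \<Phi> z M = \<i> * csqrt z * u_sol V \<Phi> z M"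
    proof -
      have "M \<ge> 0" using M by simp
      note up = u_sol_perturb[where e = ?E and z = z and \<Phi> = \<Phi> and x = M, OF this,
          folded A_def B_def u_def u1_def v_def v1_def]
      have "u_sol' V \<Phi> z M - \<i> * csqrt z * u_sol V \<Phi> z M
        = (u1 - \<i> * csqrt z * u) * (1 + (z - ?E) * B z) - (z - ?E) * A z * (v1 - \<i> * csqrt z * v)"
        unfolding up by (simp add: A_def B_def algebra_simps)
      then show ?thesis using eq by simp
    qed
    define D where "D = (cmod d0)\<^sup>2"
    have "0 < c / e" using c e by simp
    then have d00: "d0 \<noteq> 0" using d0_le by auto
    then have D0: "D > 0" by (simp add: D_def)
    \<comment> \<open>Reality of v and v1 makes the second factor the conjugate of d0.\<close>
    have dd: "d0 * (v1 + \<i> * of_real s * v) = of_real D"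
    proof -
      have "cnj d0 = v1 + \<i> * of_real s * v" by (simp add: d0_def real)
      then show ?thesis by (simp only: complex_norm_square D_def)
    qed
    have DE: "v1\<^sup>2 + ?E * v\<^sup>2 = of_real D"
    proof -
      have "v1\<^sup>2 + ?E * v\<^sup>2 = d0 * (v1 + \<i> * of_real s * v)"
        unfolding Es by (simp add: d0_def algebra_simps power2_eq_square)
      then show ?thesis by (simp add: dd)
    qed
    have den: "denom V \<Phi> E M = of_real (D * r M)"
      by (simp add: denom_def r DE[unfolded v_def v1_def])
    define X where "X = (u1 * v1 + ?E * u * v) / of_real (D * r M)"
    define Y where "Y = - s / (D * r M)"
    have Xr: "Im X = 0" using Im0 by (simp add: X_def Im_divide_of_real)
    \<comment> \<open>Expanding by the conjugate of d0 leaves - s times the Wronskian as the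
      imaginary part of the numerator; this is where the explicit leading term of Im z comes
      from.\<close>
    have del: "n0 / (d0 * N) = X + \<i> * of_real Y"
    proof -
      have "n0 * (v1 + \<i> * of_real s * v) = u1 * v1 + ?E * u * v - \<i> * of_real s * (u * v1 - u1 * v)"
        unfolding Es by (simp add: n0_def algebra_simps power2_eq_square)
      then have nn: "n0 * (v1 + \<i> * of_real s * v) = u1 * v1 + ?E * u * v - \<i> * of_real s"
        by (simp add: W)
      have "v1 + \<i> * of_real s * v \<noteq> 0" using dd D0 by auto
      then have "n0 / (d0 * N) = n0 * (v1 + \<i> * of_real s * v) / (d0 * (v1 + \<i> * of_real s * v) * N)"
        by simp
      also have "\<dots> = X + \<i> * of_real Y"
        unfolding nn dd Nr X_def Y_def using D0 rM by (simp add: field_simps)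
      finally show ?thesis .
    qed
    \<comment> \<open>One of the two factors M e^2 is at most 1 / P, which leaves the first power of
      M and half of the exponent.\<close>
    have err': "K * (M\<^sup>2 * e ^ 4) \<le> K * (1 / P) * (M * e\<^sup>2)"
    proof -
      have "M \<le> M ^ 3" using power_increasing[of 1 3 M] M by simp
      then have "M * e\<^sup>2 \<le> h" unfolding h_def by (intro mult_right_mono) auto
      then have "M * e\<^sup>2 * (M * e\<^sup>2) \<le> 1 / P * (M * e\<^sup>2)"
        using h M by (intro mult_right_mono) auto
      then have "K * (M * e\<^sup>2 * (M * e\<^sup>2)) \<le> K * (1 / P * (M * e\<^sup>2))"
        using K by (rule mult_left_mono)
      then show ?thesis by (simp add: power2_eq_square eval_nat_numeral mult_ac)
    qed
    define w where "w = z - ?E - (X + \<i> * of_real Y)"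
    have w: "cmod w \<le> K * (M\<^sup>2 * e ^ 4)" using err by (simp add: w_def del)
    have Rew: "of_real (Re z) - (?E + X) = complex_of_real (Re w)"
      using Xr by (simp add: complex_eq_iff w_def)
    have Imw: "complex_of_real (Im z) - of_real Y = of_real (Im w)"
      using Xr by (simp add: complex_eq_iff w_def)
    have re_le: "cmod (of_real (Re z) - (?E + X)) \<le> K * (1 / P) * (M * e\<^sup>2)"
      unfolding Rew using abs_Re_le_cmod[of w] w err' by simp
    have im_le: "cmod (of_real (Im z) - complex_of_real Y) \<le> K * (1 / P) * (M * e\<^sup>2)"
      unfolding Imw using abs_Im_le_cmod[of w] w err' by simp
    \<comment> \<open>The leading term is at most - s e^2 / (G M) and the error at most K h e^2 / M,
      so K h < s / G decides the sign.\<close>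
    have "Im z < 0"
    proof -
      have "cmod d0 \<le> cmod v1 + s * cmod v"
        using norm_triangle_ineq4[of v1 "\<i> * of_real s * v"] s by (simp add: d0_def norm_mult)
      also have "\<dots> \<le> C / e + s * (C / e)" using bv s by (intro add_mono mult_left_mono) auto
      also have "\<dots> = C * (1 + s) / e" by (simp add: algebra_simps add_divide_distrib)
      finally have "D \<le> (C * (1 + s) / e)\<^sup>2" unfolding D_def by (rule power_mono) auto
      moreover have "r M \<le> C\<^sup>2 * M" using N(2) rM by (simp add: Nr)
      ultimately have "D * r M \<le> (C * (1 + s) / e)\<^sup>2 * (C\<^sup>2 * M)"
        using rM D0 by (intro mult_mono) auto
      also have "\<dots> = G * M / e\<^sup>2"
        by (simp add: G_def power_divide power_mult_distrib eval_nat_numeral)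
      finally have "s / (G * M / e\<^sup>2) \<le> s / (D * r M)"
        using s rM D0 by (intro divide_left_mono) (auto intro!: mult_pos_pos divide_pos_pos G simp: M e less_le_trans[OF zero_less_one M])
      then have Yle: "Y \<le> - (s / G * (e\<^sup>2 / M))" by (simp add: Y_def)
      have "(K + 1) * h < s / G"
      proof -
        have "(K + 1) * h * 2 \<le> s / G" using sm(7) s G by (simp add: field_simps)
        moreover have "(K + 1) * h > 0" using K h by simp
        ultimately show ?thesis by linarith
      qed
      then have "K * h < s / G" using h(1) by (simp add: algebra_simps)
      then have "K * h * (e\<^sup>2 / M) < s / G * (e\<^sup>2 / M)"
        using e M by (intro mult_strict_right_mono) auto
      moreover have "K * h * (e\<^sup>2 / M) = K * (M\<^sup>2 * e ^ 4)"
        using M by (simp add: h_def field_simps eval_nat_numeral)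
      ultimately have "K * (M\<^sup>2 * e ^ 4) < s / G * (e\<^sup>2 / M)" by simp
      moreover have "Im z = Im w + Y" using Xr by (simp add: w_def)
      ultimately show ?thesis using Yle w abs_Im_le_cmod[of w] by linarith
    qed
    moreover have "Re z > 0"
    proof -
      have "M \<ge> 0" using M by simp
      have "1 \<le> M ^ 3" using M by simp
      then have "e\<^sup>2 \<le> h" unfolding h_def using mult_right_mono[of 1 "M ^ 3" "e\<^sup>2"] by simp
      then have "R * e\<^sup>2 \<le> R * h" using R by simp
      moreover have "2 * (R * h) \<le> s\<^sup>2" using sm(2) s(1) by (simp add: field_simps)
      moreover have "R * h > 0" using R h by simp
      ultimately have "cmod (z - ?E) < E" using z s(2) by linarith
      then show ?thesis using abs_Re_le_cmod[of "z - ?E"] by simp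
    qed
    ultimately show "\<exists>z. Re z > 0 \<and> Im z < 0 \<and>
       u_sol' V \<Phi> z M = \<i> * csqrt z * u_sol V \<Phi> z M \<and>
       cmod (of_real (Re z) -
         (of_real E +
          (u_sol' V \<Phi> (of_real E) M * v_sol' V \<Phi> (of_real E) M
            + of_real E * u_sol V \<Phi> (of_real E) M * v_sol V \<Phi> (of_real E) M)
          / denom V \<Phi> E M)) \<le> K * (1 / P) * (M * exp (- 2 * k * M)) \<and>
       cmod (of_real (Im z) - (- of_real (sqrt E)) / denom V \<Phi> E M)
         \<le> K * (1 / P) * (M * exp (- 2 * k * M))"
      using res re_le im_le
      unfolding den e(2)[symmetric] X_def Y_def u_def u1_def v_def v1_def s_def
      by (intro exI[of _ z]) simp
  qed
qed

end

section \<open>Outgoing solutions and the continued resolvent\<close>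

lemma L2_add:
  assumes "L2 f" "L2 g"
  shows "L2 (\<lambda>x. f x + g x)"
  unfolding L2_def
proof
  show m: "(\<lambda>x. f x + g x) \<in> borel_measurable lborel"
    using assms by (auto simp: L2_def intro: borel_measurable_add)
  show "integrable lborel (\<lambda>x. (cmod (f x + g x))\<^sup>2)"
  proof (rule Bochner_Integration.integrable_bound)
    show "integrable lborel (\<lambda>x. 2 * (cmod (f x))\<^sup>2 + 2 * (cmod (g x))\<^sup>2)"
      using assms by (auto simp: L2_def)
    show "(\<lambda>x. (cmod (f x + g x))\<^sup>2) \<in> borel_measurable lborel"
      using measurable_compose[OF m borel_measurable_norm] by (intro borel_measurable_power) auto
    have "(cmod (f x + g x))\<^sup>2 \<le> 2 * (cmod (f x))\<^sup>2 + 2 * (cmod (g x))\<^sup>2" for x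
    proof -
      have "(cmod (f x + g x))\<^sup>2 \<le> (cmod (f x) + cmod (g x))\<^sup>2"
        by (intro power_mono norm_triangle_ineq) auto
      also have "\<dots> \<le> 2 * (cmod (f x))\<^sup>2 + 2 * (cmod (g x))\<^sup>2"
        using sum_squares_bound[of "cmod (f x)" "cmod (g x)"] by (simp add: power2_sum)
      finally show ?thesis .
    qed
    then show "AE x in lborel. norm ((cmod (f x + g x))\<^sup>2) \<le> norm (2 * (cmod (f x))\<^sup>2 + 2 * (cmod (g x))\<^sup>2)"
      by (auto intro!: AE_I2)
  qed
qed

lemma L2_bounded_mult:
  fixes q f :: "real \<Rightarrow> complex"
  assumes q: "q \<in> borel_measurable borel" "\<And>t. cmod (q t) \<le> Q" and f: "L2 f"
  shows "L2 (\<lambda>x. q x * f x)"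
  unfolding L2_def
proof
  show m: "(\<lambda>x. q x * f x) \<in> borel_measurable lborel"
    using q f by (auto simp: L2_def intro: borel_measurable_times)
  show "integrable lborel (\<lambda>x. (cmod (q x * f x))\<^sup>2)"
  proof (rule Bochner_Integration.integrable_bound)
    show "integrable lborel (\<lambda>x. Q\<^sup>2 * (cmod (f x))\<^sup>2)"
      using f by (auto simp: L2_def)
    show "(\<lambda>x. (cmod (q x * f x))\<^sup>2) \<in> borel_measurable lborel"
      using measurable_compose[OF m borel_measurable_norm] by (intro borel_measurable_power) auto
    have "(cmod (q x * f x))\<^sup>2 \<le> Q\<^sup>2 * (cmod (f x))\<^sup>2" for x
      unfolding norm_mult power_mult_distrib using q(2) by (intro mult_right_mono power_mono) auto
    then show "AE x in lborel. norm ((cmod (q x * f x))\<^sup>2) \<le> norm (Q\<^sup>2 * (cmod (f x))\<^sup>2)"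
      by (auto intro!: AE_I2)
  qed
qed

lemma L2_comp_integrable:
  assumes "L2_comp f"
  shows "integrable lborel f"
proof -
  obtain r where L: "L2 f" and r: "\<And>x. \<bar>x\<bar> > r \<Longrightarrow> f x = 0"
    using assms by (auto simp: L2_comp_def)
  show ?thesis
  proof (rule Bochner_Integration.integrable_bound)
    show "integrable lborel (\<lambda>x. (cmod (f x))\<^sup>2 + indicat_real {-r..r} x)"
      using L by (intro Bochner_Integration.integrable_add) (auto simp: L2_def integrable_indicator_iff emeasure_lborel_Icc_eq)
    show "f \<in> borel_measurable lborel" using L by (simp add: L2_def)
    have "cmod (f x) \<le> (cmod (f x))\<^sup>2 + indicat_real {-r..r} x" for x
    proof (cases "x \<in> {-r..r}")
      case True
      have "2 * cmod (f x) \<le> (cmod (f x))\<^sup>2 + 1"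
        using sum_squares_bound[of "cmod (f x)" 1] by simp
      then have "cmod (f x) \<le> (cmod (f x))\<^sup>2 + 1" using norm_ge_zero[of "f x"] by linarith
      then show ?thesis using True by simp
    next
      case False
      then have "f x = 0" by (intro r) auto
      then show ?thesis by simp
    qed
    then show "AE x in lborel. cmod (f x) \<le> norm ((cmod (f x))\<^sup>2 + indicat_real {-r..r} x)"
      by (intro AE_I2) (auto intro: order_trans)
  qed
qed

lemma integrable_exp_abs:
  assumes "a > 0"
  shows "integrable lborel (\<lambda>x::real. exp (- a * \<bar>x\<bar>))"
proof -
  define h where "h = (\<lambda>x::real. indicat_real {0..} x *\<^sub>R exp (- a * x))"
  have hm: "h \<in> borel_measurable borel"
    unfolding h_def by (intro borel_measurable_continuous_on_indicator continuous_intros) auto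
  have "set_integrable lebesgue {0..} (\<lambda>x::real. exp (- a * x))"
    by (intro nonnegative_absolutely_integrable_1 integrable_on_exp_minus_to_infinity assms) auto
  then have "integrable lebesgue h" by (simp add: set_integrable_def h_def)
  then have h: "integrable lborel h"
    using hm by (subst (asm) integrable_completion) auto
  have h': "integrable lborel (\<lambda>x. h (0 + (-1) * x))"
    by (rule lborel_integrable_real_affine[OF h]) auto
  show ?thesis
  proof (rule Bochner_Integration.integrable_bound[OF Bochner_Integration.integrable_add[OF h h']])
    show "(\<lambda>x::real. exp (- a * \<bar>x\<bar>)) \<in> borel_measurable lborel"
      using borel_measurable_continuous_onI[of "\<lambda>x::real. exp (- a * \<bar>x\<bar>)"]
      by (auto intro!: continuous_intros)
    show "AE x in lborel. norm (exp (- a * \<bar>x\<bar>)) \<le> norm (h x + h (0 + (-1) * x))"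
      by (intro AE_I2) (auto simp: h_def indicator_def)
  qed
qed

lemma exp_decay_L2:
  fixes u :: "real \<Rightarrow> complex"
  assumes c: "continuous_on UNIV u" and l: "l > 0"
    and tail: "\<And>x. \<bar>x\<bar> \<ge> R \<Longrightarrow> cmod (u x) \<le> A * exp (- l * \<bar>x\<bar>)"
  shows "L2 u"
proof -
  obtain S where S: "S \<ge> 0" "\<And>x. x \<in> {-\<bar>R\<bar>..\<bar>R\<bar>} \<Longrightarrow> cmod (u x) \<le> S"
    using sup_bound_on_Icc[OF continuous_on_subset[OF c]] by blast
  define B where "B = \<bar>A\<bar> + S * exp (l * \<bar>R\<bar>)"
  have B: "cmod (u x) \<le> B * exp (- l * \<bar>x\<bar>)" for x
  proof (cases "\<bar>x\<bar> \<ge> \<bar>R\<bar>")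
    case True
    have "A \<le> B" using S(1) by (simp add: B_def add_increasing2)
    then have "A * exp (- l * \<bar>x\<bar>) \<le> B * exp (- l * \<bar>x\<bar>)" by (intro mult_right_mono) auto
    then show ?thesis using tail[of x] True by linarith
  next
    case False
    then have "cmod (u x) \<le> S" by (intro S) auto
    also have "\<dots> \<le> S * (exp (l * \<bar>R\<bar>) * exp (- l * \<bar>x\<bar>))"
      using False l S(1) mult_left_mono[of 1 "exp (l * \<bar>R\<bar>) * exp (- l * \<bar>x\<bar>)" S]
      by (simp add: exp_add[symmetric])
    also have "\<dots> \<le> B * exp (- l * \<bar>x\<bar>)"
      unfolding mult.assoc[symmetric] by (intro mult_right_mono) (auto simp: B_def)
    finally show ?thesis .
  qed
  have um: "u \<in> borel_measurable borel" using c by (rule borel_measurable_continuous_onI)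
  have "integrable lborel (\<lambda>x. (cmod (u x))\<^sup>2)"
  proof (rule Bochner_Integration.integrable_bound)
    show "integrable lborel (\<lambda>x. B\<^sup>2 * exp (- (2 * l) * \<bar>x\<bar>))"
      using integrable_exp_abs[of "2 * l"] l by simp
    show "(\<lambda>x. (cmod (u x))\<^sup>2) \<in> borel_measurable lborel" using um by simp
    have "(cmod (u x))\<^sup>2 \<le> B\<^sup>2 * exp (- (2 * l) * \<bar>x\<bar>)" for x
    proof -
      have "(cmod (u x))\<^sup>2 \<le> (B * exp (- l * \<bar>x\<bar>))\<^sup>2" by (intro power_mono B) auto
      also have "\<dots> = B\<^sup>2 * exp (- (2 * l) * \<bar>x\<bar>)"
        by (simp add: power_mult_distrib power2_eq_square exp_add[symmetric])
      finally show ?thesis .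
    qed
    then show "AE x in lborel. norm ((cmod (u x))\<^sup>2) \<le> norm (B\<^sup>2 * exp (- (2 * l) * \<bar>x\<bar>))"
      by (intro AE_I2) auto
  qed
  then show ?thesis using um by (simp add: L2_def)
qed

lemma has_AC_derivs_cont:
  assumes "has_AC_derivs w w1 w2"
  shows "continuous_on S w" "continuous_on S w1"
proof -
  \<comment> \<open>Any such triple solves the integrated equation with zero potential and source -
    w2, which gives continuity of w1.\<close>
  have weak: "weak_sol (\<lambda>_. 0) (\<lambda>t. - w2 t) w w1 a b" for a b
    by (rule has_AC_derivs_weak_sol[OF assms]) auto
  have "isCont w x \<and> isCont w1 x" for x
    using weak_sol_cont[OF weak, of "x - 1" "x + 1"]
    by (auto intro: continuous_on_interior simp: interior_atLeastAtMost_real)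
  then show "continuous_on S w" "continuous_on S w1"
    by (auto intro: continuous_at_imp_continuous_on)
qed

lemma has_AC_derivs_lincomb:
  assumes "has_AC_derivs w w1 w2" "has_AC_derivs y y1 y2"
  shows "has_AC_derivs (\<lambda>t. c * w t + d * y t) (\<lambda>t. c * w1 t + d * y1 t) (\<lambda>t. c * w2 t + d * y2 t)"
  unfolding has_AC_derivs_def
proof (intro conjI allI impI)
  fix x
  show "((\<lambda>t. c * w t + d * y t) has_vector_derivative c * w1 x + d * y1 x) (at x)"
    using assms by (intro has_vector_derivative_add has_vector_derivative_mult_right) (auto simp: has_AC_derivs_def)
  show "(\<lambda>t. c * w2 t + d * y2 t) \<in> borel_measurable lborel"
    using assms by (intro borel_measurable_add borel_measurable_times borel_measurable_const) (auto simp: has_AC_derivs_def)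
  fix a b :: real assume ab: "a \<le> b"
  have s: "set_integrable lborel {a..b} (\<lambda>t. c * w2 t)" "set_integrable lborel {a..b} (\<lambda>t. d * y2 t)"
    using assms ab by (auto simp: has_AC_derivs_def)
  show "set_integrable lborel {a..b} (\<lambda>t. c * w2 t + d * y2 t)"
    by (rule set_integral_add(1)[OF s])
  have "w1 b - w1 a = (LINT t:{a..b}|lborel. w2 t)" "y1 b - y1 a = (LINT t:{a..b}|lborel. y2 t)"
    using assms ab by (auto simp: has_AC_derivs_def)
  then show "c * w1 b + d * y1 b - (c * w1 a + d * y1 a) = (LINT t:{a..b}|lborel. c * w2 t + d * y2 t)"
    by (simp add: set_integral_add(2)[OF s] algebra_simps)
qed

lemma weak_sol_exp:
  "weak_sol (\<lambda>_. c\<^sup>2) (\<lambda>_. 0) (\<lambda>x. A * exp (c * of_real x)) (\<lambda>x. c * (A * exp (c * of_real x))) a b"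
proof -
  have d: "((\<lambda>x. B * exp (c * of_real x)) has_vector_derivative c * (B * exp (c * of_real x))) (at x within S)" for B S and x :: real
  proof -
    have "((\<lambda>z. B * exp (c * z)) has_field_derivative c * (B * exp (c * of_real x))) (at (of_real x) within UNIV)"
      by (auto intro!: derivative_eq_intros)
    from has_vector_derivative_real_field[OF this] show ?thesis
      by (auto intro: has_vector_derivative_at_within)
  qed
  show ?thesis
    unfolding weak_sol_def
  proof (intro conjI ballI allI impI d)
    fix x y :: real assume "x \<le> y"
    then show "((\<lambda>t. c\<^sup>2 * (A * exp (c * of_real t)) - 0) has_integral
        c * (A * exp (c * of_real y)) - c * (A * exp (c * of_real x))) {x..y}"
      using d[of "c * A"] by (intro fundamental_theorem_of_calculus) (auto simp: power2_eq_square mult_ac)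
  qed
qed

text \<open>The relation w' = c w at one point singles out the pure exponential. With c = i
  \<lambda> on the right and c = - i \<lambda> on the left, a boundary condition at one point
  determines the form of the whole tail.\<close>

lemma weak_sol_exp_unique:
  assumes "weak_sol (\<lambda>_. c\<^sup>2) (\<lambda>_. 0) w w1 a b" "x0 \<in> {a..b}" "w1 x0 = c * w x0" "x \<in> {a..b}"
  shows "w x = w x0 * exp (c * of_real (x - x0))" "w1 x = c * (w x0 * exp (c * of_real (x - x0)))"
proof -
  let ?A = "w x0 * exp (- (c * of_real x0))"
  have e: "?A * exp (c * of_real x) = w x0 * exp (c * of_real (x - x0))" for x
    by (simp add: exp_diff exp_minus field_simps)
  have "w x = ?A * exp (c * of_real x) \<and> w1 x = c * (?A * exp (c * of_real x))"
    using weak_sol_unique[OF assms(1) weak_sol_exp assms(2) _ _ _ assms(4), of ?A "cmod (c\<^sup>2)"] assms(3)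
    by (simp add: e)
  then show "w x = w x0 * exp (c * of_real (x - x0))" "w1 x = c * (w x0 * exp (c * of_real (x - x0)))"
    by (auto simp: e)
qed

lemma holomorphic_comp_sq:
  assumes "h holomorphic_on UNIV"
  shows "(\<lambda>l::complex. h (l\<^sup>2)) holomorphic_on UNIV"
proof -
  have "(h \<circ> (\<lambda>l. l\<^sup>2)) holomorphic_on UNIV"
    by (rule holomorphic_on_compose_gen[OF _ assms]) (auto intro!: holomorphic_intros)
  then show ?thesis by (simp add: o_def)
qed

section \<open>The truncated potential and the meromorphic continuation of its resolvent\<close>

locale truncated_potential = bounded_potential +
  fixes M :: real
  assumes M_pos: "M > 0"
begin

abbreviation "W \<equiv> trunc M V"

lemma W_meas: "(\<lambda>t. complex_of_real (W t)) \<in> borel_measurable borel"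
proof -
  have [measurable]: "V \<in> borel_measurable borel"
    using V_cont by (rule borel_measurable_continuous_onI)
  show ?thesis unfolding trunc_def by measurable
qed

lemma W_bound: "cmod (complex_of_real (W t)) \<le> Q"
  using V_bound[of t] V_bound[of 0] by (auto simp: trunc_def)

lemma Wz_meas: "(\<lambda>t. complex_of_real (W t) - z) \<in> borel_measurable borel"
  using W_meas by simp

lemma Wz_bound: "cmod (complex_of_real (W t) - z) \<le> Q + cmod z"
  using norm_triangle_ineq4[of "complex_of_real (W t)" z] W_bound[of t] by linarith

lemma AC_inside:
  assumes "has_AC_derivs u u1 (\<lambda>t. (of_real (W t) - z) * u t - f t)"
  shows "weak_sol (\<lambda>t. of_real (V t) - z) f u u1 (- M) M"
  by (rule has_AC_derivs_weak_sol[OF assms]) (auto simp: trunc_def)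

lemma outgoing_tails:
  assumes AC: "has_AC_derivs u u1 (\<lambda>t. (of_real (W t) - l\<^sup>2) * u t - f t)"
    and f: "\<forall>t. \<bar>t\<bar> > R \<longrightarrow> f t = 0" and R: "R \<ge> M"
  shows "u1 R = \<i> * l * u R \<Longrightarrow> x \<ge> R \<Longrightarrow> u x = u R * exp (\<i> * l * of_real (x - R))"
    "u1 R = \<i> * l * u R \<Longrightarrow> x \<ge> R \<Longrightarrow> u1 x = \<i> * l * (u R * exp (\<i> * l * of_real (x - R)))"
    "u1 (- R) = - \<i> * l * u (- R) \<Longrightarrow> x \<le> - R \<Longrightarrow> u x = u (- R) * exp (- \<i> * l * of_real (x + R))"
    "u1 (- R) = - \<i> * l * u (- R) \<Longrightarrow> x \<le> - R \<Longrightarrow> u1 x = - \<i> * l * (u (- R) * exp (- \<i> * l * of_real (x + R)))"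
proof -
  have weak: "weak_sol (\<lambda>t. of_real (W t) - l\<^sup>2) f u u1 a b" for a b
    by (rule has_AC_derivs_weak_sol[OF AC]) auto
  have r: "weak_sol (\<lambda>_. (\<i> * l)\<^sup>2) (\<lambda>_. 0) u u1 R b" for b
    by (rule weak_sol_cong[OF weak]) (use f R M_pos in \<open>auto simp: trunc_def power_mult_distrib\<close>)
  have l: "weak_sol (\<lambda>_. (- \<i> * l)\<^sup>2) (\<lambda>_. 0) u u1 a (- R)" for a
    by (rule weak_sol_cong[OF weak]) (use f R M_pos in \<open>auto simp: trunc_def power_mult_distrib\<close>)
  show "u x = u R * exp (\<i> * l * of_real (x - R))"
    "u1 x = \<i> * l * (u R * exp (\<i> * l * of_real (x - R)))" if "u1 R = \<i> * l * u R" "x \<ge> R"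
    using weak_sol_exp_unique[OF r[of x], of R x] that by auto
  show "u x = u (- R) * exp (- \<i> * l * of_real (x + R))"
    "u1 x = - \<i> * l * (u (- R) * exp (- \<i> * l * of_real (x + R)))" if "u1 (- R) = - \<i> * l * u (- R)" "x \<le> - R"
    using weak_sol_exp_unique[OF l[of x], of "- R" x] that by auto
qed

text \<open>For Im \<lambda> > 0 the outgoing exponentials decay, so the solution and its first
  derivative are square-integrable; the equation passes this on to the second derivative.\<close>

lemma outgoing_resolvent_eq:
  assumes AC: "has_AC_derivs u u1 (\<lambda>t. (of_real (W t) - l\<^sup>2) * u t - f t)"
    and f: "\<forall>t. \<bar>t\<bar> > R \<longrightarrow> f t = 0" "L2 f" and R: "R \<ge> M" and l: "Im l > 0"
    and out: "u1 R = \<i> * l * u R" "u1 (- R) = - \<i> * l * u (- R)"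
  shows "resolvent_eq W (l\<^sup>2) f u"
proof -
  have R0: "R > 0" using R M_pos by simp
  note t = outgoing_tails[OF AC f(1) R]
  define A where "A = cmod (u R) + cmod (u (- R))"
  have b: "cmod (u x) \<le> A * exp (Im l * R) * exp (- Im l * \<bar>x\<bar>) \<and>
      cmod (u1 x) \<le> cmod l * A * exp (Im l * R) * exp (- Im l * \<bar>x\<bar>)" if x: "\<bar>x\<bar> \<ge> R" for x
  proof -
    have "\<exists>B. cmod B \<le> A \<and> cmod (u x) = cmod B * (exp (Im l * R) * exp (- Im l * \<bar>x\<bar>)) \<and>
      cmod (u1 x) = cmod l * cmod B * (exp (Im l * R) * exp (- Im l * \<bar>x\<bar>))"
    proof (cases "x \<ge> 0")
      case True
      then have x: "x \<ge> R" using x by simp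
      have "cmod (exp (\<i> * l * of_real (x - R))) = exp (Im l * R) * exp (- Im l * \<bar>x\<bar>)"
        using True by (simp add: norm_exp_eq_Re exp_add[symmetric] algebra_simps)
      then show ?thesis
        unfolding t(1,2)[OF out(1) x] by (intro exI[of _ "u R"]) (simp add: norm_mult A_def)
    next
      case False
      then have x: "x \<le> - R" using x by simp
      have "cmod (exp (- \<i> * l * of_real (x + R))) = exp (Im l * R) * exp (- Im l * \<bar>x\<bar>)"
        using False by (simp add: norm_exp_eq_Re exp_add[symmetric] algebra_simps)
      then show ?thesis
        unfolding t(3,4)[OF out(2) x] by (intro exI[of _ "u (- R)"]) (simp add: norm_mult A_def)
    qed
    then obtain B where B: "cmod B \<le> A" "cmod (u x) = cmod B * (exp (Im l * R) * exp (- Im l * \<bar>x\<bar>))"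
      "cmod (u1 x) = cmod l * cmod B * (exp (Im l * R) * exp (- Im l * \<bar>x\<bar>))" by blast
    show ?thesis
      unfolding B(2,3) mult.assoc[of _ "exp _"] using B(1)
      by (auto intro!: mult_right_mono mult_left_mono)
  qed
  have L: "L2 u" "L2 u1"
    by (rule exp_decay_L2[OF has_AC_derivs_cont(1)[OF AC] l], use b in blast)
      (rule exp_decay_L2[OF has_AC_derivs_cont(2)[OF AC] l], use b in blast)
  have L2: "L2 (\<lambda>t. (of_real (W t) - l\<^sup>2) * u t - f t)"
    using L2_add[OF L2_bounded_mult[OF Wz_meas Wz_bound L(1)] L2_scale[OF f(2), of "-1"]] by simp
  have "L2 (\<lambda>t. f t + l\<^sup>2 * u t)" by (intro L2_add f L2_scale L)
  moreover have "AE x in lborel. - ((of_real (W x) - l\<^sup>2) * u x - f x) + of_real (W x) * u x = f x + l\<^sup>2 * u x"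
    by (intro AE_I2) (simp add: algebra_simps)
  ultimately show ?thesis
    unfolding resolvent_eq_def schroedinger_def using AC L L2 by blast
qed

text \<open>An arbitrary choice for each z is enough, because
  \<open>schroedinger_holomorphic\<close> applies to every family of solutions with fixed
  data.\<close>

definition wsol where
  "wsol x0 f A B z = (SOME p. fst p x0 = A \<and> snd p x0 = B \<and>
     has_AC_derivs (fst p) (snd p) (\<lambda>t. (of_real (W t) - z) * fst p t - f t))"

lemma wsol:
  assumes "integrable lborel f"
  shows "fst (wsol x0 f A B z) x0 = A" "snd (wsol x0 f A B z) x0 = B"
    "has_AC_derivs (fst (wsol x0 f A B z)) (snd (wsol x0 f A B z))
      (\<lambda>t. (of_real (W t) - z) * fst (wsol x0 f A B z) t - f t)"
proof -
  obtain w w1 where "w x0 = A" "w1 x0 = B" "has_AC_derivs w w1 (\<lambda>t. (of_real (W t) - z) * w t - f t)"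
    by (rule schroedinger_ivp_exists[OF Wz_meas Wz_bound assms])
  then have "\<exists>p. fst p x0 = A \<and> snd p x0 = B \<and>
     has_AC_derivs (fst p) (snd p) (\<lambda>t. (of_real (W t) - z) * fst p t - f t)"
    by (intro exI[of _ "(w, w1)"]) auto
  from someI_ex[OF this]
  show "fst (wsol x0 f A B z) x0 = A" "snd (wsol x0 f A B z) x0 = B"
    "has_AC_derivs (fst (wsol x0 f A B z)) (snd (wsol x0 f A B z))
      (\<lambda>t. (of_real (W t) - z) * fst (wsol x0 f A B z) t - f t)"
    by (auto simp: wsol_def)
qed

lemma wsol_holomorphic:
  assumes f: "integrable lborel f"
  shows "(\<lambda>l. fst (wsol x0 f A B (l\<^sup>2)) x) holomorphic_on UNIV"
    "(\<lambda>l. snd (wsol x0 f A B (l\<^sup>2)) x) holomorphic_on UNIV"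
    "integrable lborel g \<Longrightarrow> (\<And>t. \<bar>t\<bar> > r \<Longrightarrow> g t = 0) \<Longrightarrow>
      (\<lambda>l. LINT t|lborel. g t * fst (wsol x0 f A B (l\<^sup>2)) t) holomorphic_on UNIV"
proof -
  note h = schroedinger_holomorphic[OF W_meas W_bound wsol(3)[OF f] wsol(1)[OF f] wsol(2)[OF f]]
  show "(\<lambda>l. fst (wsol x0 f A B (l\<^sup>2)) x) holomorphic_on UNIV"
    "(\<lambda>l. snd (wsol x0 f A B (l\<^sup>2)) x) holomorphic_on UNIV"
    by (rule holomorphic_comp_sq[OF h(1)] holomorphic_comp_sq[OF h(2)])+
  show "(\<lambda>l. LINT t|lborel. g t * fst (wsol x0 f A B (l\<^sup>2)) t) holomorphic_on UNIV"
    if "integrable lborel g" "\<And>t. \<bar>t\<bar> > r \<Longrightarrow> g t = 0"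
    by (rule holomorphic_comp_sq[where h = "\<lambda>z. LINT t|lborel. g t * fst (wsol x0 f A B z) t"])
      (rule h(3)[OF that(1)], rule that(2))
qed

definition psi where
  "psi R l x = fst (wsol (- R) (\<lambda>_. 0) 1 0 (l\<^sup>2)) x - \<i> * l * fst (wsol (- R) (\<lambda>_. 0) 0 1 (l\<^sup>2)) x"

definition psi1 where
  "psi1 R l x = snd (wsol (- R) (\<lambda>_. 0) 1 0 (l\<^sup>2)) x - \<i> * l * snd (wsol (- R) (\<lambda>_. 0) 0 1 (l\<^sup>2)) x"

definition src where "src R f l = fst (wsol (- R) f 0 0 (l\<^sup>2))"
definition src1 where "src1 R f l = snd (wsol (- R) f 0 0 (l\<^sup>2))"

definition jost where "jost R l = psi1 R l R - \<i> * l * psi R l R"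
definition numer where "numer R f l = src1 R f l R - \<i> * l * src R f l R"

text \<open>\<open>psi R l\<close> is outgoing at \<open>-\<infinity>\<close>, and \<open>jost R\<close> measures its failure to be outgoing at \<open>\<infinity>\<close>.
  For sources supported in \<open>[-M, M]\<close> the radius has to be \<open>M\<close> itself: the residue is computed by
  classical Wronskian identities, which are available only on the interval where the truncated
  potential is continuous.\<close>

definition radius where
  "radius f = (if \<forall>x. \<bar>x\<bar> > M \<longrightarrow> f x = (0::complex) then M
     else SOME r. r \<ge> M \<and> (\<forall>x. \<bar>x\<bar> > r \<longrightarrow> f x = 0))"

definition cont_resolvent where
  "cont_resolvent f g l = (LINT x|lborel. cnj (g x) * src (radius f) f l x)
     - numer (radius f) f l / jost (radius f) l * (LINT x|lborel. cnj (g x) * psi (radius f) l x)"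

lemma radius:
  assumes "L2_comp f"
  shows "radius f \<ge> M" "\<bar>x\<bar> > radius f \<Longrightarrow> f x = 0"
proof -
  obtain r where "\<forall>x. \<bar>x\<bar> > r \<longrightarrow> f x = 0" using assms by (auto simp: L2_comp_def)
  then have "\<exists>r. r \<ge> M \<and> (\<forall>x. \<bar>x\<bar> > r \<longrightarrow> f x = 0)"
    by (intro exI[of _ "max M r"]) auto
  from someI_ex[OF this] show "radius f \<ge> M" "\<bar>x\<bar> > radius f \<Longrightarrow> f x = 0"
    by (auto simp: radius_def split: if_splits)
qed

lemma psi:
  "has_AC_derivs (psi R l) (psi1 R l) (\<lambda>t. (of_real (W t) - l\<^sup>2) * psi R l t - 0)"
  "psi R l (- R) = 1" "psi1 R l (- R) = - \<i> * l"
proof -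
  have i: "integrable lborel (\<lambda>_::real. 0::complex)" by simp
  have "psi R l = (\<lambda>t. 1 * fst (wsol (- R) (\<lambda>_. 0) 1 0 (l\<^sup>2)) t + (- \<i> * l) * fst (wsol (- R) (\<lambda>_. 0) 0 1 (l\<^sup>2)) t)"
    "psi1 R l = (\<lambda>t. 1 * snd (wsol (- R) (\<lambda>_. 0) 1 0 (l\<^sup>2)) t + (- \<i> * l) * snd (wsol (- R) (\<lambda>_. 0) 0 1 (l\<^sup>2)) t)"
    by (auto simp: psi_def psi1_def)
  with has_AC_derivs_lincomb[OF wsol(3)[OF i, of "- R" 1 0 "l\<^sup>2"] wsol(3)[OF i, of "- R" 0 1 "l\<^sup>2"], of 1 "- \<i> * l"]
  show "has_AC_derivs (psi R l) (psi1 R l) (\<lambda>t. (of_real (W t) - l\<^sup>2) * psi R l t - 0)"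
    by (simp add: algebra_simps)
  show "psi R l (- R) = 1" "psi1 R l (- R) = - \<i> * l"
    by (simp_all add: psi_def psi1_def wsol)
qed

lemma src:
  assumes "integrable lborel f"
  shows "has_AC_derivs (src R f l) (src1 R f l) (\<lambda>t. (of_real (W t) - l\<^sup>2) * src R f l t - f t)"
    "src R f l (- R) = 0" "src1 R f l (- R) = 0"
  unfolding src_def src1_def using wsol[OF assms, of "- R" 0 0 "l\<^sup>2"] by auto

lemma cont_resolvent_holomorphic:
  assumes f: "L2_comp f" and g: "L2_comp g"
  shows "jost R holomorphic_on UNIV" "numer R f holomorphic_on UNIV"
    "(\<lambda>l. LINT x|lborel. cnj (g x) * src R f l x) holomorphic_on UNIV"
    "(\<lambda>l. LINT x|lborel. cnj (g x) * psi R l x) holomorphic_on UNIV"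
proof -
  have fi: "integrable lborel f" by (rule L2_comp_integrable[OF f])
  have i0: "integrable lborel (\<lambda>_::real. 0::complex)" by simp
  have gi: "integrable lborel (\<lambda>x. cnj (g x))" using L2_comp_integrable[OF g] by simp
  obtain r where r: "\<And>x. \<bar>x\<bar> > r \<Longrightarrow> cnj (g x) = 0" using g by (auto simp: L2_comp_def)
  show "jost R holomorphic_on UNIV"
    unfolding jost_def psi_def psi1_def
    by (intro holomorphic_intros wsol_holomorphic i0)
  show "numer R f holomorphic_on UNIV"
    unfolding numer_def src_def src1_def
    by (intro holomorphic_intros wsol_holomorphic fi)
  show "(\<lambda>l. LINT x|lborel. cnj (g x) * src R f l x) holomorphic_on UNIV"
    unfolding src_def by (intro wsol_holomorphic(3)[OF fi gi r])
  have m: "integrable lborel (\<lambda>x. cnj (g x) * fst (wsol (- R) (\<lambda>_. 0) A B (l\<^sup>2)) x)" for A B l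
    by (rule integrable_mult_continuous[OF gi, of "- r" r])
      (use r in \<open>auto intro!: has_AC_derivs_cont[OF wsol(3)[OF i0]]\<close>)
  have "(LINT x|lborel. cnj (g x) * psi R l x)
    = (LINT x|lborel. cnj (g x) * fst (wsol (- R) (\<lambda>_. 0) 1 0 (l\<^sup>2)) x)
      - \<i> * l * (LINT x|lborel. cnj (g x) * fst (wsol (- R) (\<lambda>_. 0) 0 1 (l\<^sup>2)) x)" for l
  proof -
    have "cnj (g x) * psi R l x = cnj (g x) * fst (wsol (- R) (\<lambda>_. 0) 1 0 (l\<^sup>2)) x
      - \<i> * l * (cnj (g x) * fst (wsol (- R) (\<lambda>_. 0) 0 1 (l\<^sup>2)) x)" for x
      by (simp add: psi_def algebra_simps)
    then show ?thesis using m by simp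
  qed
  moreover have "(\<lambda>l. (LINT x|lborel. cnj (g x) * fst (wsol (- R) (\<lambda>_. 0) 1 0 (l\<^sup>2)) x)
      - \<i> * l * (LINT x|lborel. cnj (g x) * fst (wsol (- R) (\<lambda>_. 0) 0 1 (l\<^sup>2)) x)) holomorphic_on UNIV"
    by (intro holomorphic_intros wsol_holomorphic(3)[OF i0 gi r])
  ultimately show "(\<lambda>l. LINT x|lborel. cnj (g x) * psi R l x) holomorphic_on UNIV" by simp
qed

text \<open>Where \<open>jost\<close> vanishes, \<open>psi\<close> is outgoing at both ends, hence
  for Im \<lambda> > 0 a nonzero solution of the homogeneous resolvent equation, against uniqueness
  in the resolvent set.\<close>

lemma jost_nonzero:
  assumes l: "Im l > 0" "l\<^sup>2 \<in> resolvent_set W" and R: "R \<ge> M"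
  shows "jost R l \<noteq> 0"
proof
  assume j: "jost R l = 0"
  have L0: "L2 (\<lambda>_. 0)" by (simp add: L2_def)
  have AC0: "has_AC_derivs (\<lambda>_. 0) (\<lambda>_. 0) (\<lambda>t. (of_real (W t) - l\<^sup>2) * 0 - 0)"
    by (auto simp: has_AC_derivs_def set_integrable_def)
  have 1: "resolvent_eq W (l\<^sup>2) (\<lambda>_. 0) (psi R l)"
    by (rule outgoing_resolvent_eq[OF psi(1) _ L0 R l(1)]) (use j in \<open>auto simp: psi jost_def\<close>)
  have 2: "resolvent_eq W (l\<^sup>2) (\<lambda>_. 0) (\<lambda>_. 0)"
    by (rule outgoing_resolvent_eq[OF AC0 _ L0 R l(1)]) auto
  have "\<exists>!u. resolvent_eq W (l\<^sup>2) (\<lambda>_. 0) u"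
    using l(2) L0 by (auto simp: resolvent_set_def)
  with 1 2 have "psi R l = (\<lambda>_. 0)" by blast
  then show False using psi(2)[of R l] by simp
qed

lemma cont_resolvent_eq:
  assumes f: "L2_comp f" and g: "L2_comp g" and l: "Im l > 0" "l\<^sup>2 \<in> resolvent_set W"
  shows "cont_resolvent f g l = L2_inner g (resolvent W (l\<^sup>2) f)"
proof -
  define R where "R = radius f"
  have R: "R \<ge> M" "\<forall>t. \<bar>t\<bar> > R \<longrightarrow> f t = 0" using radius[OF f] by (auto simp: R_def)
  have fi: "integrable lborel f" by (rule L2_comp_integrable[OF f])
  have fL: "L2 f" using f by (simp add: L2_comp_def)
  note s = src[OF fi, of R l] and p = psi[of R l]
  \<comment> \<open>The coefficient that cancels the failure of \<open>src\<close> to be outgoing at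
    R. At - R the sum is outgoing for any coefficient, since \<open>src\<close> has zero data
    there.\<close>
  define c where "c = - numer R f l / jost R l"
  have c: "numer R f l + c * jost R l = 0" using jost_nonzero[OF l R(1)] by (simp add: c_def)
  define u where "u = (\<lambda>t. 1 * src R f l t + c * psi R l t)"
  define u1 where "u1 = (\<lambda>t. 1 * src1 R f l t + c * psi1 R l t)"
  have "has_AC_derivs u u1 (\<lambda>t. 1 * ((of_real (W t) - l\<^sup>2) * src R f l t - f t)
      + c * ((of_real (W t) - l\<^sup>2) * psi R l t - 0))"
    unfolding u_def u1_def by (rule has_AC_derivs_lincomb[OF s(1) p(1)])
  then have AC: "has_AC_derivs u u1 (\<lambda>t. (of_real (W t) - l\<^sup>2) * u t - f t)"
    by (simp add: u_def algebra_simps)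
  have "u1 R - \<i> * l * u R = numer R f l + c * jost R l"
    by (simp add: u_def u1_def numer_def jost_def algebra_simps)
  then have o1: "u1 R = \<i> * l * u R" using c by simp
  have o2: "u1 (- R) = - \<i> * l * u (- R)" by (simp add: u_def u1_def s p)
  have "resolvent_eq W (l\<^sup>2) f u"
    by (rule outgoing_resolvent_eq[OF AC R(2) fL R(1) l(1) o1 o2])
  moreover have "\<exists>!u. resolvent_eq W (l\<^sup>2) f u"
    using l(2) fL by (auto simp: resolvent_set_def)
  ultimately have res: "resolvent W (l\<^sup>2) f = u"
    unfolding resolvent_def by (intro the1_equality)
  have gi: "integrable lborel (\<lambda>x. cnj (g x))" using L2_comp_integrable[OF g] by simp
  obtain r where r: "\<And>x. \<bar>x\<bar> > r \<Longrightarrow> cnj (g x) = 0" using g by (auto simp: L2_comp_def)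
  have m: "integrable lborel (\<lambda>x. cnj (g x) * h x)" if "continuous_on UNIV h" for h
    by (rule integrable_mult_continuous[OF gi, of "- r" r])
      (use r in \<open>auto intro!: continuous_on_subset[OF that]\<close>)
  note ms = m[OF has_AC_derivs_cont(1)[OF s(1)]] and mp = m[OF has_AC_derivs_cont(1)[OF p(1)]]
  have "L2_inner g u = (LINT x|lborel. cnj (g x) * src R f l x + c * (cnj (g x) * psi R l x))"
    unfolding L2_inner_def u_def by (simp add: algebra_simps)
  also have "\<dots> = (LINT x|lborel. cnj (g x) * src R f l x) + c * (LINT x|lborel. cnj (g x) * psi R l x)"
    using ms mp by simp
  finally show ?thesis unfolding res by (simp add: cont_resolvent_def R_def[symmetric] c_def)
qed

lemma cont_resolvent: "resolvent_continuation W cont_resolvent"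
  unfolding resolvent_continuation_def
proof (intro allI impI conjI)
  fix f g assume fg: "L2_comp f" "L2_comp g"
  have mer: "h meromorphic_on UNIV" if "h holomorphic_on UNIV" for h :: "complex \<Rightarrow> complex"
    using that by (intro analytic_on_imp_meromorphic_on) (simp add: analytic_on_open)
  note hol = cont_resolvent_holomorphic[OF fg, THEN mer]
  have "(\<lambda>l. (LINT x|lborel. cnj (g x) * src (radius f) f l x)
     - numer (radius f) f l / jost (radius f) l * (LINT x|lborel. cnj (g x) * psi (radius f) l x)) meromorphic_on UNIV"
    by (intro meromorphic_intros hol)
  then show "cont_resolvent f g meromorphic_on UNIV"
    unfolding cont_resolvent_def .
qed (rule cont_resolvent_eq)

end

section \<open>Poles and resonant states\<close>

lemma weak_sol_C1:
  assumes w: "weak_sol q f w w1 a b" and c: "continuous_on {a..b} (\<lambda>t. q t * w t - f t)" and x: "x \<in> {a..b}"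
  shows "(w1 has_vector_derivative q x * w x - f x) (at x within {a..b})"
proof -
  have "((\<lambda>t. w1 a + integral {a..t} (\<lambda>t. q t * w t - f t)) has_vector_derivative q x * w x - f x) (at x within {a..b})"
    using integral_has_vector_derivative[OF c x] by (auto intro!: derivative_eq_intros)
  then show ?thesis
  proof (rule has_vector_derivative_transform[OF x, rotated])
    fix t assume "t \<in> {a..b}"
    then show "w1 t = w1 a + integral {a..t} (\<lambda>t. q t * w t - f t)"
      using integral_unique[OF weak_sol_integral[OF w, of a t]] by auto
  qed
qed

lemma classical_sol_zero: "classical_sol V z (\<lambda>_. 0) (\<lambda>_. 0)"
  by (simp add: classical_sol_def)

context truncated_potential
begin

text \<open>Conservation of flux at the real point \<lambda> = 1: the Wronskian with the conjugate
  is 2 i at - M, whereas the outgoing condition at M would make it - 2 i |y M|^2. So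
  \<open>jost M\<close> is not identically zero and its zeros are isolated.\<close>

lemma jost_M_1: "jost M 1 \<noteq> 0"
proof
  assume j: "jost M 1 = 0"
  obtain y y1 where y: "y (- M) = 1" "y1 (- M) = - \<i>" "classical_sol V (of_real 1) y y1"
    by (rule classical_sol_exists)
  have "weak_sol (\<lambda>t. of_real (V t) - 1\<^sup>2) (\<lambda>_. 0) (psi M 1) (psi1 M 1) (- M) M"
    by (rule AC_inside[OF psi(1)])
  then have "weak_sol (\<lambda>t. of_real (V t) - of_real 1) (\<lambda>_. 0) (psi M 1) (psi1 M 1) (- M) M"
    by simp
  from weak_sol_unique[OF this classical_imp_weak[OF y(3)] _ _ _ q_bound, of "- M" M]
  have "psi M 1 M = y M" "psi1 M 1 M = y1 M" using y psi M_pos by auto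
  then have yM: "y1 M = \<i> * y M" using j by (simp add: jost_def)
  have "y M * cnj (y1 M) - y1 M * cnj (y M) = y (- M) * cnj (y1 (- M)) - y1 (- M) * cnj (y (- M))"
    by (rule wronskian_const[OF y(3) classical_sol_cnj[OF y(3)]])
  then have "- 2 * (\<i> * (y M * cnj (y M))) = 2 * \<i>"
    by (simp add: yM y algebra_simps)
  then have "- 2 * (\<i> * of_real ((cmod (y M))\<^sup>2)) = 2 * \<i>" by (simp only: complex_norm_square)
  then have "(cmod (y M))\<^sup>2 = - 1" by (simp add: complex_eq_iff)
  then show False by (metis not_one_le_zero neg_0_le_iff_le zero_le_power2)
qed

text \<open>The test functions \<open>f = cnj \<phi>\<close> and \<open>g = \<phi>\<close> on \<open>[-M, M]\<close> make the numerator of the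
  residue equal, up to nonzero factors, to the square of \<open>\<integral> |\<phi>|\<^sup>2\<close>.\<close>

lemma resonance_pole:
  assumes phi: "classical_sol V (l\<^sup>2) \<phi> \<phi>1"
    and out: "\<phi>1 M = \<i> * l * \<phi> M" "\<phi>1 (- M) = - \<i> * l * \<phi> (- M)" and nz: "\<phi> M \<noteq> 0"
  shows "\<exists>f g. L2_comp f \<and> L2_comp g \<and> is_pole (cont_resolvent f g) l"
proof -
  define f where "f = (\<lambda>x. indicat_real {-M..M} x *\<^sub>R cnj (\<phi> x))"
  define g where "g = (\<lambda>x. indicat_real {-M..M} x *\<^sub>R \<phi> x)"
  note pc = classical_sol_cont(1)[OF phi]
  have L2_cut: "L2_comp (\<lambda>x. indicat_real {-M..M} x *\<^sub>R h x)" if h: "continuous_on UNIV h" for h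
  proof -
    have "integrable lborel (\<lambda>x. indicat_real {-M..M} x *\<^sub>R (cmod (h x))\<^sup>2)"
      by (rule borel_integrable_compact) (auto intro!: continuous_intros continuous_on_subset[OF h])
    moreover have "(\<lambda>x. indicat_real {-M..M} x *\<^sub>R (cmod (h x))\<^sup>2) = (\<lambda>x. (cmod (indicat_real {-M..M} x *\<^sub>R h x))\<^sup>2)"
      by (auto simp: indicator_def)
    moreover have "h \<in> borel_measurable borel" using h by (rule borel_measurable_continuous_onI)
    ultimately show ?thesis
      unfolding L2_comp_def L2_def
      by (intro conjI exI[of _ M]) (auto simp: indicator_def)
  qed
  have fL: "L2_comp f" and gL: "L2_comp g"
    unfolding f_def g_def by (intro L2_cut continuous_intros pc)+
  have fi: "integrable lborel f" by (rule L2_comp_integrable[OF fL])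
  have "\<forall>x. \<bar>x\<bar> > M \<longrightarrow> f x = 0" by (auto simp: f_def indicator_def)
  then have rad: "radius f = M" by (simp add: radius_def)
  have nz': "\<phi> (- M) \<noteq> 0"
  proof
    assume "\<phi> (- M) = 0"
    then have "\<phi> = (\<lambda>_. 0)"
      using classical_sol_unique(1)[OF phi classical_sol_zero, of "- M"] out(2) by simp
    then show False using nz by simp
  qed
  define I where "I = integral {-M..M} (\<lambda>x. (cmod (\<phi> x))\<^sup>2)"
  have ic: "continuous_on {-M..M} (\<lambda>x. (cmod (\<phi> x))\<^sup>2)" by (intro continuous_intros pc)
  have I: "I \<noteq> 0"
  proof
    assume "I = 0"
    then have "((\<lambda>x. (cmod (\<phi> x))\<^sup>2) has_integral 0) (cbox (- M) M)"
      using integrable_integral[OF integrable_continuous_real[OF ic]] by (simp add: I_def)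
    from has_integral_0_cbox_imp_0[OF _ _ this, of M] show False
      using nz M_pos ic by auto
  qed
  have cI: "((\<lambda>x. \<phi> x * cnj (\<phi> x)) has_integral of_real I) {-M..M}"
  proof -
    have "((\<lambda>x. complex_of_real ((cmod (\<phi> x))\<^sup>2)) has_integral of_real I) {-M..M}"
      unfolding I_def by (rule has_integral_of_real[OF integrable_integral[OF integrable_continuous_real[OF ic]]])
    then show ?thesis by (simp only: complex_norm_square)
  qed
  note s = src[OF fi, of M l]
  have weak: "weak_sol (\<lambda>t. of_real (V t) - l\<^sup>2) (\<lambda>t. cnj (\<phi> t)) (src M f l) (src1 M f l) (- M) M"
    by (rule weak_sol_cong[OF AC_inside[OF s(1)]]) (simp add: f_def)
  \<comment> \<open>Lagrange's identity for \<phi> against the driven solution. The data of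
    \<open>src\<close> vanish at - M, so only the end M contributes, and the outgoing condition of
    \<phi> turns that term into \<phi> M times \<open>numer\<close>.\<close>
  have "((\<lambda>x. - (\<phi> x * cnj (\<phi> x))) has_integral
      (\<phi> M * src1 M f l M - \<phi>1 M * src M f l M) - (\<phi> (- M) * src1 M f l (- M) - \<phi>1 (- M) * src M f l (- M))) {-M..M}"
  proof (rule fundamental_theorem_of_calculus)
    fix x assume x: "x \<in> {-M..M}"
    have d1: "(src1 M f l has_vector_derivative (of_real (V x) - l\<^sup>2) * src M f l x - cnj (\<phi> x)) (at x within {-M..M})"
      by (rule weak_sol_C1[OF weak _ x])
        (intro continuous_intros continuous_on_subset[OF V_cont] pc weak_sol_cont[OF weak], auto)
    show "((\<lambda>x. \<phi> x * src1 M f l x - \<phi>1 x * src M f l x) has_vector_derivative - (\<phi> x * cnj (\<phi> x))) (at x within {-M..M})"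
      by (rule derivative_eq_intros d1 classical_solD[OF phi] weak_sol_deriv[OF weak x] refl)+
        (simp add: algebra_simps)
  qed (use M_pos in simp)
  then have "- of_real I = (\<phi> M * src1 M f l M - \<phi>1 M * src M f l M)"
    using has_integral_unique[OF has_integral_neg[OF cI]] by (simp add: s)
  also have "\<dots> = \<phi> M * numer M f l" by (simp add: out numer_def algebra_simps)
  finally have num: "numer M f l \<noteq> 0" using I by auto
  \<comment> \<open>Both satisfy the outgoing condition at - M, so on [-M, M] \<open>psi\<close> is
    \<phi> normalised to 1 at - M. The condition of \<phi> at M then says that \<open>jost\<close>
    vanishes.\<close>
  have psi_eq: "psi M l x = inverse (\<phi> (- M)) * \<phi> x" "psi1 M l x = inverse (\<phi> (- M)) * \<phi>1 x"
    if "x \<in> {-M..M}" for x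
    using weak_sol_unique[OF AC_inside[OF psi(1)] classical_imp_weak[OF classical_sol_scale[OF phi]] _ _ _ q_bound that,
        of "- M" M "inverse (\<phi> (- M))"] M_pos psi(2,3)[of M l] nz' out(2)
    by auto
  have j0: "jost M l = 0"
    using psi_eq[of M] M_pos by (simp add: jost_def out)
  have G: "(LINT x|lborel. cnj (g x) * psi M l x) = of_real I * inverse (\<phi> (- M))"
  proof -
    have "set_integrable lborel {-M..M} (\<lambda>x. \<phi> x * cnj (\<phi> x))"
      unfolding set_integrable_def by (rule borel_integrable_compact) (auto intro!: continuous_intros pc)
    from set_borel_integral_eq_integral(2)[OF this]
    have *: "(LINT x|lborel. indicat_real {-M..M} x *\<^sub>R (\<phi> x * cnj (\<phi> x))) = of_real I"
      using integral_unique[OF cI] by (simp add: set_lebesgue_integral_def)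
    have "(\<lambda>x. cnj (g x) * psi M l x) = (\<lambda>x. indicat_real {-M..M} x *\<^sub>R (\<phi> x * cnj (\<phi> x)) * inverse (\<phi> (- M)))"
    proof
      fix x
      show "cnj (g x) * psi M l x = indicat_real {-M..M} x *\<^sub>R (\<phi> x * cnj (\<phi> x)) * inverse (\<phi> (- M))"
        using psi_eq(1)[of x] by (cases "x \<in> {-M..M}") (simp_all add: g_def)
    qed
    then show ?thesis using * by (simp only: integral_mult_left_zero)
  qed
  note hol = cont_resolvent_holomorphic[OF fL gL, of M]
  have lim: "(h \<longlongrightarrow> h l) (at l)" if "h holomorphic_on UNIV" for h
    using holomorphic_on_imp_continuous_on[OF that] by (simp add: continuous_on_def)
  \<comment> \<open>Away from \<open>l\<close> the quotient must have a genuine nonzero denominator,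
    because division by zero yields 0 and would hide the pole.\<close>
  obtain r where r: "r > 0" "\<And>w. w \<in> ball l r - {l} \<Longrightarrow> jost M w \<noteq> 0"
    using isolated_zeros[OF hol(1) open_UNIV connected_UNIV _ j0 _ jost_M_1] by auto
  have ev: "\<forall>\<^sub>F w in at l. jost M w \<noteq> 0"
    unfolding eventually_at using r by (intro exI[of _ r]) (auto simp: dist_commute)
  have "filterlim (\<lambda>w. - (numer M f w * (LINT x|lborel. cnj (g x) * psi M w x)) / jost M w) at_infinity (at l)"
  proof (rule filterlim_divide_at_infinity)
    show "filterlim (jost M) (at 0) (at l)"
      using lim[OF hol(1)] ev by (auto simp: filterlim_at j0)
    show "((\<lambda>w. - (numer M f w * (LINT x|lborel. cnj (g x) * psi M w x))) \<longlongrightarrow>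
        - (numer M f l * (LINT x|lborel. cnj (g x) * psi M l x))) (at l)"
      by (intro tendsto_intros lim hol)
    show "- (numer M f l * (LINT x|lborel. cnj (g x) * psi M l x)) \<noteq> 0"
      using num G I nz' by simp
  qed
  \<comment> \<open>The \<open>src\<close> term is entire in \<lambda> and cannot cancel the
    blow-up, whatever the order of the zero of \<open>jost\<close>.\<close>
  from tendsto_add_filterlim_at_infinity[OF lim[OF hol(3)] this]
  have "is_pole (cont_resolvent f g) l"
    by (simp add: is_pole_def cont_resolvent_def[abs_def] rad)
  then show ?thesis using fL gL by blast
qed

text \<open>Parity turns the relation at M into its mirror image at - M, so u_z is outgoing at both
  ends. This makes \<open>csqrt z\<close> a pole, and continuing u_z from [-M, M] by exponentials
  gives the state.\<close>

lemma resonance_and_state: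
  fixes \<Phi> :: "real \<Rightarrow> complex"
  assumes ev: "even_fun V" and z: "Re z > 0" "Im z < 0"
    and res: "u_sol' V \<Phi> z M = \<i> * csqrt z * u_sol V \<Phi> z M"
  shows "is_resonance W z \<and> (\<exists>\<Phi>s. resonant_state W M z \<Phi>s \<and>
          (\<forall>\<Psi>. resonant_state W M z \<Psi> \<longrightarrow> (\<exists>c. \<forall>x. \<Psi> x = c * \<Phi>s x)) \<and>
          (\<forall>x. 0 \<le> x \<longrightarrow> x \<le> M \<longrightarrow> \<Phi>s x = u_sol V \<Phi> z x) \<and>
          (\<forall>x>M. \<Phi>s x = u_sol V \<Phi> z M * exp (\<i> * csqrt z * of_real (x - M))) \<and>
          (even_fun \<Phi> \<longrightarrow> even_fun \<Phi>s) \<and> (\<not> even_fun \<Phi> \<longrightarrow> odd_fun \<Phi>s))"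
proof
  define l where "l = csqrt z"
  have lz: "l\<^sup>2 = z" by (simp add: l_def)
  define \<phi> where "\<phi> = u_sol V \<Phi> z"
  define \<phi>1 where "\<phi>1 = u_sol' V \<Phi> z"
  have phi: "classical_sol V z \<phi> \<phi>1" unfolding \<phi>_def \<phi>1_def by (rule uv_sol(1))
  define s :: complex where "s = (if even_fun \<Phi> then 1 else - 1)"
  have par: "\<phi> (- x) = s * \<phi> x" "\<phi>1 (- x) = - s * \<phi>1 x" for x
    using u_parity[OF ev, of \<Phi> z x] by (auto simp: \<phi>_def \<phi>1_def s_def)
  have out: "\<phi>1 M = \<i> * l * \<phi> M" "\<phi>1 (- M) = - \<i> * l * \<phi> (- M)"
    using res by (auto simp: par) (auto simp: \<phi>_def \<phi>1_def l_def)
  have nz: "\<phi> M \<noteq> 0"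
    using uv_wronskian[of \<Phi> z M] out(1) by (auto simp: \<phi>_def \<phi>1_def)
  \<comment> \<open>\<open>csqrt\<close> takes values with nonnegative real part, and 2 Re l Im l =
    Im z < 0 leaves only this sign.\<close>
  have "Im l < 0"
  proof -
    have "Im z = 2 * (Re l * Im l)" by (simp add: lz[symmetric] power2_eq_square)
    then have "Re l * Im l < 0" using z by linarith
    moreover have "0 < Re l \<or> Re l = 0 \<and> 0 \<le> Im l"
      unfolding l_def by (rule csqrt_principal)
    ultimately show ?thesis by (auto simp: mult_less_0_iff)
  qed
  moreover have "\<exists>f g. L2_comp f \<and> L2_comp g \<and> is_pole (cont_resolvent f g) l"
    by (rule resonance_pole[OF _ out nz]) (simp add: lz phi)
  ultimately show "is_resonance W z"
    unfolding is_resonance_def l_def[symmetric] using cont_resolvent by blast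
  have i0: "integrable lborel (\<lambda>_::real. 0::complex)" by simp
  \<comment> \<open>u_z solves the equation for V on the line. \<open>w\<close> solves the one for
    the truncation with the same data at 0, so the two agree on [-M, M] and may part beyond
    it.\<close>
  define w where "w = fst (wsol 0 (\<lambda>_. 0) (\<phi> 0) (\<phi>1 0) z)"
  define w1 where "w1 = snd (wsol 0 (\<lambda>_. 0) (\<phi> 0) (\<phi>1 0) z)"
  have w: "w 0 = \<phi> 0" "w1 0 = \<phi>1 0" "has_AC_derivs w w1 (\<lambda>t. (of_real (W t) - z) * w t - 0)"
    unfolding w_def w1_def by (rule wsol[OF i0])+
  have w_in: "w x = \<phi> x" "w1 x = \<phi>1 x" if "x \<in> {-M..M}" for x
    using weak_sol_unique[OF AC_inside[OF w(3)] classical_imp_weak[OF phi] _ w(1,2) q_bound that] M_pos by auto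
  have wM: "w M = \<phi> M" "w1 M = \<phi>1 M" "w (- M) = \<phi> (- M)" "w1 (- M) = \<phi>1 (- M)"
    using w_in M_pos by auto
  have AC: "has_AC_derivs w w1 (\<lambda>t. (of_real (W t) - l\<^sup>2) * w t - 0)" using w(3) by (simp add: lz)
  note t = outgoing_tails[OF AC _ order_refl, simplified]
  have tr: "w x = \<phi> M * exp (\<i> * l * of_real (x - M))" "w1 x = \<i> * l * w x" if "x \<ge> M" for x
    using t(1,2)[of x] that by (auto simp: wM out)
  have tl: "w x = \<phi> (- M) * exp (- \<i> * l * of_real (x + M))" if "x \<le> - M" for x
    using t(3)[of x] that by (auto simp: wM out)
  have rs: "resonant_state W M z w"
    unfolding resonant_state_def l_def[symmetric]
  proof (intro conjI)
    show "\<exists>x. w x \<noteq> 0" using nz wM by metis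
    show "\<exists>\<Psi>1 \<Psi>2. has_AC_derivs w \<Psi>1 \<Psi>2 \<and> (AE x in lborel. - \<Psi>2 x + of_real (W x) * w x = z * w x)"
      by (intro exI conjI, rule w(3)) (auto simp: algebra_simps)
    have "w x = \<phi> M * exp (- \<i> * l * M) * exp (\<i> * l * of_real x)" if "x > M" for x
      using tr(1)[of x] that by (simp add: exp_add[symmetric] algebra_simps mult.assoc)
    then show "\<exists>c. \<forall>x>M. w x = c * exp (\<i> * l * of_real x)" by blast
    have "w x = \<phi> (- M) * exp (- \<i> * l * M) * exp (- \<i> * l * of_real x)" if "x < - M" for x
      using tl[of x] that by (simp add: exp_add[symmetric] algebra_simps mult.assoc)
    then show "\<exists>c. \<forall>x<(- M). w x = c * exp (- \<i> * l * of_real x)" by blast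
  qed
  have par_w: "w (- x) = s * w x" for x
  proof -
    have *: "w (- x) = s * w x" if "x \<ge> 0" for x
    proof (cases "x \<le> M")
      case True
      then show ?thesis using w_in(1)[of x] w_in(1)[of "- x"] that par by simp
    next
      case False
      then show ?thesis using tr(1)[of x] tl[of "- x"] par by (simp add: algebra_simps)
    qed
    have "s * s = 1" by (simp add: s_def)
    then show ?thesis
      using *[of x] *[of "- x"] by (cases "x \<ge> 0") (auto simp: mult.assoc[symmetric])
  qed
  have uniq: "\<exists>c. \<forall>x. \<Psi> x = c * w x" if \<Psi>: "resonant_state W M z \<Psi>" for \<Psi>
  proof -
    obtain \<Psi>1 \<Psi>2 c where P: "has_AC_derivs \<Psi> \<Psi>1 \<Psi>2"
      "AE x in lborel. - \<Psi>2 x + of_real (W x) * \<Psi> x = z * \<Psi> x"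
      and c: "\<And>x. x > M \<Longrightarrow> \<Psi> x = c * exp (\<i> * l * of_real x)"
      using \<Psi> unfolding resonant_state_def l_def[symmetric] by blast
    have weak: "weak_sol (\<lambda>t. of_real (W t) - z) (\<lambda>_. 0) \<Psi> \<Psi>1 a b" for a b
      by (rule has_AC_derivs_weak_sol[OF P(1)]) (use P(2) in eventually_elim, auto simp: algebra_simps)
    have ww: "weak_sol (\<lambda>t. of_real (W t) - z) (\<lambda>_. 0) w w1 a b" for a b
      by (rule has_AC_derivs_weak_sol[OF w(3)]) auto
    \<comment> \<open>A point inside the tail: \<Psi> and \<open>w\<close> are proportional around
      it, hence so are their derivatives, and uniqueness carries the factor \<open>k\<close> to the
      whole line.\<close>
    define x0 where "x0 = M + 1"
    define k where "k = c * exp (\<i> * l * M) / \<phi> M"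
    have eq: "\<Psi> x = k * w x" if "x > M" for x
      using c[OF that] tr(1)[of x] that nz
      by (simp add: k_def exp_add[symmetric] algebra_simps mult.assoc)
    have d1: "(\<Psi> has_vector_derivative \<Psi>1 x0) (at x0)" "(w has_vector_derivative w1 x0) (at x0)"
      using P(1) w(3) by (auto simp: has_AC_derivs_def)
    have "(\<Psi> has_vector_derivative k * w1 x0) (at x0)"
      by (rule has_vector_derivative_transform_within_open[OF has_vector_derivative_mult_right[OF d1(2)], of "{M<..}"])
        (auto simp: x0_def eq)
    then have "\<Psi>1 x0 = k * w1 x0" using d1(1) by (rule vector_derivative_unique_at[rotated])
    moreover have "\<Psi> x0 = k * w x0" by (rule eq) (simp add: x0_def)
    ultimately have "\<Psi> x = k * w x" for x
      using weak_sol_unique(1)[OF weak weak_sol_scale[OF ww] _ _ _ Wz_bound, of x0 "min x0 x" "max x0 x" k x]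
      by auto
    then show ?thesis by blast
  qed
  show "\<exists>\<Phi>s. resonant_state W M z \<Phi>s \<and>
          (\<forall>\<Psi>. resonant_state W M z \<Psi> \<longrightarrow> (\<exists>c. \<forall>x. \<Psi> x = c * \<Phi>s x)) \<and>
          (\<forall>x. 0 \<le> x \<longrightarrow> x \<le> M \<longrightarrow> \<Phi>s x = u_sol V \<Phi> z x) \<and>
          (\<forall>x>M. \<Phi>s x = u_sol V \<Phi> z M * exp (\<i> * csqrt z * of_real (x - M))) \<and>
          (even_fun \<Phi> \<longrightarrow> even_fun \<Phi>s) \<and> (\<not> even_fun \<Phi> \<longrightarrow> odd_fun \<Phi>s)"
    using rs uniq w_in(1) tr(1) par_w
    unfolding l_def \<phi>_def s_def even_fun_def odd_fun_def
    by (intro exI[of _ w]) (auto split: if_splits)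
qed

end

section \<open>The threshold for M and the final statement\<close>

lemma pow3_exp_tendsto_0:
  fixes k :: real
  assumes "k > 0"
  shows "((\<lambda>M. M ^ 3 * exp (- 2 * k * M)) \<longlongrightarrow> 0) at_top"
proof -
  have "filterlim (\<lambda>M. 2 * k * M) at_top at_top"
    using assms by (intro filterlim_tendsto_pos_mult_at_top[OF tendsto_const]) (auto intro: filterlim_ident)
  from filterlim_compose[OF tendsto_power_div_exp_0[of 3] this]
  have "((\<lambda>M. (2 * k * M) ^ 3 / exp (2 * k * M) / (2 * k) ^ 3) \<longlongrightarrow> 0 / (2 * k) ^ 3) at_top"
    using assms by (intro tendsto_divide tendsto_const) auto
  then show ?thesis using assms by (simp add: exp_minus field_simps)
qed

theorem corollary2p2:
  fixes V V_per V_def :: "real \<Rightarrow> real" and \<rho> E :: real and \<Phi> :: "real \<Rightarrow> complex"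
  assumes "smooth_fun V"
    and "even_fun V"
    and "\<And>x. V x = V_per x + V_def x"
    and "\<And>x. V_per (x + 1) = V_per x"
    and "\<rho> > 0"
    and "\<And>x. \<bar>x\<bar> > \<rho> \<Longrightarrow> V_def x = 0"
    and "E > 0"
    and "bound_state V E \<Phi>"
  shows "(even_fun \<Phi> \<or> odd_fun \<Phi>) \<and>
    (\<exists>k>0. \<exists>M0>\<rho>. \<exists>C. \<forall>M\<ge>M0. \<exists>z.
       Re z > 0 \<and> Im z < 0 \<and> is_resonance (trunc M V) z \<and>
       cmod (of_real (Re z) -
         (of_real E +
          (u_sol' V \<Phi> (of_real E) M * v_sol' V \<Phi> (of_real E) M
            + of_real E * u_sol V \<Phi> (of_real E) M * v_sol V \<Phi> (of_real E) M)
          / denom V \<Phi> E M)) \<le> C * (M * exp (- 4 * k * M)) \<and>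
       cmod (of_real (Im z) - (- of_real (sqrt E)) / denom V \<Phi> E M)
         \<le> C * (M * exp (- 4 * k * M)) \<and>
       (\<exists>\<Phi>s. resonant_state (trunc M V) M z \<Phi>s \<and>
          (\<forall>\<Psi>. resonant_state (trunc M V) M z \<Psi> \<longrightarrow> (\<exists>c. \<forall>x. \<Psi> x = c * \<Phi>s x)) \<and>
          (\<forall>x. 0 \<le> x \<longrightarrow> x \<le> M \<longrightarrow> \<Phi>s x = u_sol V \<Phi> z x) \<and>
          (\<forall>x>M. \<Phi>s x = u_sol V \<Phi> z M * exp (\<i> * csqrt z * of_real (x - M))) \<and>
          (even_fun \<Phi> \<longrightarrow> even_fun \<Phi>s) \<and> (odd_fun \<Phi> \<longrightarrow> odd_fun \<Phi>s)))"
proof -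
  have Vc: "continuous_on UNIV V"
    using assms(1) by (auto simp: smooth_fun_def dest!: spec[of _ 0] intro: differentiable_imp_continuous_on)
  \<comment> \<open>The threshold \<rho> + 1 keeps x and x + 1 strictly beyond \<rho>, where the
    defect vanishes.\<close>
  have per: "V (x + 1) = V x" if "x \<ge> \<rho> + 1" for x
    using assms(3)[of x] assms(3)[of "x + 1"] assms(4)[of x] assms(5) assms(6)[of x] assms(6)[of "x + 1"] that
    by simp
  have r0: "\<rho> + 1 \<ge> 0" using assms(5) by simp
  obtain Q where Q: "\<And>x. \<bar>V x\<bar> \<le> Q"
    using periodic_tail_bounded[OF Vc assms(2) per r0] by blast
  interpret bounded_potential V Q by unfold_locales (rule Vc Q)+
  note parity = bound_state_parity[OF assms(8,2)]
  obtain k C where kC: "k > 0" "C \<ge> 1"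
    and bd: "\<And>x. x \<ge> 0 \<Longrightarrow> cmod (u_sol V \<Phi> (of_real E) x) \<le> C * exp (- k * x)"
      "\<And>x. x \<ge> 0 \<Longrightarrow> cmod (u_sol' V \<Phi> (of_real E) x) \<le> C * exp (- k * x)"
      "\<And>x. x \<ge> 0 \<Longrightarrow> cmod (v_sol V \<Phi> (of_real E) x) \<le> C * exp (k * x)"
      "\<And>x. x \<ge> 0 \<Longrightarrow> cmod (v_sol' V \<Phi> (of_real E) x) \<le> C * exp (k * x)"
    using floquet_decay[OF per r0 uv_sol(1) uv_sol(2) uv_wronskian parity(3,4)] by blast
  obtain \<epsilon> K where eps: "\<epsilon> > 0" and ex: "\<And>M. M \<ge> 1 \<Longrightarrow> M ^ 3 * exp (- 2 * k * M) \<le> \<epsilon> \<Longrightarrow> \<exists>z. Re z > 0 \<and> Im z < 0 \<and>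
       u_sol' V \<Phi> z M = \<i> * csqrt z * u_sol V \<Phi> z M \<and>
       cmod (of_real (Re z) -
         (of_real E +
          (u_sol' V \<Phi> (of_real E) M * v_sol' V \<Phi> (of_real E) M
            + of_real E * u_sol V \<Phi> (of_real E) M * v_sol V \<Phi> (of_real E) M)
          / denom V \<Phi> E M)) \<le> K * (M * exp (- 2 * k * M)) \<and>
       cmod (of_real (Im z) - (- of_real (sqrt E)) / denom V \<Phi> E M)
         \<le> K * (M * exp (- 2 * k * M))"
    using resonance_exists[OF assms(7) kC bd] by blast
  have "\<forall>\<^sub>F M in at_top. M ^ 3 * exp (- 2 * k * M) < \<epsilon>"
    using order_tendstoD(2)[OF pow3_exp_tendsto_0[OF kC(1)] eps] .
  then obtain M1 where M1: "\<And>M. M \<ge> M1 \<Longrightarrow> M ^ 3 * exp (- 2 * k * M) < \<epsilon>"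
    by (auto simp: eventually_at_top_linorder)
  \<comment> \<open>Since \<rho> > 0, the second entry gives both M0 > \<rho> and M >= 1.\<close>
  define M0 where "M0 = max M1 (\<rho> + 1)"
  have main: "\<exists>z. Re z > 0 \<and> Im z < 0 \<and> is_resonance (trunc M V) z \<and>
       cmod (of_real (Re z) -
         (of_real E +
          (u_sol' V \<Phi> (of_real E) M * v_sol' V \<Phi> (of_real E) M
            + of_real E * u_sol V \<Phi> (of_real E) M * v_sol V \<Phi> (of_real E) M)
          / denom V \<Phi> E M)) \<le> K * (M * exp (- 4 * (k / 2) * M)) \<and>
       cmod (of_real (Im z) - (- of_real (sqrt E)) / denom V \<Phi> E M)
         \<le> K * (M * exp (- 4 * (k / 2) * M)) \<and>
       (\<exists>\<Phi>s. resonant_state (trunc M V) M z \<Phi>s \<and>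
          (\<forall>\<Psi>. resonant_state (trunc M V) M z \<Psi> \<longrightarrow> (\<exists>c. \<forall>x. \<Psi> x = c * \<Phi>s x)) \<and>
          (\<forall>x. 0 \<le> x \<longrightarrow> x \<le> M \<longrightarrow> \<Phi>s x = u_sol V \<Phi> z x) \<and>
          (\<forall>x>M. \<Phi>s x = u_sol V \<Phi> z M * exp (\<i> * csqrt z * of_real (x - M))) \<and>
          (even_fun \<Phi> \<longrightarrow> even_fun \<Phi>s) \<and> (odd_fun \<Phi> \<longrightarrow> odd_fun \<Phi>s))"
    if M: "M \<ge> M0" for M
  proof -
    have M': "M \<ge> 1" "M > 0" "M \<ge> M1" using M assms(5) by (auto simp: M0_def)
    interpret truncated_potential V Q M by unfold_locales (rule M'(2))
    obtain z where z: "Re z > 0" "Im z < 0" "u_sol' V \<Phi> z M = \<i> * csqrt z * u_sol V \<Phi> z M"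
      and le: "cmod (of_real (Re z) -
         (of_real E +
          (u_sol' V \<Phi> (of_real E) M * v_sol' V \<Phi> (of_real E) M
            + of_real E * u_sol V \<Phi> (of_real E) M * v_sol V \<Phi> (of_real E) M)
          / denom V \<Phi> E M)) \<le> K * (M * exp (- 2 * k * M))"
       "cmod (of_real (Im z) - (- of_real (sqrt E)) / denom V \<Phi> E M)
         \<le> K * (M * exp (- 2 * k * M))"
      using ex[OF M'(1) less_imp_le[OF M1[OF M'(3)]]] by blast
    \<comment> \<open>The rate in the statement is half of the Floquet rate.\<close>
    have e: "- 4 * (k / 2) * M = - 2 * k * M" by simp
    \<comment> \<open>\<Phi> is nonzero, so the parities exclude each other, and the else-branch of
      \<open>u_sol\<close> is exactly the odd case.\<close>
    have "odd_fun \<Phi> \<Longrightarrow> \<not> even_fun \<Phi>" using parity(2) by blast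
    then show ?thesis
      unfolding e using resonance_and_state[OF assms(2) z] z(1,2) le by blast
  qed
  have "k / 2 > 0" "M0 > \<rho>" using kC(1) by (auto simp: M0_def)
  then show ?thesis using parity(1) main by blast
qed

end
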